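(* Let $\Omega\subset\mathbb{R}^n$ be a smooth bounded domain, $s\in(0,1)$, $n>ps$, $1<q<p$, and let $\alpha>1$, $\beta>1$ satisfy $p<\alpha+\beta<p^\star=\frac{np}{n-ps}$. Suppose the weight functions $f,g,h$ satisfy conditions (A) and (B) stated in the context. Then for each $(\lambda,\mu)\in\Theta$ the system $$\begin{cases}(-\Delta)_p^s u=\lambda f(x)|u|^{q-2}u+\frac{2\alpha}{\alpha+\beta}h(x)|u|^{\alpha-2}u|v|^{\beta} & \text{in }\Omega,\\ (-\Delta)_p^s v=\mu g(x)|v|^{q-2}v+\frac{2\beta}{\alpha+\beta}h(x)|u|^{\alpha}|v|^{\beta-2}v & \text{in }\Omega,\\ u=v=0 & \text{in }\mathbb{R}^n\setminus\Omega\end{cases}$$ has at least one nontrivial solution in $W^{s,p}(\Omega)\times W^{s,p}(\Omega)$.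
   Context: All functions are real-valued. Conditions on the weights: (A) $f,g\in L^{q^\star}(\Omega)$ with $q^\star=\frac{\alpha+\beta}{\alpha+\beta-q}$, and either $f^{\pm}=\max\{\pm f,0\}\neq0$ (both $f^+$ and $f^-$ are not a.e. zero) or $g^{\pm}=\max\{\pm g,0\}\neq0$ (both $g^+$ and $g^-$ are not a.e. zero). (B) $h\in C(\overline\Omega)$, $\|h\|_\infty=1$, $h\ge0$. The fractional $p$-Laplacian is $(-\Delta)_p^s u(x)=2\lim_{\epsilon\to0}\int_{\mathbb{R}^n\setminus B_\epsilon(x)}\frac{|u(x)-u(y)|^{p-2}(u(x)-u(y))}{|x-y|^{n+ps}}\,dy$. $W^{s,p}(\Omega)$ is the fractional Sobolev space with norm $\|u\|_{L^p(\Omega)}+\left(\int_{\Omega\times\Omega}\frac{|u(x)-u(y)|^p}{|x-y|^{n+ps}}dxdy\right)^{1/p}$. Let $Q=\mathbb{R}^{2n}\setminus(\mathcal{C}_\Omega\times\mathcal{C}_\Omega)$, $\mathcal{C}_\Omega=\mathbb{R}^n\setminus\Omega$. Let $X$ be the space of measurable $u:\mathbb{R}^n\to\mathbb{R}$ with $\int_Q\frac{|u(x)-u(y)|^p}{|x-y|^{n+ps}}dxdy<\infty$, with norm $\|u\|_X=\|u\|_{L^p(\Omega)}+\left(\int_Q\frac{|u(x)-u(y)|^p}{|x-y|^{n+ps}}dxdy\right)^{1/p}$; $X_0$ is the closure of $C_0^\infty(\Omega)$ in $X$, with norm $\|u\|_{X_0}=\left(\int_Q\frac{|u(x)-u(y)|^p}{|x-y|^{n+ps}}dxdy\right)^{1/p}$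 (elements of $X_0$ vanish a.e. outside $\Omega$). Let $E=X_0\times X_0$. Solutions are weak solutions: $(u,v)\in E$ is a (weak) solution if for all $(\varphi_1,\varphi_2)\in E$, $$\int_Q\frac{|u(x)-u(y)|^{p-2}(u(x)-u(y))(\varphi_1(x)-\varphi_1(y))}{|x-y|^{n+ps}}dxdy+\int_Q\frac{|v(x)-v(y)|^{p-2}(v(x)-v(y))(\varphi_2(x)-\varphi_2(y))}{|x-y|^{n+ps}}dxdy$$ $$=\int_\Omega(\lambda f|u|^{q-2}u\varphi_1+\mu g|v|^{q-2}v\varphi_2)dx+\frac{2\alpha}{\alpha+\beta}\int_\Omega h|u|^{\alpha-2}u|v|^\beta\varphi_1dx+\frac{2\beta}{\alpha+\beta}\int_\Omega h|u|^\alpha|v|^{\beta-2}v\varphi_2dx.$$ Nontrivial means $(u,v)\ne(0,0)$. $S=\inf_{u\in X_0\setminus\{0\}}\frac{\|u\|_{X_0}^p}{\left(\int_\Omega|u|^{\alpha+\beta}dx\right)^{p/(\alpha+\beta)}}$ is the best Sobolev constant of $X_0\hookrightarrow L^{\alpha+\beta}(\Omega)$, and $$\Theta=\left\{(\lambda,\mu)\in\mathbb{R}^2\setminus\{(0,0)\}:\ 0<(|\lambda|\|f\|_{L^{q^\star}})^{\frac{p}{p-q}}+(|\mu|\|g\|_{L^{q^\star}})^{\frac{p}{p-q}}<C(\alpha,\beta,p,q,S)\right\},$$ $$C(\alpha,\beta,p,q,S)=\left[\frac{p-q}{2(\alpha+\beta-q)}S^{\frac{\alpha+\beta}{p}}\right]^{\frac{p}{\alpha+\beta-p}}\left(S^{-\frac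 qp}\frac{\alpha+\beta-q}{\alpha+\beta-p}\right)^{-\frac{p}{p-q}}.$$ *)

theory Defs
  imports "HOL-Analysis.Analysis"
begin

text \<open>Intended for open \<open>U\<close>: iterated directional derivatives up to order \<open>k\<close> exist, and those of
  order \<open>k\<close> are continuous; the lower ones are continuous because they are differentiable.\<close>

primrec Ck_on :: "nat \<Rightarrow> (real^'n) set \<Rightarrow> (real^'n \<Rightarrow> real) \<Rightarrow> bool" where
  "Ck_on 0 U f \<longleftrightarrow> continuous_on U f"
| "Ck_on (Suc k) U f \<longleftrightarrow>
     (\<forall>x\<in>U. f differentiable (at x)) \<and>
     (\<forall>w. Ck_on k U (\<lambda>x. frechet_derivative f (at x) w))"

definition smooth_fun_on :: "(real^'n) set \<Rightarrow> (real^'n \<Rightarrow> real) \<Rightarrow> bool" where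
  "smooth_fun_on U f \<longleftrightarrow> (\<forall>k. Ck_on k U f)"

text \<open>The boundary is described by local defining functions with nonvanishing differential;
  the domain lies on one side of its boundary.\<close>

definition smooth_boundary :: "(real^'n) set \<Rightarrow> bool" where
  "smooth_boundary \<Omega> \<longleftrightarrow>
     (\<forall>x\<in>frontier \<Omega>. \<exists>U \<rho>. open U \<and> x \<in> U \<and> smooth_fun_on U \<rho> \<and>
        (\<forall>y\<in>U. frechet_derivative \<rho> (at y) \<noteq> (\<lambda>w. 0)) \<and>
        \<Omega> \<inter> U = {y \<in> U. \<rho> y < 0})"

definition smooth_bounded_domain :: "(real^'n) set \<Rightarrow> bool" where
  "smooth_bounded_domain \<Omega> \<longleftrightarrow>
     open \<Omega> \<and> connected \<Omega> \<and> \<Omega> \<noteq> {} \<and> bounded \<Omega> \<and> smooth_boundary \<Omega>"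

definition test_functions :: "(real^'n) set \<Rightarrow> (real^'n \<Rightarrow> real) set" where
  "test_functions \<Omega> =
     {\<phi>. smooth_fun_on UNIV \<phi> \<and>
         compact (closure {x. \<phi> x \<noteq> 0}) \<and> closure {x. \<phi> x \<noteq> 0} \<subseteq> \<Omega>}"

text \<open>Functions are total on \<open>real^'n\<close> and are not quotiented by a.e. equality; the
  norms below are therefore seminorms, and being zero or nonzero in a space is expressed by \<open>AE\<close>.
  Since \<open>0 powr a = 0\<close> for all \<open>a\<close>, the term \<open>\<bar>t\<bar> powr (a - 2) * t\<close> vanishes at \<open>t = 0\<close>,
  also for \<open>a < 2\<close>.\<close>

definition Lp_on :: "real \<Rightarrow> (real^'n) set \<Rightarrow> (real^'n \<Rightarrow> real) set" where
  "Lp_on r \<Omega> = {f. set_borel_measurable lebesgue \<Omega> f \<and>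
                    set_integrable lebesgue \<Omega> (\<lambda>x. \<bar>f x\<bar> powr r)}"

definition Lp_norm_on :: "real \<Rightarrow> (real^'n) set \<Rightarrow> (real^'n \<Rightarrow> real) \<Rightarrow> real" where
  "Lp_norm_on r \<Omega> f = (set_lebesgue_integral lebesgue \<Omega> (\<lambda>x. \<bar>f x\<bar> powr r)) powr (1 / r)"

definition frac_kernel :: "real \<Rightarrow> real \<Rightarrow> real^'n \<Rightarrow> real^'n \<Rightarrow> real" where
  "frac_kernel s p x y = norm (x - y) powr (real CARD('n) + p * s)"

definition gagliardo_integrand ::
  "real \<Rightarrow> real \<Rightarrow> (real^'n \<Rightarrow> real) \<Rightarrow> (real^'n) \<times> (real^'n) \<Rightarrow> real" where
  "gagliardo_integrand s p u = (\<lambda>(x, y). \<bar>u x - u y\<bar> powr p / frac_kernel s p x y)"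

definition W_sp :: "real \<Rightarrow> real \<Rightarrow> (real^'n) set \<Rightarrow> (real^'n \<Rightarrow> real) set" where
  "W_sp s p \<Omega> = {u \<in> Lp_on p \<Omega>. set_integrable lebesgue (\<Omega> \<times> \<Omega>) (gagliardo_integrand s p u)}"

definition Q_set :: "(real^'n) set \<Rightarrow> ((real^'n) \<times> (real^'n)) set" where
  "Q_set \<Omega> = UNIV - (- \<Omega>) \<times> (- \<Omega>)"

text \<open>For bounded open \<open>\<Omega>\<close> the condition \<open>u \<in> Lp_on p \<Omega>\<close> follows from the other two. It is
  included so that \<open>X_norm\<close> is visibly the intended finite quantity.\<close>

definition X_space :: "real \<Rightarrow> real \<Rightarrow> (real^'n) set \<Rightarrow> (real^'n \<Rightarrow> real) set" where
  "X_space s p \<Omega> = {u \<in> borel_measurable lebesgue. u \<in> Lp_on p \<Omega> \<and>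
                       set_integrable lebesgue (Q_set \<Omega>) (gagliardo_integrand s p u)}"

definition X0_norm :: "real \<Rightarrow> real \<Rightarrow> (real^'n) set \<Rightarrow> (real^'n \<Rightarrow> real) \<Rightarrow> real" where
  "X0_norm s p \<Omega> u =
     (set_lebesgue_integral lebesgue (Q_set \<Omega>) (gagliardo_integrand s p u)) powr (1 / p)"

definition X_norm :: "real \<Rightarrow> real \<Rightarrow> (real^'n) set \<Rightarrow> (real^'n \<Rightarrow> real) \<Rightarrow> real" where
  "X_norm s p \<Omega> u = Lp_norm_on p \<Omega> u + X0_norm s p \<Omega> u"

definition X0_space :: "real \<Rightarrow> real \<Rightarrow> (real^'n) set \<Rightarrow> (real^'n \<Rightarrow> real) set" where
  "X0_space s p \<Omega> =
     {u \<in> X_space s p \<Omega>. \<forall>\<epsilon>>0. \<exists>\<phi>\<in>test_functions \<Omega>. X_norm s p \<Omega> (\<lambda>x. u x - \<phi> x) < \<epsilon>}"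

definition q_star :: "real \<Rightarrow> real \<Rightarrow> real \<Rightarrow> real" where
  "q_star \<alpha> \<beta> q = (\<alpha> + \<beta>) / (\<alpha> + \<beta> - q)"

definition changes_sign_on :: "(real^'n) set \<Rightarrow> (real^'n \<Rightarrow> real) \<Rightarrow> bool" where
  "changes_sign_on \<Omega> f \<longleftrightarrow>
     \<not> (AE x in lebesgue. x \<in> \<Omega> \<longrightarrow> max (f x) 0 = 0) \<and>
     \<not> (AE x in lebesgue. x \<in> \<Omega> \<longrightarrow> max (- f x) 0 = 0)"

definition weight_cond_A ::
  "(real^'n) set \<Rightarrow> real \<Rightarrow> real \<Rightarrow> real \<Rightarrow> (real^'n \<Rightarrow> real) \<Rightarrow> (real^'n \<Rightarrow> real) \<Rightarrow> bool" where
  "weight_cond_A \<Omega> q \<alpha> \<beta> f g \<longleftrightarrow>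
     f \<in> Lp_on (q_star \<alpha> \<beta> q) \<Omega> \<and> g \<in> Lp_on (q_star \<alpha> \<beta> q) \<Omega> \<and>
     (changes_sign_on \<Omega> f \<or> changes_sign_on \<Omega> g)"

definition weight_cond_B :: "(real^'n) set \<Rightarrow> (real^'n \<Rightarrow> real) \<Rightarrow> bool" where
  "weight_cond_B \<Omega> h \<longleftrightarrow>
     continuous_on (closure \<Omega>) h \<and> (SUP x\<in>closure \<Omega>. \<bar>h x\<bar>) = 1 \<and> (\<forall>x\<in>closure \<Omega>. 0 \<le> h x)"

definition sobolev_const :: "real \<Rightarrow> real \<Rightarrow> (real^'n) set \<Rightarrow> real \<Rightarrow> real \<Rightarrow> real" where
  "sobolev_const s p \<Omega> \<alpha> \<beta> =
     (INF u \<in> {u \<in> X0_space s p \<Omega>. \<not> (AE x in lebesgue. u x = 0)}.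
        X0_norm s p \<Omega> u powr p /
        (set_lebesgue_integral lebesgue \<Omega> (\<lambda>x. \<bar>u x\<bar> powr (\<alpha> + \<beta>))) powr (p / (\<alpha> + \<beta>)))"

definition C_const :: "real \<Rightarrow> real \<Rightarrow> real \<Rightarrow> real \<Rightarrow> real \<Rightarrow> real" where
  "C_const \<alpha> \<beta> p q S =
     ((p - q) / (2 * (\<alpha> + \<beta> - q)) * S powr ((\<alpha> + \<beta>) / p)) powr (p / (\<alpha> + \<beta> - p)) *
     (S powr (- q / p) * ((\<alpha> + \<beta> - q) / (\<alpha> + \<beta> - p))) powr (- (p / (p - q)))"

definition Theta_set ::
  "real \<Rightarrow> real \<Rightarrow> real \<Rightarrow> (real^'n) set \<Rightarrow> real \<Rightarrow> real \<Rightarrow>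
   (real^'n \<Rightarrow> real) \<Rightarrow> (real^'n \<Rightarrow> real) \<Rightarrow> (real \<times> real) set" where
  "Theta_set s p q \<Omega> \<alpha> \<beta> f g =
     {(l, m). (l, m) \<noteq> (0, 0) \<and>
        (let N = (\<bar>l\<bar> * Lp_norm_on (q_star \<alpha> \<beta> q) \<Omega> f) powr (p / (p - q)) +
                 (\<bar>m\<bar> * Lp_norm_on (q_star \<alpha> \<beta> q) \<Omega> g) powr (p / (p - q))
         in 0 < N \<and> N < C_const \<alpha> \<beta> p q (sobolev_const s p \<Omega> \<alpha> \<beta>))}"

definition frac_form ::
  "real \<Rightarrow> real \<Rightarrow> (real^'n) set \<Rightarrow> (real^'n \<Rightarrow> real) \<Rightarrow> (real^'n \<Rightarrow> real) \<Rightarrow> real" where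
  "frac_form s p \<Omega> u \<phi> =
     set_lebesgue_integral lebesgue (Q_set \<Omega>)
       (\<lambda>(x, y). \<bar>u x - u y\<bar> powr (p - 2) * (u x - u y) * (\<phi> x - \<phi> y) / frac_kernel s p x y)"

text \<open>The exterior condition \<open>u = v = 0\<close> is contained in membership in \<open>X0_space\<close>.
  On \<open>X0_space\<close>, under the assumptions on the exponents and weights, every integral below
  converges absolutely (Hoelder and Sobolev), so the default value \<open>0\<close> of the integral of a
  non-integrable function never enters.\<close>

definition weak_solution ::
  "real \<Rightarrow> real \<Rightarrow> real \<Rightarrow> (real^'n) set \<Rightarrow> real \<Rightarrow> real \<Rightarrow>
   (real^'n \<Rightarrow> real) \<Rightarrow> (real^'n \<Rightarrow> real) \<Rightarrow> (real^'n \<Rightarrow> real) \<Rightarrow> real \<Rightarrow> real \<Rightarrow>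
   (real^'n \<Rightarrow> real) \<Rightarrow> (real^'n \<Rightarrow> real) \<Rightarrow> bool" where
  "weak_solution s p q \<Omega> \<alpha> \<beta> f g h l m u v \<longleftrightarrow>
     u \<in> X0_space s p \<Omega> \<and> v \<in> X0_space s p \<Omega> \<and>
     (\<forall>\<phi>1\<in>X0_space s p \<Omega>. \<forall>\<phi>2\<in>X0_space s p \<Omega>.
        frac_form s p \<Omega> u \<phi>1 + frac_form s p \<Omega> v \<phi>2 =
          set_lebesgue_integral lebesgue \<Omega>
            (\<lambda>x. l * f x * \<bar>u x\<bar> powr (q - 2) * u x * \<phi>1 x +
                 m * g x * \<bar>v x\<bar> powr (q - 2) * v x * \<phi>2 x) +
          2 * \<alpha> / (\<alpha> + \<beta>) *
            set_lebesgue_integral lebesgue \<Omega>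
              (\<lambda>x. h x * \<bar>u x\<bar> powr (\<alpha> - 2) * u x * \<bar>v x\<bar> powr \<beta> * \<phi>1 x) +
          2 * \<beta> / (\<alpha> + \<beta>) *
            set_lebesgue_integral lebesgue \<Omega>
              (\<lambda>x. h x * \<bar>u x\<bar> powr \<alpha> * \<bar>v x\<bar> powr (\<beta> - 2) * v x * \<phi>2 x))"

end

theory Submission
  imports Defs "HOL-Complex_Analysis.Great_Picard"
begin

text \<open>
  The system is the Euler--Lagrange system of \<open>J = A / p - K / q - B / r\<close> on pairs \<open>(u, v)\<close> of functions
  in \<open>X\<^sub>0\<close>, with \<open>r = \<alpha> + \<beta>\<close>, where \<open>A\<close> is the sum of the energies of \<open>u\<close> and \<open>v\<close>, \<open>K\<close> is the integral of
  \<open>\<lambda> f \<bar>u\<bar>\<^sup>q + \<mu> g \<bar>v\<bar>\<^sup>q\<close>, and \<open>B\<close> is twice the integral of \<open>h \<bar>u\<bar>\<^sup>\<alpha> \<bar>v\<bar>\<^sup>\<beta>\<close>. These are homogeneous of degrees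
  \<open>q < p < r\<close>, and a nontrivial critical point of \<open>J\<close> is found in one of two ways.

  If \<open>K\<close> is positive somewhere, then \<open>J\<close> is negative near the origin of some ray. The bound on the
  parameters says that \<open>A - K - B\<close>, the radial derivative of \<open>J\<close>, is positive on a certain sphere
  \<open>A = T\<close> (\<open>threshold_inequality\<close>), so the minimum of \<open>J\<close> over the ball \<open>A \<le> T\<close> is negative and is
  attained inside the ball (\<open>critical_point_ball\<close>). If \<open>K\<close> is nowhere positive, as happens for
  \<open>\<lambda> = 0\<close> and \<open>\<mu> g \<le> 0\<close>, every ray on which \<open>B\<close> is positive meets the Nehari set \<open>A = K + B\<close> exactly once,
  and a minimizer of \<open>J\<close> on that set is critical (\<open>critical_point_Nehari\<close>).

  Both minimizations rest on compactness (\<open>X0_compact\<close>): a sequence of bounded energy has a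
  subsequence that converges almost everywhere and below a common majorant in \<open>L\<^sup>r\<close> to an element
  of \<open>X\<^sub>0\<close> whose energy does not exceed the limit of the energies. Two ideas carry it. First,
  replacing a function by its averages over dyadic cubes of side \<open>1 / 2\<^sup>k\<close> costs little in \<open>L\<^sup>p\<close>; the
  change from one level to the next is constant on small cubes, so that \<open>L\<^sup>p\<close> bounds turn into \<open>L\<^sup>r\<close>
  bounds, and below the critical exponent these sum to a geometric series
  (\<open>dyadic_approximation\<close>). Secondly, the limit belongs to the closure of the test functions because
  near-minimizers of the energy among functions close to the limit converge in energy, by uniform
  convexity (\<open>X0_closed\<close>).

  The Sobolev inequality with the sharp constant \<open>S\<close> enters through the set of admissible parameters,
  which is empty for \<open>S = 0\<close>; for \<open>S > 0\<close> the inequality is the definition of \<open>S\<close>.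
\<close>

section \<open>Powers of absolute values\<close>

lemma abs_add_powr_le:
  fixes a b r :: real
  assumes "0 \<le> r"
  shows "\<bar>a + b\<bar> powr r \<le> 2 powr r * (\<bar>a\<bar> powr r + \<bar>b\<bar> powr r)"
proof -
  have "\<bar>a + b\<bar> powr r \<le> (2 * max \<bar>a\<bar> \<bar>b\<bar>) powr r"
    using assms by (intro powr_mono2) auto
  also have "\<dots> = 2 powr r * (max \<bar>a\<bar> \<bar>b\<bar>) powr r"
    by (intro powr_mult)
  also have "\<dots> \<le> 2 powr r * (\<bar>a\<bar> powr r + \<bar>b\<bar> powr r)"
    by (intro mult_left_mono) (auto simp: max_def)
  finally show ?thesis .
qed

lemma abs_diff_powr_le:
  fixes a b r :: real
  assumes "0 \<le> r"
  shows "\<bar>a - b\<bar> powr r \<le> 2 powr r * (\<bar>a\<bar> powr r + \<bar>b\<bar> powr r)"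
  using abs_add_powr_le[OF assms, of a "- b"] by simp

lemma abs_powr_minus_2_times:
  fixes t r :: real
  shows "\<bar>t\<bar> powr (r - 2) * t * t = \<bar>t\<bar> powr r"
proof (cases "t = 0")
  case False
  have "t * t = \<bar>t\<bar> powr 2"
    using False by (simp add: powr_numeral power2_eq_square abs_mult_self_eq)
  then have "\<bar>t\<bar> powr (r - 2) * t * t = \<bar>t\<bar> powr (r - 2) * \<bar>t\<bar> powr 2"
    by (simp add: mult.assoc)
  also have "\<dots> = \<bar>t\<bar> powr ((r - 2) + 2)"
    by (simp only: powr_add)
  finally show ?thesis by simp
qed simp

lemma abs_powr_le_1_plus:
  fixes t a b :: real
  assumes "0 < a" "a \<le> b"
  shows "\<bar>t\<bar> powr a \<le> 1 + \<bar>t\<bar> powr b"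
proof (cases "\<bar>t\<bar> \<le> 1")
  case True
  then have "\<bar>t\<bar> powr a \<le> 1 powr a" using assms by (intro powr_mono2) auto
  then show ?thesis using powr_ge_zero[of "\<bar>t\<bar>" b] unfolding powr_one_eq_one by linarith
next
  case False
  then have "\<bar>t\<bar> powr a \<le> \<bar>t\<bar> powr b" using assms by (intro powr_mono) auto
  then show ?thesis by simp
qed

lemma abs_abs_powr_minus_2_times:
  fixes t r :: real
  shows "\<bar>\<bar>t\<bar> powr (r - 2) * t\<bar> = \<bar>t\<bar> powr (r - 1)"
proof (cases "t = 0")
  case False
  have "\<bar>\<bar>t\<bar> powr (r - 2) * t\<bar> = \<bar>t\<bar> powr (r - 2) * \<bar>t\<bar> powr 1"
    using False by (simp add: abs_mult)
  also have "\<dots> = \<bar>t\<bar> powr ((r - 2) + 1)"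
    by (simp only: powr_add)
  finally show ?thesis by simp
qed simp

text \<open>At the origin the difference quotient is \<open>\<bar>h\<bar> powr (r - 1)\<close> up to sign, which tends to zero as
  \<open>r > 1\<close>; away from the origin the sign of the argument is locally constant.\<close>

lemma DERIV_abs_powr:
  fixes r t :: real
  assumes "1 < r"
  shows "((\<lambda>t. \<bar>t\<bar> powr r) has_real_derivative r * (\<bar>t\<bar> powr (r - 2) * t)) (at t)"
proof -
  consider "t > 0" | "t < 0" | "t = 0" by linarith
  then show ?thesis
  proof cases
    case 1
    have "((\<lambda>z. z powr r) has_real_derivative r * t powr (r - 1)) (at t)"
      using 1 by (rule has_real_derivative_powr)
    moreover have "t powr (r - 1) = \<bar>t\<bar> powr (r - 2) * t"
      using 1 powr_add[of t "r - 2" 1] by simp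
    moreover have "eventually (\<lambda>z. \<bar>z\<bar> powr r = z powr r) (nhds t)"
      using eventually_nhds_in_open[of "{0<..}" t] 1 by (auto elim: eventually_mono)
    ultimately show ?thesis
      by (subst DERIV_cong_ev[OF refl _ refl]) auto
  next
    case 2
    have "((\<lambda>z. (- z) powr r) has_real_derivative (r * (- t) powr (r - 1)) * (- 1)) (at t)"
      by (rule DERIV_chain2[OF has_real_derivative_powr])
        (use 2 in \<open>auto intro!: derivative_eq_intros\<close>)
    moreover have "(r * (- t) powr (r - 1)) * (- 1) = r * (\<bar>t\<bar> powr (r - 2) * t)"
      using 2 powr_add[of "- t" "r - 2" 1] by simp
    moreover have "eventually (\<lambda>z. \<bar>z\<bar> powr r = (- z) powr r) (nhds t)"
      using eventually_nhds_in_open[of "{..<0}" t] 2 by (auto elim: eventually_mono)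
    ultimately show ?thesis
      by (subst DERIV_cong_ev[OF refl _ refl]) auto
  next
    case 3
    have "((\<lambda>h. \<bar>h\<bar> powr (r - 1)) \<longlongrightarrow> 0 powr (r - 1)) (at (0::real))"
      using assms by (intro tendsto_powr') (auto intro!: tendsto_eq_intros)
    then have "((\<lambda>h. \<bar>h\<bar> powr (r - 1)) \<longlongrightarrow> 0) (at (0::real))"
      by simp
    moreover have "\<bar>\<bar>h\<bar> powr r / h\<bar> = \<bar>h\<bar> powr (r - 1)" for h :: real
      using powr_diff[of "\<bar>h\<bar>" r 1] by (cases "h = 0") (auto simp: abs_divide)
    ultimately have "((\<lambda>h. \<bar>\<bar>h\<bar> powr r / h\<bar>) \<longlongrightarrow> 0) (at (0::real))"
      by simp
    then have "((\<lambda>h. \<bar>h\<bar> powr r / h) \<longlongrightarrow> 0) (at (0::real))"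
      by (rule tendsto_rabs_zero_cancel)
    then show ?thesis
      using 3 by (simp add: has_field_derivative_iff)
  qed
qed

lemma powr_deriv_strict_mono:
  fixes a b r :: real
  assumes "1 < r" "a < b"
  shows "\<bar>a\<bar> powr (r - 2) * a < \<bar>b\<bar> powr (r - 2) * b"
proof -
  have *: "\<bar>t\<bar> powr (r - 2) * t = sgn t * \<bar>t\<bar> powr (r - 1)" for t :: real
    using abs_abs_powr_minus_2_times[of t r]
    by (cases "t = 0"; cases "t > 0") (auto simp: abs_mult sgn_if)
  consider "0 \<le> a" | "a < 0" "0 \<le> b" | "b < 0" by linarith
  then show ?thesis
  proof cases
    case 1
    then show ?thesis
      unfolding * using assms powr_less_mono2[of "r - 1" a b] by (cases "a = 0") (auto simp: sgn_if)
  next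
    case 2
    then have "\<bar>a\<bar> powr (r - 2) * a < 0"
      by (simp add: mult_pos_neg)
    moreover have "0 \<le> \<bar>b\<bar> powr (r - 2) * b"
      using 2 by simp
    ultimately show ?thesis by linarith
  next
    case 3
    then show ?thesis
      unfolding * using assms powr_less_mono2[of "r - 1" "- b" "- a"] by (auto simp: sgn_if)
  qed
qed

text \<open>The mean value theorem on both halves of the interval, with the strictly increasing derivative.\<close>

lemma powr_midpoint_less:
  fixes a b r :: real
  assumes "1 < r" "a \<noteq> b"
  shows "\<bar>(a + b) / 2\<bar> powr r < (\<bar>a\<bar> powr r + \<bar>b\<bar> powr r) / 2"
proof -
  have main: "\<bar>(a + b) / 2\<bar> powr r < (\<bar>a\<bar> powr r + \<bar>b\<bar> powr r) / 2" if "a < b" for a b :: real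
  proof -
    define m where "m = (a + b) / 2"
    have m: "a < m" "m < b" using that by (auto simp: m_def)
    obtain x where x: "a < x" "x < m"
      "\<bar>m\<bar> powr r - \<bar>a\<bar> powr r = (m - a) * (r * (\<bar>x\<bar> powr (r - 2) * x))"
      using MVT2[OF m(1) DERIV_abs_powr[OF assms(1)]] by blast
    obtain y where y: "m < y" "y < b"
      "\<bar>b\<bar> powr r - \<bar>m\<bar> powr r = (b - m) * (r * (\<bar>y\<bar> powr (r - 2) * y))"
      using MVT2[OF m(2) DERIV_abs_powr[OF assms(1)]] by blast
    have "\<bar>x\<bar> powr (r - 2) * x < \<bar>y\<bar> powr (r - 2) * y"
      using powr_deriv_strict_mono assms x y by simp
    then have "(m - a) * (r * (\<bar>x\<bar> powr (r - 2) * x)) < (m - a) * (r * (\<bar>y\<bar> powr (r - 2) * y))"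
      using m assms by (intro mult_strict_left_mono) auto
    moreover have "b - m = m - a" by (simp add: m_def field_simps)
    ultimately show ?thesis
      using x(3) y(3) unfolding m_def[symmetric] by simp
  qed
  consider "a < b" | "b < a" using assms by linarith
  then show ?thesis
    using main[of a b] main[of b a] by cases (auto simp: add.commute)
qed

lemma powr_midpoint_le:
  fixes a b r :: real
  assumes "1 < r"
  shows "\<bar>(a + b) / 2\<bar> powr r \<le> (\<bar>a\<bar> powr r + \<bar>b\<bar> powr r) / 2"
  using powr_midpoint_less[OF assms, of a b] by (cases "a = b") auto

text \<open>A weak form of the Clarkson inequalities, uniform over all exponents above one. By homogeneity it suffices to look at the compact set
  \<open>\<bar>a\<bar>\<^sup>r + \<bar>b\<bar>\<^sup>r = 1\<close>, \<open>\<bar>a - b\<bar>\<^sup>r \<ge> e\<close>, on which the convexity gap is bounded away from zero.\<close>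

lemma powr_uniformly_convex:
  fixes r e :: real
  assumes r: "1 < r" and e: "0 < e"
  obtains C where "0 \<le> C"
    "\<And>a b :: real. \<bar>a - b\<bar> powr r \<le> e * (\<bar>a\<bar> powr r + \<bar>b\<bar> powr r)
        + C * ((\<bar>a\<bar> powr r + \<bar>b\<bar> powr r) / 2 - \<bar>(a + b) / 2\<bar> powr r)"
proof -
  define s where "s z = \<bar>fst z\<bar> powr r + \<bar>snd z\<bar> powr r" for z :: "real \<times> real"
  define D where "D z = s z / 2 - \<bar>(fst z + snd z) / 2\<bar> powr r" for z
  define d where "d z = \<bar>fst z - snd z\<bar> powr r" for z :: "real \<times> real"
  define K where "K = {z. s z = 1 \<and> e \<le> d z}"
  have cont [continuous_intros]: "continuous_on UNIV s" "continuous_on UNIV D" "continuous_on UNIV d"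
    using r unfolding s_def D_def d_def
    by (intro continuous_intros continuous_on_powr'; auto)+
  have D0: "0 \<le> D z" for z
    using powr_midpoint_le[OF r, of "fst z" "snd z"] by (simp add: D_def s_def)
  have "closed K"
    unfolding K_def by (intro closed_Collect_conj closed_Collect_eq closed_Collect_le cont
        continuous_intros)
  moreover have "bounded K"
  proof -
    have one: "\<bar>x\<bar> \<le> 1" if "\<bar>x\<bar> powr r \<le> 1" for x :: real
    proof (rule ccontr)
      assume "\<not> \<bar>x\<bar> \<le> 1"
      then have "\<bar>x\<bar> powr r > 1 powr r" using r by (intro powr_less_mono2) auto
      then show False using that by simp
    qed
    have "K \<subseteq> cbox (-1, -1) (1, 1)"
    proof
      fix z assume "z \<in> K"
      then have "s z = 1" by (simp add: K_def)
      then have "\<bar>fst z\<bar> powr r \<le> 1" "\<bar>snd z\<bar> powr r \<le> 1"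
        using powr_ge_zero[of "\<bar>fst z\<bar>" r] powr_ge_zero[of "\<bar>snd z\<bar>" r]
        unfolding s_def by linarith+
      then have "\<bar>fst z\<bar> \<le> 1" "\<bar>snd z\<bar> \<le> 1" using one by auto
      then show "z \<in> cbox (-1, -1) (1, 1)"
        by (cases z) (auto simp: cbox_Pair_eq)
    qed
    then show ?thesis using bounded_cbox bounded_subset by blast
  qed
  ultimately have "compact K" by (simp add: compact_eq_bounded_closed)
  have "\<exists>m>0. \<forall>z\<in>K. m \<le> D z"
  proof (cases "K = {}")
    case True then show ?thesis by (auto intro: exI[of _ 1])
  next
    case False
    have "continuous_on K D" using cont(2) continuous_on_subset by blast
    then obtain z where z: "z \<in> K" "\<forall>w\<in>K. D z \<le> D w"
      using continuous_attains_inf \<open>compact K\<close> False by blast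
    have "fst z \<noteq> snd z"
      using z(1) e by (auto simp: K_def d_def)
    then have "0 < D z"
      using powr_midpoint_less[OF r, of "fst z" "snd z"] by (simp add: D_def s_def)
    then show ?thesis using z by blast
  qed
  then obtain m where m: "m > 0" "\<And>z. z \<in> K \<Longrightarrow> m \<le> D z" by blast
  have hom: "d z \<le> e * s z + 2 powr r / m * D z" for z
  proof (cases "s z = 0")
    case True
    then have "\<bar>fst z\<bar> powr r = 0" "\<bar>snd z\<bar> powr r = 0"
      using powr_ge_zero[of "\<bar>fst z\<bar>" r] powr_ge_zero[of "\<bar>snd z\<bar>" r]
      unfolding s_def by linarith+
    then show ?thesis by (auto simp: d_def s_def D_def)
  next
    case False
    have s0: "s z > 0" using False by (simp add: s_def less_le)
    show ?thesis
    proof (cases "d z < e * s z")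
      case True
      then show ?thesis using D0[of z] m by (smt (verit) divide_nonneg_pos mult_nonneg_nonneg powr_ge_zero)
    next
      case False
      define c where "c = s z powr (- 1 / r)"
      have c: "c > 0" "c powr r = 1 / s z"
      proof -
        show "c > 0" using s0 by (simp add: c_def)
        have "c powr r = s z powr (- 1)" unfolding c_def powr_powr using r by simp
        then show "c powr r = 1 / s z" using s0 by (simp add: powr_neg_one)
      qed
      define w where "w = (c * fst z, c * snd z)"
      have sc: "s w = s z / s z" "d w = d z / s z" "D w = D z / s z"
      proof -
        have h: "\<bar>c * x\<bar> powr r = \<bar>x\<bar> powr r / s z" for x
          using c by (simp add: abs_mult powr_mult)
        show sw: "s w = s z / s z"
          by (simp only: s_def w_def fst_conv snd_conv h add_divide_distrib[symmetric])
        show "d w = d z / s z"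
          using h[of "fst z - snd z"] by (simp add: d_def w_def right_diff_distrib)
        have mid: "(fst w + snd w) / 2 = c * ((fst z + snd z) / 2)"
          by (simp add: w_def distrib_left)
        show "D w = D z / s z"
          unfolding D_def mid h sw by (simp only: diff_divide_distrib) simp
      qed
      have "w \<in> K"
        using sc(1,2) False s0 by (simp add: K_def pos_le_divide_eq not_less)
      then have "m \<le> D z / s z" using m sc by metis
      then have "s z \<le> D z / m" using s0 m by (simp add: field_simps)
      then have "2 powr r * s z \<le> 2 powr r * (D z / m)" by (intro mult_left_mono) auto
      moreover have "d z \<le> 2 powr r * s z"
        using abs_diff_powr_le[of r "fst z" "snd z"] r by (simp add: d_def s_def)
      moreover have "0 \<le> e * s z" using e s0 by simp
      ultimately show ?thesis by simp
    qed
  qed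
  show ?thesis
  proof (rule that[of "2 powr r / m"])
    show "0 \<le> 2 powr r / m" using m by simp
    fix a b :: real
    show "\<bar>a - b\<bar> powr r \<le> e * (\<bar>a\<bar> powr r + \<bar>b\<bar> powr r)
        + 2 powr r / m * ((\<bar>a\<bar> powr r + \<bar>b\<bar> powr r) / 2 - \<bar>(a + b) / 2\<bar> powr r)"
      using hom[of "(a, b)"] by (simp add: d_def s_def D_def)
  qed
qed

section \<open>Spaces of r-integrable functions over an arbitrary measure\<close>

definition Lspace :: "'a measure \<Rightarrow> real \<Rightarrow> ('a \<Rightarrow> real) set" where
  "Lspace M r = {f \<in> borel_measurable M. integrable M (\<lambda>x. \<bar>f x\<bar> powr r)}"

lemma Lspace_measurable: "f \<in> Lspace M r \<Longrightarrow> f \<in> borel_measurable M"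
  and Lspace_integrable: "f \<in> Lspace M r \<Longrightarrow> integrable M (\<lambda>x. \<bar>f x\<bar> powr r)"
  by (auto simp: Lspace_def)

lemma LspaceI_dominated:
  assumes "f \<in> borel_measurable M" "integrable M g" "AE x in M. \<bar>f x\<bar> powr r \<le> g x"
  shows "f \<in> Lspace M r"
proof -
  have [measurable]: "f \<in> borel_measurable M" by fact
  have "integrable M (\<lambda>x. \<bar>f x\<bar> powr r)"
    by (rule Bochner_Integration.integrable_bound[OF assms(2)]) (use assms(3) in auto)
  then show ?thesis using assms by (simp add: Lspace_def)
qed

lemma Lspace_abs: "f \<in> Lspace M r \<Longrightarrow> (\<lambda>x. \<bar>f x\<bar>) \<in> Lspace M r"
  by (auto simp: Lspace_def)

lemma Lspace_scale:
  assumes "f \<in> Lspace M r"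
  shows "(\<lambda>x. c * f x) \<in> Lspace M r"
  using assms by (auto simp: Lspace_def abs_mult powr_mult)

lemma integral_powr_scale:
  fixes f :: "'a \<Rightarrow> real"
  shows "(\<integral>x. \<bar>c * f x\<bar> powr r \<partial>M) = \<bar>c\<bar> powr r * (\<integral>x. \<bar>f x\<bar> powr r \<partial>M)"
  by (simp add: abs_mult powr_mult)

lemma Lspace_add:
  assumes "f \<in> Lspace M r" "g \<in> Lspace M r" "0 \<le> r"
  shows "(\<lambda>x. f x + g x) \<in> Lspace M r"
  using assms abs_add_powr_le[OF assms(3)]
  by (intro LspaceI_dominated[where g = "\<lambda>x. 2 powr r * (\<bar>f x\<bar> powr r + \<bar>g x\<bar> powr r)"])
    (auto simp: Lspace_def)

lemma Lspace_diff:
  assumes "f \<in> Lspace M r" "g \<in> Lspace M r" "0 \<le> r"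
  shows "(\<lambda>x. f x - g x) \<in> Lspace M r"
  using Lspace_add[OF assms(1) Lspace_scale[OF assms(2), of "-1"] assms(3)] by simp

lemma Lspace_powr:
  assumes "w \<in> Lspace M e" "0 < c"
  shows "(\<lambda>x. \<bar>w x\<bar> powr c) \<in> Lspace M (e / c)"
proof -
  have "\<bar>\<bar>w x\<bar> powr c\<bar> powr (e / c) = \<bar>w x\<bar> powr e" for x using assms(2) by (simp add: powr_powr)
  moreover have "(\<lambda>x. \<bar>w x\<bar> powr c) \<in> borel_measurable M"
    using Lspace_measurable[OF assms(1)] by measurable
  ultimately show ?thesis unfolding Lspace_def using Lspace_integrable[OF assms(1)] by (simp only: mem_Collect_eq)
qed

lemma integral_add_powr_le:
  assumes "f \<in> Lspace M r" "g \<in> Lspace M r" "0 \<le> r"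
  shows "(\<integral>x. \<bar>f x + g x\<bar> powr r \<partial>M)
     \<le> 2 powr r * ((\<integral>x. \<bar>f x\<bar> powr r \<partial>M) + (\<integral>x. \<bar>g x\<bar> powr r \<partial>M))"
proof -
  have "(\<integral>x. \<bar>f x + g x\<bar> powr r \<partial>M) \<le> (\<integral>x. 2 powr r * (\<bar>f x\<bar> powr r + \<bar>g x\<bar> powr r) \<partial>M)"
    using assms Lspace_add[OF assms] abs_add_powr_le[OF assms(3)]
    by (intro integral_mono) (auto simp: Lspace_def)
  also have "\<dots> = 2 powr r * ((\<integral>x. \<bar>f x\<bar> powr r \<partial>M) + (\<integral>x. \<bar>g x\<bar> powr r \<partial>M))"
    using assms by (simp add: Lspace_def)
  finally show ?thesis .
qed

lemma integral_diff_powr_le: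
  assumes "f \<in> Lspace M r" "g \<in> Lspace M r" "0 \<le> r"
  shows "(\<integral>x. \<bar>f x - g x\<bar> powr r \<partial>M)
     \<le> 2 powr r * ((\<integral>x. \<bar>f x\<bar> powr r \<partial>M) + (\<integral>x. \<bar>g x\<bar> powr r \<partial>M))"
  using integral_add_powr_le[OF assms(1) Lspace_scale[OF assms(2), of "-1"] assms(3)] by simp

lemma integral_comb:
  fixes F1 F2 F3 :: "'a \<Rightarrow> real"
  assumes "integrable M F1" "integrable M F2" "\<And>x. F3 x = a * F1 x + b * F2 x"
  shows "(\<integral>x. F3 x \<partial>M) = a * (\<integral>x. F1 x \<partial>M) + b * (\<integral>x. F2 x \<partial>M)"
  unfolding assms(3) using assms(1,2) by simp

text \<open>Young's inequality for the normalized functions; integrated, it gives one on the right.\<close>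

lemma Holder_integral:
  fixes f g :: "'a \<Rightarrow> real"
  assumes f: "f \<in> Lspace M a" and g: "g \<in> Lspace M b"
    and ab: "1 < a" "1 < b" "1 / a + 1 / b = 1"
  shows "integrable M (\<lambda>x. f x * g x)"
    and "(\<integral>x. \<bar>f x * g x\<bar> \<partial>M)
      \<le> (\<integral>x. \<bar>f x\<bar> powr a \<partial>M) powr (1 / a) * (\<integral>x. \<bar>g x\<bar> powr b \<partial>M) powr (1 / b)"
proof -
  have [measurable]: "f \<in> borel_measurable M" "g \<in> borel_measurable M"
    using f g by (auto simp: Lspace_def)
  have If: "integrable M (\<lambda>x. \<bar>f x\<bar> powr a)" and Ig: "integrable M (\<lambda>x. \<bar>g x\<bar> powr b)"
    using f g by (auto simp: Lspace_def)
  have young: "\<bar>x * y\<bar> \<le> \<bar>x\<bar> powr a / a + \<bar>y\<bar> powr b / b" for x y :: real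
    using Youngs_inequality[OF ab, of "\<bar>x\<bar>" "\<bar>y\<bar>"] by (simp add: abs_mult)
  show int: "integrable M (\<lambda>x. f x * g x)"
    by (rule Bochner_Integration.integrable_bound[of M "\<lambda>x. \<bar>f x\<bar> powr a / a + \<bar>g x\<bar> powr b / b"])
      (use If Ig young ab in \<open>auto intro!: AE_I2 order_trans[OF _ abs_ge_self]\<close>)
  let ?F = "\<integral>x. \<bar>f x\<bar> powr a \<partial>M" and ?G = "\<integral>x. \<bar>g x\<bar> powr b \<partial>M"
  have nn: "0 \<le> ?F" "0 \<le> ?G" by auto
  show "(\<integral>x. \<bar>f x * g x\<bar> \<partial>M) \<le> ?F powr (1 / a) * ?G powr (1 / b)"
  proof (cases "?F = 0 \<or> ?G = 0")
    case True
    then have "(AE x in M. \<bar>f x\<bar> powr a = 0) \<or> (AE x in M. \<bar>g x\<bar> powr b = 0)"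
      using integral_nonneg_eq_0_iff_AE[OF If] integral_nonneg_eq_0_iff_AE[OF Ig] by auto
    then have "AE x in M. \<bar>f x * g x\<bar> = 0"
      by auto
    then have "(\<integral>x. \<bar>f x * g x\<bar> \<partial>M) = 0"
      by (rule integral_eq_zero_AE)
    then show ?thesis by (metis mult_nonneg_nonneg powr_ge_zero)
  next
    case False
    define F where "F = ?F powr (1 / a)"
    define G where "G = ?G powr (1 / b)"
    have pos: "F > 0" "G > 0" and FG: "F powr a = ?F" "G powr b = ?G"
      using False nn ab by (auto simp: F_def G_def powr_powr less_le)
    have "(\<integral>x. \<bar>f x * g x\<bar> / (F * G) \<partial>M)
        \<le> (\<integral>x. \<bar>f x\<bar> powr a / (a * ?F) + \<bar>g x\<bar> powr b / (b * ?G) \<partial>M)"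
    proof (rule integral_mono)
      fix x
      have "\<bar>f x * g x\<bar> / (F * G) = \<bar>(f x / F) * (g x / G)\<bar>"
        using pos by (simp add: abs_mult)
      also have "\<dots> \<le> \<bar>f x / F\<bar> powr a / a + \<bar>g x / G\<bar> powr b / b" by (rule young)
      also have "\<dots> = \<bar>f x\<bar> powr a / (a * ?F) + \<bar>g x\<bar> powr b / (b * ?G)"
        using pos FG by (simp add: powr_divide mult.commute)
      finally show "\<bar>f x * g x\<bar> / (F * G) \<le> \<bar>f x\<bar> powr a / (a * ?F) + \<bar>g x\<bar> powr b / (b * ?G)" .
    qed (use int If Ig in auto)
    also have "\<dots> = 1 / a + 1 / b"
      using If Ig False ab by simp
    finally have "(\<integral>x. \<bar>f x * g x\<bar> \<partial>M) / (F * G) \<le> 1"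
      using ab by simp
    then show ?thesis using pos by (simp add: F_def[symmetric] G_def[symmetric] field_simps)
  qed
qed

lemma Fatou_bound:
  fixes g :: "'a \<Rightarrow> real"
  assumes int: "\<And>k. integrable M (G k)" and nn: "\<And>k x. 0 \<le> G k x"
    and lim: "AE x in M. (\<lambda>k. G k x) \<longlonglongrightarrow> g x" and g: "g \<in> borel_measurable M"
    and le: "\<forall>\<^sub>F k in sequentially. (\<integral>x. G k x \<partial>M) \<le> c"
  shows "integrable M g" "(\<integral>x. g x \<partial>M) \<le> c"
proof -
  note [measurable] = g
  have [measurable]: "G k \<in> borel_measurable M" for k using int by auto
  have "0 \<le> (\<integral>x. G k x \<partial>M)" for k
    using nn by (intro integral_nonneg_AE AE_I2)
  then have c: "0 \<le> c"
    using eventually_happens[OF le] by (auto intro: order_trans)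
  have g0: "AE x in M. 0 \<le> g x"
    using lim by eventually_elim (rule LIMSEQ_le_const, auto simp: nn)
  have "(\<integral>\<^sup>+x. ennreal (g x) \<partial>M) = (\<integral>\<^sup>+x. liminf (\<lambda>k. ennreal (G k x)) \<partial>M)"
  proof (rule nn_integral_cong_AE)
    show "AE x in M. ennreal (g x) = liminf (\<lambda>k. ennreal (G k x))"
      using lim
    proof eventually_elim
      case (elim x)
      then have "(\<lambda>k. ennreal (G k x)) \<longlonglongrightarrow> ennreal (g x)" by (rule tendsto_ennrealI)
      then show ?case by (simp add: lim_imp_Liminf)
    qed
  qed
  also have "\<dots> \<le> liminf (\<lambda>k. \<integral>\<^sup>+x. ennreal (G k x) \<partial>M)"
    by (rule nn_integral_liminf) simp
  also have "\<dots> \<le> liminf (\<lambda>k. ennreal c)"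
    using le by (intro Liminf_mono) (auto elim!: eventually_mono simp: nn_integral_eq_integral int nn ennreal_leI)
  also have "\<dots> = ennreal c" by (simp add: Liminf_const)
  finally have fin: "(\<integral>\<^sup>+x. ennreal (g x) \<partial>M) \<le> ennreal c" .
  show ig: "integrable M g"
    by (rule integrableI_nonneg) (use g0 fin in \<open>auto simp: le_less_trans\<close>)
  show "(\<integral>x. g x \<partial>M) \<le> c"
    using fin c nn_integral_eq_integral[OF ig g0] by (simp add: ennreal_le_iff)
qed

lemma subseq_below:
  fixes a :: "nat \<Rightarrow> real" and b :: "nat \<Rightarrow> real"
  assumes "a \<longlonglongrightarrow> 0" "\<And>k. 0 < b k"
  obtains \<sigma> where "strict_mono \<sigma>" "\<And>k. \<bar>a (\<sigma> k)\<bar> < b k"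
proof -
  have ex: "\<exists>n>m. \<bar>a n\<bar> < b k" for m k
  proof -
    have "\<forall>\<^sub>F n in sequentially. \<bar>a n\<bar> < b k"
      using assms by (metis tendsto_rabs_zero order_tendstoD(2))
    then obtain N where "\<forall>n\<ge>N. \<bar>a n\<bar> < b k" by (auto simp: eventually_sequentially)
    then show ?thesis by (intro exI[of _ "max N (Suc m)"]) auto
  qed
  have "\<exists>\<sigma>. \<forall>k. \<bar>a (\<sigma> k)\<bar> < b k \<and> \<sigma> k < \<sigma> (Suc k)"
  proof (rule dependent_nat_choice)
    show "\<exists>x. \<bar>a x\<bar> < b 0" using ex by blast
  qed (use ex in blast)
  then show ?thesis using that by (metis strict_mono_Suc_iff)
qed

lemma AE_summable_of_summable_integral:
  fixes G :: "nat \<Rightarrow> 'a \<Rightarrow> real"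
  assumes int: "\<And>k. integrable M (G k)" and nn: "\<And>k x. 0 \<le> G k x"
    and sm: "summable (\<lambda>k. \<integral>x. G k x \<partial>M)"
  shows "AE x in M. summable (\<lambda>k. G k x)" "integrable M (\<lambda>x. \<Sum>k. G k x)"
proof -
  have [measurable]: "G k \<in> borel_measurable M" for k using int by auto
  have "(\<integral>\<^sup>+x. (\<Sum>k. ennreal (G k x)) \<partial>M) = (\<Sum>k. \<integral>\<^sup>+x. ennreal (G k x) \<partial>M)"
    by (rule nn_integral_suminf) simp
  also have "\<dots> = (\<Sum>k. ennreal (\<integral>x. G k x \<partial>M))"
    by (intro suminf_cong nn_integral_eq_integral int) (simp add: nn)
  also have "\<dots> < \<infinity>"
    using sm by (simp add: suminf_ennreal2 nn less_top[symmetric])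
  finally have "AE x in M. (\<Sum>k. ennreal (G k x)) \<noteq> \<infinity>"
    by (intro nn_integral_PInf_AE) auto
  then show ae: "AE x in M. summable (\<lambda>k. G k x)"
    by eventually_elim (auto intro!: summable_suminf_not_top simp: nn)
  show "integrable M (\<lambda>x. \<Sum>k. G k x)"
    by (rule integrable_suminf) (use ae int sm nn in auto)
qed

text \<open>Convergence in the mean of order \<open>r\<close> that is fast enough for the errors to be summable
  holds almost everywhere as well, and below one common r-integrable function: the sum of
  all the errors serves as majorant. Passing to subsequences, limits of nonlinear functionals thus
  follow from dominated convergence.\<close>

lemma Lspace_fast_limit:
  assumes r: "1 \<le> r" and fk: "\<And>k. f k \<in> Lspace M r" and f: "g \<in> Lspace M r"
    and sm: "summable (\<lambda>k. \<integral>x. \<bar>f k x - g x\<bar> powr r \<partial>M)"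
  obtains W where "W \<in> Lspace M r" "\<And>x. 0 \<le> W x" "AE x in M. \<forall>k. \<bar>f k x\<bar> \<le> W x"
    "AE x in M. (\<lambda>k. f k x) \<longlonglongrightarrow> g x"
proof -
  have [measurable]: "f k \<in> borel_measurable M" "g \<in> borel_measurable M" for k
    using fk f by (auto simp: Lspace_def)
  define G where "G k x = \<bar>f k x - g x\<bar> powr r" for k x
  have int: "integrable M (G k)" for k
    unfolding G_def using Lspace_diff[OF fk f] r by (auto simp: Lspace_def)
  have ae: "AE x in M. summable (\<lambda>k. G k x)" and V: "integrable M (\<lambda>x. \<Sum>k. G k x)"
    using AE_summable_of_summable_integral[of M G] int sm by (auto simp: G_def)
  define V where "V x = (\<Sum>k. G k x)" for x
  have [measurable]: "V \<in> borel_measurable M" using V by (auto simp: V_def[abs_def])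
  define W where "W x = \<bar>g x\<bar> + \<bar>V x\<bar> powr (1 / r)" for x
  have "(\<lambda>x. \<bar>V x\<bar> powr (1 / r)) \<in> Lspace M r"
    using V r by (auto simp: Lspace_def powr_powr V_def[abs_def])
  then have "W \<in> Lspace M r"
    unfolding W_def[abs_def] using Lspace_add[OF Lspace_abs[OF f]] r by auto
  moreover have "AE x in M. \<forall>k. \<bar>f k x\<bar> \<le> W x"
    using ae
  proof eventually_elim
    case (elim x)
    show ?case
    proof
      fix k
      have "G k x \<le> V x"
        unfolding V_def using elim sum_le_suminf[OF elim, of "{k}"] by (auto simp: G_def)
      then have "(G k x) powr (1 / r) \<le> \<bar>V x\<bar> powr (1 / r)"
        using r by (intro powr_mono2) (auto simp: G_def)
      moreover have "(G k x) powr (1 / r) = \<bar>f k x - g x\<bar>"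
        using r by (simp add: G_def powr_powr)
      ultimately show "\<bar>f k x\<bar> \<le> W x" unfolding W_def by linarith
    qed
  qed
  moreover have "AE x in M. (\<lambda>k. f k x) \<longlonglongrightarrow> g x"
    using ae
  proof eventually_elim
    case (elim x)
    have "(\<lambda>k. G k x) \<longlonglongrightarrow> 0" using elim by (rule summable_LIMSEQ_zero)
    then have "(\<lambda>k. (G k x) powr (1 / r)) \<longlonglongrightarrow> 0 powr (1 / r)"
      using r by (intro tendsto_powr') (auto simp: G_def)
    then have "(\<lambda>k. \<bar>f k x - g x\<bar>) \<longlonglongrightarrow> 0" using r by (simp add: G_def powr_powr)
    then show ?case by (simp add: tendsto_rabs_zero_iff LIM_zero_iff)
  qed
  ultimately show ?thesis using that by (auto simp: W_def)
qed

text \<open>Along a subsequence whose successive differences have \<open>L\<^sup>r\<close> size at most about \<open>1 / 2\<^sup>k\<close>, even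
  the differences multiplied by \<open>2\<^sup>k\<close> have summable \<open>r\<close>-th powers almost everywhere, so that the
  sequence is pointwise Cauchy; Fatou's lemma then controls the distance to the limit.\<close>

lemma Lspace_complete:
  assumes r: "1 \<le> r" and fk: "\<And>k. f k \<in> Lspace M r"
    and cauchy: "\<And>e. 0 < e \<Longrightarrow> \<exists>N. \<forall>i\<ge>N. \<forall>j\<ge>N. (\<integral>x. \<bar>f i x - f j x\<bar> powr r \<partial>M) < e"
  obtains g where "g \<in> Lspace M r" "(\<lambda>k. \<integral>x. \<bar>f k x - g x\<bar> powr r \<partial>M) \<longlonglongrightarrow> 0"
proof -
  have [measurable]: "f k \<in> borel_measurable M" for k using fk by (auto simp: Lspace_def)
  \<comment> \<open>The first factor compensates \<open>2\<^sup>k\<close> inside the \<open>r\<close>-th power, the second makes the series converge.\<close>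
  define b where "b k = ((1/2) powr r * (1/2)) ^ k" for k :: nat
  have b: "0 < b k" for k by (simp add: b_def)
  have ex: "\<exists>n>m. \<forall>i\<ge>n. \<forall>j\<ge>n. (\<integral>x. \<bar>f i x - f j x\<bar> powr r \<partial>M) < b k" for m k
  proof -
    obtain N where "\<forall>i\<ge>N. \<forall>j\<ge>N. (\<integral>x. \<bar>f i x - f j x\<bar> powr r \<partial>M) < b k"
      using cauchy[OF b] by blast
    then show ?thesis by (intro exI[of _ "max N (Suc m)"]) auto
  qed
  have "\<exists>\<sigma>. \<forall>k. (\<forall>i\<ge>\<sigma> k. \<forall>j\<ge>\<sigma> k. (\<integral>x. \<bar>f i x - f j x\<bar> powr r \<partial>M) < b k) \<and> \<sigma> k < \<sigma> (Suc k)"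
    by (rule dependent_nat_choice) (use ex in blast)+
  then obtain \<sigma> where \<sigma>: "\<And>k i j. \<sigma> k \<le> i \<Longrightarrow> \<sigma> k \<le> j \<Longrightarrow> (\<integral>x. \<bar>f i x - f j x\<bar> powr r \<partial>M) < b k"
    "\<And>k. \<sigma> k < \<sigma> (Suc k)" by metis
  have mono: "strict_mono \<sigma>" using \<sigma>(2) by (simp add: strict_mono_Suc_iff)
  define G where "G k x = \<bar>2 ^ k * (f (\<sigma> (Suc k)) x - f (\<sigma> k) x)\<bar> powr r" for k x
  have G0: "0 \<le> G k x" for k x by (simp add: G_def)
  have int: "integrable M (G k)" for k
    unfolding G_def using Lspace_scale[OF Lspace_diff[OF fk fk]] r by (auto simp: Lspace_def)
  have "(\<integral>x. G k x \<partial>M) \<le> (1/2) ^ k" for k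
  proof -
    have "(\<integral>x. G k x \<partial>M) = (2 ^ k) powr r * (\<integral>x. \<bar>f (\<sigma> (Suc k)) x - f (\<sigma> k) x\<bar> powr r \<partial>M)"
      unfolding G_def by (subst integral_powr_scale) simp
    also have "\<dots> \<le> (2 ^ k) powr r * b k"
      using \<sigma>(1)[of k "\<sigma> (Suc k)" "\<sigma> k"] \<sigma>(2)[of k] by (intro mult_left_mono) auto
    also have "((2::real) ^ k) powr r = (2 powr r) ^ k"
      by (simp add: powr_powr powr_realpow[symmetric] mult.commute)
    also have "(2 powr r) ^ k * b k = (2 powr r * (1/2) powr r * (1/2)) ^ k"
      unfolding b_def by (simp only: power_mult_distrib[symmetric] mult.assoc)
    also have "(2::real) powr r * (1/2) powr r = (2 * (1/2)) powr r"
      by (simp only: powr_mult)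
    also have "((2 * (1/2)) powr r * (1/2)) ^ k = (1/2 :: real) ^ k"
      by simp
    finally show ?thesis .
  qed
  moreover have "0 \<le> (\<integral>x. G k x \<partial>M)" for k
    by (intro integral_nonneg_AE AE_I2) (simp add: G_def)
  ultimately have le: "norm (\<integral>x. G k x \<partial>M) \<le> (1/2) ^ k" for k
    by (metis abs_of_nonneg real_norm_def)
  have sm: "summable (\<lambda>k. \<integral>x. G k x \<partial>M)"
  proof (rule summable_comparison_test'[OF _ le])
    show "summable (\<lambda>k. (1 / 2 :: real) ^ k)" by (rule summable_geometric) simp
  qed
  have ae: "AE x in M. summable (\<lambda>k. G k x)"
    by (rule AE_summable_of_summable_integral(1)[OF int _ sm]) (simp add: G_def)
  define g where "g x = lim (\<lambda>k. f (\<sigma> k) x)" for x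
  have gm [measurable]: "g \<in> borel_measurable M" unfolding g_def by simp
  have lim: "AE x in M. (\<lambda>k. f (\<sigma> k) x) \<longlonglongrightarrow> g x"
    using ae
  proof eventually_elim
    case (elim x)
    have "G k x \<le> (\<Sum>k. G k x)" for k
      using sum_le_suminf[OF elim, of "{k}"] G0 by simp
    then have le: "(G k x) powr (1 / r) \<le> (\<Sum>k. G k x) powr (1 / r)" for k
      using r G0 by (intro powr_mono2) auto
    define B where "B = (\<Sum>k. G k x) powr (1 / r)"
    have "\<bar>2 ^ k * (f (\<sigma> (Suc k)) x - f (\<sigma> k) x)\<bar> = (G k x) powr (1 / r)" for k
      unfolding G_def powr_powr using r by simp
    then have "2 ^ k * \<bar>f (\<sigma> (Suc k)) x - f (\<sigma> k) x\<bar> \<le> B" for k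
      using le[of k] by (simp add: B_def abs_mult)
    then have "\<bar>f (\<sigma> (Suc k)) x - f (\<sigma> k) x\<bar> \<le> B / 2 ^ k" for k
      by (simp add: pos_le_divide_eq mult.commute)
    then have le': "norm (f (\<sigma> (Suc k)) x - f (\<sigma> k) x) \<le> B * (1/2) ^ k" for k
      unfolding power_one_over real_norm_def by simp
    have "summable (\<lambda>k. f (\<sigma> (Suc k)) x - f (\<sigma> k) x)"
    proof (rule summable_comparison_test'[OF _ le'])
      show "summable (\<lambda>k. B * (1 / 2 :: real) ^ k)"
        by (intro summable_mult summable_geometric) simp
    qed
    then have "convergent (\<lambda>n. \<Sum>k<n. f (\<sigma> (Suc k)) x - f (\<sigma> k) x)"
      by (simp add: summable_iff_convergent)
    then have "convergent (\<lambda>n. f (\<sigma> n) x - f (\<sigma> 0) x)"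
      by (simp only: sum_lessThan_telescope[of "\<lambda>n. f (\<sigma> n) x"])
    then have "convergent (\<lambda>n. f (\<sigma> n) x)"
      by (simp only: convergent_diff_const_right_iff)
    then show ?case unfolding g_def by (simp only: convergent_LIMSEQ_iff)
  qed
  have main: "integrable M (\<lambda>x. \<bar>f i x - g x\<bar> powr r) \<and> (\<integral>x. \<bar>f i x - g x\<bar> powr r \<partial>M) \<le> b k"
    if "\<sigma> k \<le> i" for i k
  proof -
    let ?H = "\<lambda>j x. \<bar>f i x - f (\<sigma> j) x\<bar> powr r"
    have 1: "integrable M (?H j)" for j
      using Lspace_diff[OF fk fk] r by (auto simp: Lspace_def)
    have 2: "AE x in M. (\<lambda>j. ?H j x) \<longlonglongrightarrow> \<bar>f i x - g x\<bar> powr r"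
      using lim by eventually_elim (use r in \<open>auto intro!: tendsto_intros tendsto_powr'\<close>)
    have 3: "\<forall>\<^sub>F j in sequentially. (\<integral>x. ?H j x \<partial>M) \<le> b k"
      using eventually_ge_at_top[of k]
    proof eventually_elim
      case (elim j)
      then have "\<sigma> k \<le> \<sigma> j" using mono by (simp add: strict_mono_less_eq)
      then show ?case using \<sigma>(1)[of k i "\<sigma> j"] that by simp
    qed
    have 4: "0 \<le> ?H j x" for j x by simp
    have 5: "(\<lambda>x. \<bar>f i x - g x\<bar> powr r) \<in> borel_measurable M" by measurable
    show ?thesis
      using Fatou_bound[of M ?H, OF 1 4 2 5 3] by blast
  qed
  have "(\<lambda>x. f (\<sigma> 0) x - g x) \<in> Lspace M r"
    using main[of 0 "\<sigma> 0"] by (simp add: Lspace_def)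
  then have "(\<lambda>x. f (\<sigma> 0) x - (f (\<sigma> 0) x - g x)) \<in> Lspace M r"
    by (rule Lspace_diff[OF fk]) (use r in simp)
  then have "g \<in> Lspace M r" by simp
  moreover have "(\<lambda>k. \<integral>x. \<bar>f k x - g x\<bar> powr r \<partial>M) \<longlonglongrightarrow> 0"
  proof (rule LIMSEQ_I)
    fix e :: real assume "0 < e"
    have "(1/2::real) powr r \<le> 1 powr r"
      using r by (intro powr_mono2) auto
    then have "(1/2::real) powr r * (1/2) < 1"
      unfolding powr_one_eq_one by linarith
    then have "b \<longlonglongrightarrow> 0"
      unfolding b_def by (intro LIMSEQ_realpow_zero mult_nonneg_nonneg powr_ge_zero) simp_all
    then obtain k where k: "b k < e"
      using \<open>0 < e\<close> order_tendstoD(2) eventually_happens trivial_limit_sequentially by metis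
    show "\<exists>N. \<forall>n\<ge>N. norm ((\<integral>x. \<bar>f n x - g x\<bar> powr r \<partial>M) - 0) < e"
    proof (intro exI[of _ "\<sigma> k"] allI impI)
      fix n assume n: "\<sigma> k \<le> n"
      have "0 \<le> (\<integral>x. \<bar>f n x - g x\<bar> powr r \<partial>M)"
        by (intro integral_nonneg_AE AE_I2) simp
      moreover have "(\<integral>x. \<bar>f n x - g x\<bar> powr r \<partial>M) < e"
        using main[OF n] k by linarith
      ultimately show "norm ((\<integral>x. \<bar>f n x - g x\<bar> powr r \<partial>M) - 0) < e"
        by simp
    qed
  qed
  ultimately show ?thesis by (rule that)
qed

text \<open>The mean value theorem bounds the difference quotients by the majorant of the derivative, and
  dominated convergence applies.\<close>

lemma has_real_derivative_integral_at_0: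
  fixes H H' :: "real \<Rightarrow> 'a \<Rightarrow> real"
  assumes int: "\<And>t. \<bar>t\<bar> < 1 \<Longrightarrow> integrable M (H t)"
    and D: "\<And>t x. \<bar>t\<bar> < 1 \<Longrightarrow> ((\<lambda>t. H t x) has_real_derivative H' t x) (at t)"
    and le: "\<And>t x. \<bar>t\<bar> < 1 \<Longrightarrow> x \<in> space M \<Longrightarrow> \<bar>H' t x\<bar> \<le> W x" and W: "integrable M W"
    and m: "H' 0 \<in> borel_measurable M"
  shows "((\<lambda>t. \<integral>x. H t x \<partial>M) has_real_derivative (\<integral>x. H' 0 x \<partial>M)) (at 0)"
    and "integrable M (H' 0)"
proof -
  show "integrable M (H' 0)"
    by (rule Bochner_Integration.integrable_bound[OF W m])
      (use le[of 0] in \<open>auto intro!: AE_I2 order_trans[OF _ abs_ge_self]\<close>)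
  show "((\<lambda>t. \<integral>x. H t x \<partial>M) has_real_derivative (\<integral>x. H' 0 x \<partial>M)) (at 0)"
    unfolding DERIV_def tendsto_at_iff_sequentially comp_def
  proof (intro allI impI)
    fix X :: "nat \<Rightarrow> real"
    assume X: "\<forall>i. X i \<in> UNIV - {0}" and lim: "X \<longlonglongrightarrow> 0"
    have "\<forall>\<^sub>F i in sequentially. \<bar>X i\<bar> < 1"
      using order_tendstoD(2)[OF tendsto_rabs_zero[OF lim], of 1] by simp
    then obtain N where N: "\<And>i. N \<le> i \<Longrightarrow> \<bar>X i\<bar> < 1"
      by (auto simp: eventually_sequentially)
    define Y where "Y i = X (i + N)" for i
    have Y: "Y i \<noteq> 0" "\<bar>Y i\<bar> < 1" for i using X N[of "i + N"] by (auto simp: Y_def)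
    have Yl: "Y \<longlonglongrightarrow> 0" unfolding Y_def using lim by (rule LIMSEQ_ignore_initial_segment)
    define S where "S i x = (H (Y i) x - H 0 x) / Y i" for i x
    have Si: "integrable M (S i)" for i
      unfolding S_def using int[OF Y(2)] int[of 0] by auto
    have "(\<lambda>i. \<integral>x. S i x \<partial>M) \<longlonglongrightarrow> (\<integral>x. H' 0 x \<partial>M)"
    proof (rule integral_dominated_convergence[OF m _ W])
      show "S i \<in> borel_measurable M" for i using Si by auto
      show "AE x in M. (\<lambda>i. S i x) \<longlonglongrightarrow> H' 0 x"
      proof (rule AE_I2)
        fix x
        have "((\<lambda>h. (H (0 + h) x - H 0 x) / h) \<longlongrightarrow> H' 0 x) (at 0)"
          using D[of 0 x] by (simp add: DERIV_def)
        then show "(\<lambda>i. S i x) \<longlonglongrightarrow> H' 0 x"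
          unfolding tendsto_at_iff_sequentially comp_def S_def using Y(1) Yl by auto
      qed
      show "AE x in M. norm (S i x) \<le> W x" for i
      proof (rule AE_I2)
        fix x assume x: "x \<in> space M"
        have "norm (H (Y i) x - H 0 x) \<le> W x * norm (Y i - 0)"
          by (rule field_differentiable_bound[of "{-1<..<1}" "\<lambda>t. H t x" "\<lambda>t. H' t x"])
            (use D le x Y(2)[of i] in \<open>auto intro!: DERIV_subset[OF D]\<close>)
        then show "norm (S i x) \<le> W x"
          using Y(1)[of i] by (simp add: S_def field_simps)
      qed
    qed
    moreover have "(\<integral>x. S i x \<partial>M) = ((\<integral>x. H (Y i) x \<partial>M) - (\<integral>x. H 0 x \<partial>M)) / Y i" for i
      unfolding S_def using int[OF Y(2)] int[of 0] by simp
    ultimately have "(\<lambda>i. ((\<integral>x. H (Y i) x \<partial>M) - (\<integral>x. H 0 x \<partial>M)) / Y i) \<longlonglongrightarrow> (\<integral>x. H' 0 x \<partial>M)"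
      by simp
    then show "(\<lambda>i. ((\<integral>x. H (0 + X i) x \<partial>M) - (\<integral>x. H 0 x \<partial>M)) / X i) \<longlonglongrightarrow> (\<integral>x. H' 0 x \<partial>M)"
      using LIMSEQ_offset[of "\<lambda>i. ((\<integral>x. H (X i) x \<partial>M) - (\<integral>x. H 0 x \<partial>M)) / X i" N]
      by (simp add: Y_def)
  qed
qed

section \<open>The Gagliardo energy as an integral of differences\<close>

text \<open>Lebesgue measure on a product is the completion of the product measure rather than the product
  itself, so that exceptional sets of one variable have to be carried over through Borel null sets.\<close>

lemma AE_lebesgue_fst:
  assumes "AE x in (lebesgue :: 'a::euclidean_space measure). P x"
  shows "AE z in (lebesgue :: ('a \<times> 'b::euclidean_space) measure). P (fst z)"
proof -
  have "AE x in (lborel :: 'a measure). P x" using assms by (simp add: AE_completion_iff)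
  then obtain N where N: "{x. \<not> P x} \<subseteq> N" "N \<in> null_sets (lborel :: 'a measure)"
    by (auto elim!: AE_E simp: null_sets_def)
  have "emeasure (lborel :: ('a \<times> 'b) measure) (N \<times> UNIV) = 0"
    using N(2) by (simp add: lborel_prod[symmetric] lborel.emeasure_pair_measure_Times null_sets_def)
  then have "N \<times> UNIV \<in> null_sets (lborel :: ('a \<times> 'b) measure)"
    using N(2) by (auto simp: null_sets_def lborel_prod[symmetric])
  then have "AE z in (lborel :: ('a \<times> 'b) measure). P (fst z)"
    by (rule AE_I') (use N in auto)
  then show ?thesis by (simp add: AE_completion_iff)
qed

lemma AE_lebesgue_snd:
  assumes "AE x in (lebesgue :: 'b::euclidean_space measure). P x"
  shows "AE z in (lebesgue :: ('a::euclidean_space \<times> 'b) measure). P (snd z)"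
proof -
  have "AE x in (lborel :: 'b measure). P x" using assms by (simp add: AE_completion_iff)
  then obtain N where N: "{x. \<not> P x} \<subseteq> N" "N \<in> null_sets (lborel :: 'b measure)"
    by (auto elim!: AE_E simp: null_sets_def)
  have "emeasure (lborel :: ('a \<times> 'b) measure) (UNIV \<times> N) = 0"
    using N(2) by (simp add: lborel_prod[symmetric] lborel.emeasure_pair_measure_Times null_sets_def)
  then have "UNIV \<times> N \<in> null_sets (lborel :: ('a \<times> 'b) measure)"
    using N(2) by (auto simp: null_sets_def lborel_prod[symmetric])
  then have "AE z in (lborel :: ('a \<times> 'b) measure). P (snd z)"
    by (rule AE_I') (use N in auto)
  then show ?thesis by (simp add: AE_completion_iff)
qed

lemma lebesgue_measurable_Borel_version:
  fixes u :: "'a::euclidean_space \<Rightarrow> real"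
  assumes "u \<in> borel_measurable lebesgue"
  obtains u' where "u' \<in> borel_measurable borel" "AE x in lebesgue. u x = u' x"
  using completion_ex_borel_measurable_real[OF assms] by (auto simp: AE_completion_iff)

definition diff2 :: "('a \<Rightarrow> real) \<Rightarrow> 'a \<times> 'a \<Rightarrow> real" where
  "diff2 u z = u (fst z) - u (snd z)"

lemma diff2_measurable:
  fixes u :: "'a::euclidean_space \<Rightarrow> real"
  assumes "u \<in> borel_measurable lebesgue"
  shows "diff2 u \<in> borel_measurable lebesgue"
proof -
  obtain u' where u': "u' \<in> borel_measurable borel" "AE x in lebesgue. u x = u' x"
    using lebesgue_measurable_Borel_version[OF assms] .
  have [measurable]: "u' \<in> borel_measurable borel" by fact
  have "diff2 u' \<in> borel_measurable (borel \<Otimes>\<^sub>M borel)"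
    unfolding diff2_def by measurable
  then have "diff2 u' \<in> borel_measurable lebesgue"
    by (intro measurable_completion) (simp add: borel_prod)
  moreover have "AE z in lebesgue. diff2 u' z = diff2 u z"
    using AE_lebesgue_fst[OF u'(2)] AE_lebesgue_snd[OF u'(2)]
    by eventually_elim (simp add: diff2_def)
  ultimately show ?thesis by (rule borel_measurable_AE)
qed

lemma diff2_comb: "diff2 (\<lambda>x. a * u x + b * v x) = (\<lambda>z. a * diff2 u z + b * diff2 v z)"
  by (simp add: diff2_def fun_eq_iff algebra_simps)

lemma diff2_minus: "diff2 (\<lambda>x. u x - v x) = (\<lambda>z. diff2 u z - diff2 v z)"
  by (simp add: diff2_def fun_eq_iff)

definition gag_weight :: "real \<Rightarrow> real \<Rightarrow> (real^'n) set \<Rightarrow> (real^'n) \<times> (real^'n) \<Rightarrow> real" where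
  "gag_weight s p \<Omega> z = indicator (Q_set \<Omega>) z / frac_kernel s p (fst z) (snd z)"

text \<open>With the kernel and the set \<open>Q\<close> absorbed into the measure, the Gagliardo seminorm is the \<open>L\<^sup>p\<close> norm
  of the difference function, and all facts on \<open>Lspace\<close> apply to it.\<close>

definition gag_measure :: "real \<Rightarrow> real \<Rightarrow> (real^'n) set \<Rightarrow> ((real^'n) \<times> (real^'n)) measure" where
  "gag_measure s p \<Omega> = density lebesgue (\<lambda>z. ennreal (gag_weight s p \<Omega> z))"

definition energy :: "real \<Rightarrow> real \<Rightarrow> (real^'n) set \<Rightarrow> (real^'n \<Rightarrow> real) \<Rightarrow> real" where
  "energy s p \<Omega> u = (\<integral>z. \<bar>diff2 u z\<bar> powr p \<partial>gag_measure s p \<Omega>)"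

lemma gag_weight_nonneg: "0 \<le> gag_weight s p \<Omega> z"
  by (simp add: gag_weight_def frac_kernel_def)

lemma energy_nonneg: "0 \<le> energy s p \<Omega> u"
  unfolding energy_def by (intro integral_nonneg_AE AE_I2) simp

lemma open_Q_set: "open \<Omega> \<Longrightarrow> open (Q_set \<Omega>)"
proof -
  assume "open \<Omega>"
  moreover have "Q_set \<Omega> = \<Omega> \<times> UNIV \<union> UNIV \<times> \<Omega>" by (auto simp: Q_set_def)
  ultimately show ?thesis by (simp add: open_Times open_Un)
qed

lemma frac_kernel_measurable:
  "(\<lambda>z. frac_kernel s p (fst z) (snd z :: real^'n)) \<in> borel_measurable (borel \<Otimes>\<^sub>M borel)"
  unfolding frac_kernel_def by measurable

lemma gag_weight_measurable:
  assumes "open (\<Omega> :: (real^'n) set)"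
  shows "gag_weight s p \<Omega> \<in> borel_measurable borel"
proof -
  have [measurable]: "(\<lambda>z. frac_kernel s p (fst z) (snd z :: real^'n)) \<in> borel_measurable borel"
    using frac_kernel_measurable by (simp add: borel_prod)
  have [measurable]: "Q_set \<Omega> \<in> sets borel" using open_Q_set[OF assms] by simp
  show ?thesis unfolding gag_weight_def by measurable
qed

lemma gag_weight_measurable_lebesgue [measurable]:
  assumes "open (\<Omega> :: (real^'n) set)"
  shows "gag_weight s p \<Omega> \<in> borel_measurable lebesgue"
  using gag_weight_measurable[OF assms] by (intro measurable_completion) simp

lemma measurable_gag_measure:
  "borel_measurable (gag_measure s p \<Omega>) = (borel_measurable lebesgue :: (_ \<Rightarrow> real) set)"
  by (simp add: gag_measure_def measurable_def)

lemma AE_gag_measure: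
  assumes "open \<Omega>" "AE z in lebesgue. P z"
  shows "AE z in gag_measure s p \<Omega>. P z"
  unfolding gag_measure_def using assms gag_weight_measurable_lebesgue[OF assms(1)]
  by (subst AE_density) auto

lemma gag_measure_eq_set_integral:
  fixes F :: "(real^'n) \<times> (real^'n) \<Rightarrow> real"
  assumes "open \<Omega>" "F \<in> borel_measurable lebesgue"
  shows "integrable (gag_measure s p \<Omega>) F \<longleftrightarrow>
      set_integrable lebesgue (Q_set \<Omega>) (\<lambda>z. F z / frac_kernel s p (fst z) (snd z))"
    and "(\<integral>z. F z \<partial>gag_measure s p \<Omega>) =
      set_lebesgue_integral lebesgue (Q_set \<Omega>) (\<lambda>z. F z / frac_kernel s p (fst z) (snd z))"
proof -
  note m = assms(2) gag_weight_measurable_lebesgue[OF assms(1), of s p]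
  have eq: "gag_weight s p \<Omega> z *\<^sub>R F z
     = indicator (Q_set \<Omega>) z *\<^sub>R (F z / frac_kernel s p (fst z) (snd z))" for z
    by (simp add: gag_weight_def)
  show "integrable (gag_measure s p \<Omega>) F \<longleftrightarrow>
      set_integrable lebesgue (Q_set \<Omega>) (\<lambda>z. F z / frac_kernel s p (fst z) (snd z))"
    unfolding gag_measure_def set_integrable_def eq[symmetric]
    by (rule integrable_density) (use m in \<open>auto intro!: AE_I2 gag_weight_nonneg simp del: split_paired_All\<close>)
  show "(\<integral>z. F z \<partial>gag_measure s p \<Omega>) =
      set_lebesgue_integral lebesgue (Q_set \<Omega>) (\<lambda>z. F z / frac_kernel s p (fst z) (snd z))"
    unfolding gag_measure_def set_lebesgue_integral_def eq[symmetric]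
    by (rule integral_density) (use m in \<open>auto intro!: AE_I2 gag_weight_nonneg simp del: split_paired_All\<close>)
qed

lemma gagliardo_integrand_eq:
  "gagliardo_integrand s p u = (\<lambda>z. \<bar>diff2 u z\<bar> powr p / frac_kernel s p (fst z) (snd z))"
  by (auto simp: gagliardo_integrand_def diff2_def fun_eq_iff)

lemma
  fixes \<Omega> :: "(real^'n) set"
  assumes "open \<Omega>" "u \<in> borel_measurable lebesgue"
  shows set_integrable_gagliardo: "set_integrable lebesgue (Q_set \<Omega>) (gagliardo_integrand s p u)
      \<longleftrightarrow> diff2 u \<in> Lspace (gag_measure s p \<Omega>) p"
    and X0_norm_eq: "X0_norm s p \<Omega> u = energy s p \<Omega> u powr (1 / p)"
proof -
  have [measurable]: "diff2 u \<in> borel_measurable lebesgue" using diff2_measurable assms by blast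
  have "(\<lambda>z. \<bar>diff2 u z\<bar> powr p) \<in> borel_measurable lebesgue" by measurable
  note * = gag_measure_eq_set_integral[OF assms(1) this, of s p]
  show "set_integrable lebesgue (Q_set \<Omega>) (gagliardo_integrand s p u)
      \<longleftrightarrow> diff2 u \<in> Lspace (gag_measure s p \<Omega>) p"
    unfolding gagliardo_integrand_eq *(1)[symmetric] Lspace_def
    using \<open>diff2 u \<in> borel_measurable lebesgue\<close> by (simp add: measurable_gag_measure)
  show "X0_norm s p \<Omega> u = energy s p \<Omega> u powr (1 / p)"
    unfolding X0_norm_def gagliardo_integrand_eq *(2)[symmetric] energy_def ..
qed

lemma frac_form_eq:
  fixes \<Omega> :: "(real^'n) set"
  assumes "open \<Omega>" "u \<in> borel_measurable lebesgue" "\<phi> \<in> borel_measurable lebesgue"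
  shows "frac_form s p \<Omega> u \<phi> =
    (\<integral>z. \<bar>diff2 u z\<bar> powr (p - 2) * diff2 u z * diff2 \<phi> z \<partial>gag_measure s p \<Omega>)"
proof -
  have [measurable]: "diff2 u \<in> borel_measurable lebesgue" "diff2 \<phi> \<in> borel_measurable lebesgue"
    using diff2_measurable assms by blast+
  have "(\<lambda>z. \<bar>diff2 u z\<bar> powr (p - 2) * diff2 u z * diff2 \<phi> z) \<in> borel_measurable lebesgue"
    by measurable
  from gag_measure_eq_set_integral(2)[OF assms(1) this, of s p] show ?thesis
    unfolding frac_form_def by (simp add: diff2_def case_prod_beta')
qed

lemma set_integral_eq_lebesgue_on:
  fixes F :: "'a::euclidean_space \<Rightarrow> real"
  assumes "\<Omega> \<in> sets lebesgue"
  shows "set_integrable lebesgue \<Omega> F \<longleftrightarrow> integrable (lebesgue_on \<Omega>) F"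
    and "set_lebesgue_integral lebesgue \<Omega> F = (\<integral>x. F x \<partial>lebesgue_on \<Omega>)"
    and "set_borel_measurable lebesgue \<Omega> F \<longleftrightarrow> F \<in> borel_measurable (lebesgue_on \<Omega>)"
  using assms
  by (simp_all add: set_integrable_def set_lebesgue_integral_def set_borel_measurable_def
      integrable_restrict_space integral_restrict_space borel_measurable_restrict_space_iff)

lemma Lp_on_eq:
  fixes \<Omega> :: "(real^'n) set"
  assumes "\<Omega> \<in> sets lebesgue"
  shows "Lp_on r \<Omega> = Lspace (lebesgue_on \<Omega>) r"
    and "Lp_norm_on r \<Omega> u = (\<integral>x. \<bar>u x\<bar> powr r \<partial>lebesgue_on \<Omega>) powr (1 / r)"
  using set_integral_eq_lebesgue_on[OF assms]
  by (auto simp: Lp_on_def Lspace_def Lp_norm_on_def)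

section \<open>Test functions\<close>

lemma Ck_on_UNIV_comb:
  fixes f g :: "real^'n \<Rightarrow> real"
  assumes "Ck_on k UNIV f" "Ck_on k UNIV g"
  shows "Ck_on k UNIV (\<lambda>x. a * f x + b * g x)"
  using assms
proof (induction k arbitrary: f g)
  case 0
  then show ?case by (auto intro!: continuous_intros)
next
  case (Suc k)
  have D: "((\<lambda>x. a * f x + b * g x) has_derivative
      (\<lambda>w. a * frechet_derivative f (at x) w + b * frechet_derivative g (at x) w)) (at x)" for x
  proof -
    have "(f has_derivative frechet_derivative f (at x)) (at x)"
      "(g has_derivative frechet_derivative g (at x)) (at x)"
      using Suc.prems by (simp_all only: Ck_on.simps frechet_derivative_works[symmetric] UNIV_I)
    then show ?thesis by (intro has_derivative_add has_derivative_mult_right)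
  qed
  have "frechet_derivative (\<lambda>x. a * f x + b * g x) (at x)
      = (\<lambda>w. a * frechet_derivative f (at x) w + b * frechet_derivative g (at x) w)" for x
    by (rule frechet_derivative_at[OF D, symmetric])
  moreover have "(\<lambda>x. a * f x + b * g x) differentiable (at x)" for x
    using D differentiable_def by blast
  ultimately show ?case using Suc by simp
qed

lemma test_functions_comb:
  assumes "\<phi> \<in> test_functions \<Omega>" "\<psi> \<in> test_functions \<Omega>"
  shows "(\<lambda>x. a * \<phi> x + b * \<psi> x) \<in> test_functions \<Omega>"
proof -
  let ?c = "\<lambda>x. a * \<phi> x + b * \<psi> x"
  have "{x. ?c x \<noteq> 0} \<subseteq> {x. \<phi> x \<noteq> 0} \<union> {x. \<psi> x \<noteq> 0}" by auto
  from closure_mono[OF this]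
  have sub: "closure {x. ?c x \<noteq> 0} \<subseteq> closure {x. \<phi> x \<noteq> 0} \<union> closure {x. \<psi> x \<noteq> 0}"
    by (simp only: closure_Un)
  moreover have "compact (closure {x. \<phi> x \<noteq> 0} \<union> closure {x. \<psi> x \<noteq> 0})"
    using assms by (simp add: test_functions_def compact_Un)
  ultimately have "compact (closure {x. ?c x \<noteq> 0})"
    by (meson bounded_subset closed_closure compact_eq_bounded_closed)
  with sub show ?thesis
    using assms by (auto simp: test_functions_def smooth_fun_on_def intro!: Ck_on_UNIV_comb)
qed

lemma test_functions_zero_outside: "\<phi> \<in> test_functions \<Omega> \<Longrightarrow> x \<notin> \<Omega> \<Longrightarrow> \<phi> x = 0"
  using closure_subset[of "{x. \<phi> x \<noteq> 0}"] unfolding test_functions_def by blast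

lemma test_functions_continuous: "\<phi> \<in> test_functions \<Omega> \<Longrightarrow> continuous_on UNIV \<phi>"
  unfolding test_functions_def smooth_fun_on_def by (auto dest: spec[of _ 0])

text \<open>A test function is bounded and globally Lipschitz: on a ball that contains the support with
  a margin of one its derivative is bounded by compactness, and points separated by the margin are
  covered by the bound for the function itself.\<close>

lemma test_functions_bounded_Lipschitz:
  assumes "\<phi> \<in> test_functions (\<Omega> :: (real^'n) set)"
  obtains C where "0 \<le> C" "\<And>x. \<bar>\<phi> x\<bar> \<le> C" "\<And>x y. \<bar>\<phi> x - \<phi> y\<bar> \<le> C"
    "\<And>x y. \<bar>\<phi> x - \<phi> y\<bar> \<le> C * norm (x - y)"
proof -
  define K where "K = closure {x. \<phi> x \<noteq> 0}"
  have K: "compact K" "\<And>x. x \<notin> K \<Longrightarrow> \<phi> x = 0"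
    using assms closure_subset[of "{x. \<phi> x \<noteq> 0}"] unfolding test_functions_def K_def by blast+
  have cont: "continuous_on UNIV \<phi>" using test_functions_continuous[OF assms] .
  obtain R where R: "\<And>x. x \<in> K \<Longrightarrow> norm x \<le> R" "R > 0"
    using compact_imp_bounded[OF K(1)] by (auto simp: bounded_pos)
  have "bounded (\<phi> ` K)"
    using compact_continuous_image[OF continuous_on_subset[OF cont] K(1)] compact_imp_bounded by auto
  then obtain M where M: "M > 0" "\<And>x. x \<in> K \<Longrightarrow> \<bar>\<phi> x\<bar> \<le> M" by (auto simp: bounded_pos)
  have M': "\<bar>\<phi> x\<bar> \<le> M" for x using M K(2)[of x] by (cases "x \<in> K") auto
  have C1: "Ck_on (Suc 0) UNIV \<phi>" using assms by (simp add: test_functions_def smooth_fun_on_def del: Ck_on.simps)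
  have der: "(\<phi> has_derivative frechet_derivative \<phi> (at x)) (at x)" for x
    using C1 by (simp only: Ck_on.simps frechet_derivative_works[symmetric] UNIV_I)
  have "continuous_on UNIV (\<lambda>x. \<Sum>b\<in>Basis. norm (frechet_derivative \<phi> (at x) b))"
    using C1 by (intro continuous_intros) auto
  then have "bounded ((\<lambda>x. \<Sum>b\<in>Basis. norm (frechet_derivative \<phi> (at x) b)) ` cball 0 (R + 1))"
    using compact_continuous_image[OF continuous_on_subset compact_cball] compact_imp_bounded by blast
  then obtain L where L: "L > 0" "\<And>x. x \<in> cball 0 (R + 1) \<Longrightarrow>
      norm (\<Sum>b\<in>Basis. norm (frechet_derivative \<phi> (at x) b)) \<le> L" by (auto simp: bounded_pos)
  have on: "onorm (frechet_derivative \<phi> (at x)) \<le> L" if "x \<in> cball 0 (R + 1)" for x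
    using onorm_componentwise[OF has_derivative_bounded_linear[OF der[of x]]] L(2)[OF that] by simp
  have inner: "\<bar>\<phi> x - \<phi> y\<bar> \<le> L * norm (x - y)"
    if "x \<in> cball 0 (R + 1)" "y \<in> cball 0 (R + 1)" for x y
    using differentiable_bound[OF convex_cball has_derivative_at_withinI[OF der] on that] by simp
  have near: "\<bar>\<phi> x - \<phi> y\<bar> \<le> (2 * M + L) * norm (x - y)" if "x \<in> K" for x y
  proof (cases "y \<in> cball 0 (R + 1)")
    case True
    have "\<bar>\<phi> x - \<phi> y\<bar> \<le> L * norm (x - y)"
      using inner True R(1)[OF that] by simp
    also have "\<dots> \<le> (2 * M + L) * norm (x - y)" using M by (intro mult_right_mono) auto
    finally show ?thesis .
  next
    case False
    then have "1 \<le> norm (x - y)"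
      using R(1)[OF that] norm_triangle_ineq2[of y x] by (simp add: norm_minus_commute)
    then have "(2 * M + L) * 1 \<le> (2 * M + L) * norm (x - y)"
      using M L by (intro mult_left_mono) auto
    moreover have "\<bar>\<phi> x - \<phi> y\<bar> \<le> (2 * M + L) * 1"
      using abs_triangle_ineq4[of "\<phi> x" "\<phi> y"] M'[of x] M'[of y] L(1) by simp
    ultimately show ?thesis by (rule order_trans[rotated])
  qed
  show ?thesis
  proof (rule that[of "2 * M + L"])
    show "0 \<le> 2 * M + L" using M L by simp
    show "\<bar>\<phi> x\<bar> \<le> 2 * M + L" for x using M'[of x] M(1) L(1) by linarith
    show "\<bar>\<phi> x - \<phi> y\<bar> \<le> 2 * M + L" for x y using M'[of x] M'[of y] L(1) by linarith
    show "\<bar>\<phi> x - \<phi> y\<bar> \<le> (2 * M + L) * norm (x - y)" for x y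
      using near[of x y] near[of y x] K(2)[of x] K(2)[of y] M L
      by (cases "x \<in> K"; cases "y \<in> K") (auto simp: abs_minus_commute norm_minus_commute)
  qed
qed

text \<open>Integrability criterion for functions that are controlled on countably many balls, used with
  dyadic radii in place of polar coordinates.\<close>

lemma nn_integral_finite_of_ball_cover:
  fixes \<Psi> :: "real^'n \<Rightarrow> real" and c r :: "nat \<Rightarrow> real"
  assumes cover: "\<And>z. z \<noteq> 0 \<Longrightarrow> \<Psi> z \<noteq> 0 \<Longrightarrow> \<exists>k. norm z \<le> r k \<and> \<Psi> z \<le> c k"
    and nn: "\<And>k. 0 \<le> c k" "\<And>k. 0 \<le> r k"
    and sm: "summable (\<lambda>k. c k * r k ^ CARD('n))"
  shows "(\<integral>\<^sup>+z. ennreal (\<Psi> z) \<partial>lborel) < \<infinity>"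
proof -
  have "AE z in (lborel :: (real^'n) measure). ennreal (\<Psi> z) \<le> (\<Sum>k. ennreal (c k) * indicator (cball 0 (r k)) z)"
    using AE_lborel_singleton[of "0 :: real^'n"]
  proof eventually_elim
    case (elim z)
    show ?case
    proof (cases "\<Psi> z = 0")
      case False
      then obtain k where k: "norm z \<le> r k" "\<Psi> z \<le> c k" using cover elim by blast
      have "ennreal (\<Psi> z) \<le> (\<Sum>j\<in>{k}. ennreal (c j) * indicator (cball 0 (r j)) z)"
        using k by (simp add: ennreal_leI)
      also have "\<dots> \<le> (\<Sum>k. ennreal (c k) * indicator (cball 0 (r k)) z)"
        by (rule sum_le_suminf) auto
      finally show ?thesis .
    qed simp
  qed
  then have "(\<integral>\<^sup>+z. ennreal (\<Psi> z) \<partial>lborel)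
      \<le> (\<integral>\<^sup>+z. (\<Sum>k. ennreal (c k) * indicator (cball 0 (r k)) (z :: real^'n)) \<partial>lborel)"
    by (rule nn_integral_mono_AE)
  also have "\<dots> = (\<Sum>k. \<integral>\<^sup>+z. ennreal (c k) * indicator (cball 0 (r k)) (z :: real^'n) \<partial>lborel)"
    by (intro nn_integral_suminf borel_measurable_times_ennreal borel_measurable_indicator) auto
  also have "\<dots> = (\<Sum>k. ennreal (unit_ball_vol (real CARD('n)) * (c k * r k ^ CARD('n))))"
    using nn by (intro suminf_cong)
      (simp add: nn_integral_cmult_indicator emeasure_cball ennreal_mult'[symmetric] mult_ac)
  also have "\<dots> < \<infinity>"
    using nn sm by (subst suminf_ennreal2) (auto intro!: summable_mult mult_nonneg_nonneg unit_ball_vol_nonneg)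
  finally show ?thesis .
qed

lemma nn_integral_min_kernel_finite:
  fixes s p :: real
  assumes "0 < s" "s < 1" "1 < p"
  shows "(\<integral>\<^sup>+(z::real^'n). ennreal (min 1 (norm z) powr p / norm z powr (real CARD('n) + p * s)) \<partial>lborel) < \<infinity>"
proof -
  define d where "d = real CARD('n) + p * s"
  have d: "d > 0" using assms by (simp add: d_def add_pos_pos)
  define I where "I z = min 1 (norm z) powr p / norm z powr d" for z :: "real^'n"
  define I1 where "I1 z = (if norm z \<le> 1 then I z else 0)" for z
  define I2 where "I2 z = (if norm z \<le> 1 then 0 else I z)" for z
  have half: "(2::real) powr (- real k * x) = (2 powr (- x)) ^ k" for k x
    by (simp add: powr_realpow[symmetric] powr_powr mult.commute)
  have n: "((2::real) powr y) ^ CARD('n) = 2 powr (real CARD('n) * y)" for y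
    by (simp add: powr_realpow[symmetric] powr_powr mult.commute)
  have "(\<integral>\<^sup>+z. ennreal (I1 z) \<partial>lborel) < \<infinity>"
  proof (rule nn_integral_finite_of_ball_cover)
    let ?c = "\<lambda>k::nat. (2 powr (- real k)) powr p / (2 powr (- real (Suc k))) powr d"
    let ?r = "\<lambda>k::nat. 2 powr (- real k) :: real"
    fix z :: "real^'n" assume z: "z \<noteq> 0" "I1 z \<noteq> 0"
    then have z1: "norm z \<le> 1" by (auto simp: I1_def split: if_splits)
    define k where "k = nat \<lfloor>- log 2 (norm z)\<rfloor>"
    have l0: "0 \<le> - log 2 (norm z)" using z z1 by (simp add: log_le_zero_cancel_iff)
    then have "real k \<le> - log 2 (norm z)" "- log 2 (norm z) < real (Suc k)"
      by (auto simp: k_def) linarith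
    then have "log 2 (norm z) \<le> - real k" "- real (Suc k) < log 2 (norm z)" by auto
    then have zk: "norm z \<le> 2 powr (- real k)" "2 powr (- real (Suc k)) < norm z"
      using z by (auto simp: log_le_iff less_log_iff)
    have "I z \<le> ?c k"
      unfolding I_def using zk z1 z d assms by (intro frac_le powr_mono2) auto
    then show "\<exists>k. norm z \<le> ?r k \<and> I1 z \<le> ?c k"
      using zk z1 by (auto simp: I1_def)
  next
    have "(2 powr (- real k)) powr p / (2 powr (- real (Suc k))) powr d * (2 powr (- real k)) ^ CARD('n)
       = 2 powr d * (2 powr (- (p * (1 - s)))) ^ k" for k
      unfolding n half[symmetric] powr_powr powr_diff[symmetric] powr_add[symmetric]
      by (rule arg_cong[where f = "\<lambda>x. 2 powr x"]) (simp add: d_def algebra_simps)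
    moreover have "2 powr (- (p * (1 - s))) < (1::real)"
      using assms by (intro powr_less_one) auto
    ultimately show "summable (\<lambda>k. (2 powr (- real k)) powr p / (2 powr (- real (Suc k))) powr d
        * (2 powr (- real k)) ^ CARD('n))"
      by (simp only:) (intro summable_mult summable_geometric, simp)
  qed auto
  moreover have "(\<integral>\<^sup>+z. ennreal (I2 z) \<partial>lborel) < \<infinity>"
  proof (rule nn_integral_finite_of_ball_cover)
    let ?c = "\<lambda>k::nat. 1 / (2 powr (real k)) powr d :: real"
    let ?r = "\<lambda>k::nat. 2 powr (real (Suc k)) :: real"
    fix z :: "real^'n" assume z: "z \<noteq> 0" "I2 z \<noteq> 0"
    then have z1: "norm z > 1" by (auto simp: I2_def split: if_splits)
    define k where "k = nat \<lfloor>log 2 (norm z)\<rfloor>"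
    have l0: "0 \<le> log 2 (norm z)" using z1 z by (simp add: zero_le_log_cancel_iff less_imp_le)
    then have "real k \<le> log 2 (norm z)" "log 2 (norm z) < real (Suc k)"
      by (auto simp: k_def) linarith
    then have zk: "2 powr (real k) \<le> norm z" "norm z \<le> 2 powr (real (Suc k))"
      using z by (auto simp: log_less_iff le_log_iff less_imp_le simp del: of_nat_Suc)
    have "I z \<le> 1 / (2 powr (real k)) powr d"
      unfolding I_def using zk z1 z d assms by (intro frac_le powr_mono2) auto
    then show "\<exists>k. norm z \<le> ?r k \<and> I2 z \<le> ?c k"
      using zk z1 by (auto simp: I2_def simp del: of_nat_Suc)
  next
    have "1 / (2 powr (real k)) powr d * (2 powr (real (Suc k))) ^ CARD('n)
       = 2 powr (real CARD('n)) * (2 powr (- (p * s))) ^ k" for k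
      unfolding n half[symmetric] powr_powr powr_add[symmetric] powr_minus_divide[symmetric]
      by (rule arg_cong[where f = "\<lambda>x. 2 powr x"]) (simp add: d_def algebra_simps)
    moreover have "2 powr (- (p * s)) < (1::real)"
      using assms by (intro powr_less_one) auto
    ultimately show "summable (\<lambda>k. 1 / (2 powr (real k)) powr d
        * (2 powr (real (Suc k))) ^ CARD('n) :: real)"
      by (simp only:) (intro summable_mult summable_geometric, simp)
  qed auto
  moreover have "(\<integral>\<^sup>+z. ennreal (I z) \<partial>lborel)
     = (\<integral>\<^sup>+z. ennreal (I1 z) \<partial>lborel) + (\<integral>\<^sup>+z. ennreal (I2 z) \<partial>lborel)"
  proof -
    have [measurable]: "I1 \<in> borel_measurable borel" "I2 \<in> borel_measurable borel"
      unfolding I1_def I2_def I_def by measurable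
    have m: "(\<lambda>z. ennreal (I1 z)) \<in> borel_measurable lborel"
      "(\<lambda>z. ennreal (I2 z)) \<in> borel_measurable lborel"
      by measurable
    show ?thesis
      unfolding nn_integral_add[OF m, symmetric]
      by (intro nn_integral_cong) (simp add: I1_def I2_def)
  qed
  ultimately show ?thesis by (simp add: I_def d_def less_top[symmetric])
qed

lemma nn_integral_lborel_shift:
  fixes F :: "'a::euclidean_space \<Rightarrow> ennreal"
  assumes "F \<in> borel_measurable borel"
  shows "(\<integral>\<^sup>+y. F (c + y) \<partial>lborel) = (\<integral>\<^sup>+y. F y \<partial>lborel)"
proof -
  have "(\<integral>\<^sup>+y. F y \<partial>lborel) = (\<integral>\<^sup>+y. F y \<partial>distr lborel borel ((+) c))"
    by (simp add: lborel_distr_plus)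
  also have "\<dots> = (\<integral>\<^sup>+y. F (c + y) \<partial>lborel)"
    using assms by (subst nn_integral_distr) auto
  finally show ?thesis ..
qed

text \<open>Bounded Lipschitz functions have finite energy because \<open>Q\<close> is the union of \<open>\<Omega> \<times> \<real>\<^sup>n\<close> and
  \<open>\<real>\<^sup>n \<times> \<Omega>\<close>, and the quotient of \<open>min 1 (\<bar>z\<bar>\<^sup>p)\<close> by \<open>\<bar>z\<bar>\<close> to the power \<open>n + p s\<close> is integrable both at the origin
  (as \<open>s < 1\<close>) and at infinity (as \<open>s > 0\<close>).\<close>

lemma bounded_Lipschitz_energy_finite:
  fixes u :: "real^'n \<Rightarrow> real"
  assumes \<Omega>: "open \<Omega>" "bounded \<Omega>" and sp: "0 < s" "s < 1" "1 < p"
    and u: "continuous_on UNIV u" and C: "0 \<le> C" "\<And>x y. \<bar>u x - u y\<bar> \<le> C"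
      "\<And>x y. \<bar>u x - u y\<bar> \<le> C * norm (x - y)"
  shows "diff2 u \<in> Lspace (gag_measure s p \<Omega>) p"
proof -
  define d where "d = real CARD('n) + p * s"
  define I where "I z = min 1 (norm z) powr p / norm z powr d" for z :: "real^'n"
  have [measurable]: "I \<in> borel_measurable borel" unfolding I_def by measurable
  have [measurable]: "u \<in> borel_measurable borel" using u by (rule borel_measurable_continuous_onI)
  have [measurable]: "\<Omega> \<in> sets borel" using \<Omega> by simp
  have um: "u \<in> borel_measurable lebesgue" by (intro measurable_completion) simp
  have I0: "0 \<le> I z" for z by (simp add: I_def)
  define J where "J = (\<integral>\<^sup>+z. ennreal (I z) \<partial>lborel)"
  have J: "J < \<infinity>" unfolding J_def I_def d_def using nn_integral_min_kernel_finite[OF sp] .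
  have shift: "(\<integral>\<^sup>+y. ennreal (I (y - x)) \<partial>lborel) = J" for x
    using nn_integral_lborel_shift[of "\<lambda>z. ennreal (I z)" "- x"] by (simp add: J_def)
  have point: "\<bar>diff2 u z\<bar> powr p * gag_weight s p \<Omega> z
     \<le> C powr p * (indicator \<Omega> (fst z) * I (snd z - fst z) + indicator \<Omega> (snd z) * I (fst z - snd z))" for z
  proof (cases "z \<in> Q_set \<Omega>")
    case True
    have "\<bar>diff2 u z\<bar> \<le> C * min 1 (norm (fst z - snd z))"
      using C(2,3)[of "fst z" "snd z"] by (auto simp: diff2_def min_def)
    then have "\<bar>diff2 u z\<bar> powr p \<le> (C * min 1 (norm (fst z - snd z))) powr p"
      using sp by (intro powr_mono2) auto
    then have "\<bar>diff2 u z\<bar> powr p \<le> C powr p * min 1 (norm (fst z - snd z)) powr p"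
      by (simp add: powr_mult)
    then have "\<bar>diff2 u z\<bar> powr p / norm (fst z - snd z) powr d \<le> C powr p * I (fst z - snd z)"
      unfolding I_def by (simp add: divide_right_mono)
    moreover have "I (snd z - fst z) = I (fst z - snd z)" by (simp add: I_def norm_minus_commute)
    moreover have "fst z \<in> \<Omega> \<or> snd z \<in> \<Omega>" using True by (cases z) (auto simp: Q_set_def)
    moreover have "0 \<le> C powr p * I (fst z - snd z)" using I0 by simp
    ultimately show ?thesis using True
      by (auto simp: gag_weight_def frac_kernel_def d_def indicator_def algebra_simps)
  next
    case False
    then show ?thesis using I0 by (simp add: gag_weight_def)
  qed
  have meas: "(\<lambda>z. ennreal (indicator \<Omega> (fst z) * I (snd z - fst z))) \<in> borel_measurable (borel \<Otimes>\<^sub>M borel)"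
     "(\<lambda>z. ennreal (indicator \<Omega> (snd z) * I (fst z - snd z))) \<in> borel_measurable (borel \<Otimes>\<^sub>M borel)"
    by measurable
  have e\<Omega>: "emeasure lborel \<Omega> < \<infinity>" using emeasure_bounded_finite[OF \<Omega>(2)] .
  have 1: "(\<integral>\<^sup>+z. ennreal (indicator \<Omega> (fst z) * I (snd z - fst z)) \<partial>lborel) = emeasure lborel \<Omega> * J"
  proof -
    have "(\<integral>\<^sup>+z. ennreal (indicator \<Omega> (fst z) * I (snd z - fst z)) \<partial>(lborel \<Otimes>\<^sub>M lborel))
       = (\<integral>\<^sup>+x. \<integral>\<^sup>+y. ennreal (indicator \<Omega> x * I (y - x)) \<partial>lborel \<partial>lborel)"
      using meas(1) by (subst lborel.nn_integral_fst[symmetric]) auto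
    also have "\<dots> = (\<integral>\<^sup>+x. indicator \<Omega> x * J \<partial>lborel)"
      by (intro nn_integral_cong) (auto simp: indicator_def shift)
    also have "\<dots> = emeasure lborel \<Omega> * J"
      by (subst nn_integral_multc) auto
    finally show ?thesis by (simp add: lborel_prod)
  qed
  have 2: "(\<integral>\<^sup>+z. ennreal (indicator \<Omega> (snd z) * I (fst z - snd z)) \<partial>lborel) = emeasure lborel \<Omega> * J"
  proof -
    have "(\<integral>\<^sup>+z. ennreal (indicator \<Omega> (snd z) * I (fst z - snd z)) \<partial>(lborel \<Otimes>\<^sub>M lborel))
       = (\<integral>\<^sup>+y. \<integral>\<^sup>+x. ennreal (indicator \<Omega> y * I (x - y)) \<partial>lborel \<partial>lborel)"
      using meas(2) by (subst lborel_pair.nn_integral_snd[symmetric]) auto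
    also have "\<dots> = (\<integral>\<^sup>+x. indicator \<Omega> x * J \<partial>lborel)"
      by (intro nn_integral_cong) (auto simp: indicator_def shift)
    also have "\<dots> = emeasure lborel \<Omega> * J"
      by (subst nn_integral_multc) auto
    finally show ?thesis by (simp add: lborel_prod)
  qed
  have Dm [measurable]: "diff2 u \<in> borel_measurable lebesgue" using diff2_measurable[OF um] .
  have wm [measurable]: "gag_weight s p \<Omega> \<in> borel_measurable lebesgue"
    by (rule gag_weight_measurable_lebesgue[OF \<Omega>(1)])
  have "(\<integral>\<^sup>+z. ennreal (\<bar>diff2 u z\<bar> powr p) \<partial>gag_measure s p \<Omega>)
      = (\<integral>\<^sup>+z. ennreal (gag_weight s p \<Omega> z) * ennreal (\<bar>diff2 u z\<bar> powr p) \<partial>lebesgue)"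
    unfolding gag_measure_def by (rule nn_integral_density) measurable
  also have "\<dots> = (\<integral>\<^sup>+z. ennreal (\<bar>diff2 u z\<bar> powr p * gag_weight s p \<Omega> z) \<partial>lborel)"
    by (simp add: nn_integral_completion ennreal_mult[symmetric] gag_weight_nonneg mult.commute)
  also have "\<dots> \<le> (\<integral>\<^sup>+z. ennreal (C powr p * (indicator \<Omega> (fst z) * I (snd z - fst z)
       + indicator \<Omega> (snd z) * I (fst z - snd z))) \<partial>lborel)"
    by (intro nn_integral_mono ennreal_leI point)
  also have "\<dots> = (\<integral>\<^sup>+z. ennreal (C powr p) * (ennreal (indicator \<Omega> (fst z) * I (snd z - fst z))
       + ennreal (indicator \<Omega> (snd z) * I (fst z - snd z))) \<partial>lborel)"
    by (intro nn_integral_cong) (simp add: ennreal_mult ennreal_plus I0 del: ennreal_plus_if)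
  also have "\<dots> = ennreal (C powr p) * (\<integral>\<^sup>+z. (ennreal (indicator \<Omega> (fst z) * I (snd z - fst z))
       + ennreal (indicator \<Omega> (snd z) * I (fst z - snd z))) \<partial>lborel)"
    using meas by (intro nn_integral_cmult) (simp add: borel_prod)
  also have "\<dots> = ennreal (C powr p) * (emeasure lborel \<Omega> * J + emeasure lborel \<Omega> * J)"
  proof (subst nn_integral_add)
    show "(\<lambda>z. ennreal (indicator \<Omega> (fst z) * I (snd z - fst z))) \<in> borel_measurable lborel"
      "(\<lambda>z. ennreal (indicator \<Omega> (snd z) * I (fst z - snd z))) \<in> borel_measurable lborel"
      using meas by (simp_all add: borel_prod)
  qed (simp only: 1 2)
  also have "\<dots> < \<infinity>" using e\<Omega> J by (auto simp: ennreal_mult_less_top)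
  finally have fin: "(\<integral>\<^sup>+z. ennreal (\<bar>diff2 u z\<bar> powr p) \<partial>gag_measure s p \<Omega>) < \<infinity>" .
  have "(\<lambda>z. \<bar>diff2 u z\<bar> powr p) \<in> borel_measurable (gag_measure s p \<Omega>)"
    unfolding measurable_gag_measure by measurable
  then have "integrable (gag_measure s p \<Omega>) (\<lambda>z. \<bar>diff2 u z\<bar> powr p)"
    by (intro integrableI_nonneg) (use fin in auto)
  then show ?thesis using Dm by (simp add: Lspace_def measurable_gag_measure)
qed

text \<open>The smooth cutoff \<open>exp (- 1 / t)\<close>, divided by powers of \<open>t\<close> so that the derivative of a member
  is a combination of members.\<close>

definition flat_exp :: "nat \<Rightarrow> real \<Rightarrow> real" where
  "flat_exp k t = (if t \<le> 0 then 0 else exp (- (1 / t)) / t ^ k)"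

lemma flat_exp_tendsto_0: "(flat_exp k \<longlongrightarrow> 0) (at 0)"
proof -
  have "((\<lambda>x::real. x ^ k / exp x) \<longlongrightarrow> 0) at_top"
    by (rule tendsto_power_div_exp_0)
  from filterlim_compose[OF this filterlim_inverse_at_top_right]
  have "((\<lambda>t::real. inverse t ^ k / exp (inverse t)) \<longlongrightarrow> 0) (at_right 0)" .
  moreover have "\<forall>\<^sub>F t::real in at_right 0. inverse t ^ k / exp (inverse t) = flat_exp k t"
    by (simp add: eventually_at_filter flat_exp_def exp_minus field_simps)
  ultimately have "(flat_exp k \<longlongrightarrow> 0) (at_right 0)"
    by (rule Lim_transform_eventually)
  moreover have "\<forall>\<^sub>F t::real in at_left 0. 0 = flat_exp k t"
    by (simp add: eventually_at_filter flat_exp_def)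
  then have "(flat_exp k \<longlongrightarrow> 0) (at_left 0)"
    by (rule Lim_transform_eventually[OF tendsto_const])
  ultimately show ?thesis by (simp add: filterlim_at_split)
qed

lemma DERIV_flat_exp:
  "(flat_exp k has_real_derivative flat_exp (k + 2) t - real k * flat_exp (k + 1) t) (at t)"
proof -
  consider "t > 0" | "t < 0" | "t = 0" by linarith
  then show ?thesis
  proof cases
    case 1
    have "((\<lambda>t. exp (- (1 / t)) / t ^ k) has_real_derivative
        (exp (- (1 / t)) * (1 / t ^ 2) * t ^ k - exp (- (1 / t)) * (real k * t ^ (k - 1))) / (t ^ k * t ^ k)) (at t)"
      using 1 by (auto intro!: derivative_eq_intros simp: power2_eq_square)
    moreover have "(exp (- (1 / t)) * (1 / t ^ 2) * t ^ k - exp (- (1 / t)) * (real k * t ^ (k - 1))) / (t ^ k * t ^ k)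
       = flat_exp (k + 2) t - real k * flat_exp (k + 1) t"
      using 1 by (cases k) (simp_all add: flat_exp_def field_simps power2_eq_square)
    moreover have "\<forall>\<^sub>F x in nhds t. flat_exp k x = exp (- (1 / x)) / x ^ k"
      using eventually_nhds_in_open[of "{0<..}" t] 1 by (auto elim!: eventually_mono simp: flat_exp_def)
    ultimately show ?thesis by (subst DERIV_cong_ev[OF refl _ refl]) auto
  next
    case 2
    have "\<forall>\<^sub>F x in nhds t. flat_exp k x = 0"
      using eventually_nhds_in_open[of "{..<0}" t] 2 by (auto elim!: eventually_mono simp: flat_exp_def)
    then show ?thesis
      using 2 by (subst DERIV_cong_ev[OF refl _ refl]) (auto simp: flat_exp_def)
  next
    case 3
    have "\<forall>\<^sub>F h::real in at 0. flat_exp (k + 1) h = flat_exp k h / h"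
      by (auto simp: eventually_at_filter flat_exp_def)
    then have "((\<lambda>h. flat_exp k h / h) \<longlongrightarrow> 0) (at 0)"
      using flat_exp_tendsto_0 by (rule Lim_transform_eventually[rotated])
    then show ?thesis using 3 by (simp add: DERIV_def flat_exp_def)
  qed
qed

text \<open>An algebra containing the bump function and closed under directional derivatives; smoothness to
  all orders then follows by induction, without computing any derivative explicitly.\<close>

inductive_set bump_algebra :: "real^'n \<Rightarrow> real \<Rightarrow> (real^'n \<Rightarrow> real) set"
  for a :: "real^'n" and R :: real where
  const: "(\<lambda>x. c) \<in> bump_algebra a R"
| inner: "(\<lambda>x. x \<bullet> w) \<in> bump_algebra a R"
| flat: "(\<lambda>x. flat_exp k (R - (x - a) \<bullet> (x - a))) \<in> bump_algebra a R"
| add: "f \<in> bump_algebra a R \<Longrightarrow> g \<in> bump_algebra a R \<Longrightarrow> (\<lambda>x. f x + g x) \<in> bump_algebra a R"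
| mult: "f \<in> bump_algebra a R \<Longrightarrow> g \<in> bump_algebra a R \<Longrightarrow> (\<lambda>x. f x * g x) \<in> bump_algebra a R"

lemma bump_algebra_derivative:
  assumes "f \<in> bump_algebra a R"
  shows "\<exists>D. (\<forall>x. (f has_derivative D x) (at x)) \<and> (\<forall>w. (\<lambda>x. D x w) \<in> bump_algebra a R)"
  using assms
proof induction
  case (const c)
  then show ?case
    by (intro exI[of _ "\<lambda>x w. 0"]) (auto intro: bump_algebra.const)
next
  case (inner w)
  then show ?case
    by (intro exI[of _ "\<lambda>x v. v \<bullet> w"]) (auto intro: bump_algebra.const intro!: derivative_eq_intros)
next
  case (flat k)
  define e where "e k x = flat_exp k (R - (x - a) \<bullet> (x - a))" for k x
  define D where "D x v = (e (k + 2) x + (- real k) * e (k + 1) x) * ((- 2) * (x \<bullet> v + - (a \<bullet> v)))" for x v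
  have "((\<lambda>x. R - (x - a) \<bullet> (x - a)) has_derivative (\<lambda>v. - 2 * (x \<bullet> v + - (a \<bullet> v)))) (at x)" for x
    by (auto intro!: derivative_eq_intros simp: inner_diff_left inner_diff_right inner_commute algebra_simps)
  note R = this
  have "((\<lambda>x. flat_exp k (R - (x - a) \<bullet> (x - a))) has_derivative D x) (at x)" for x
    by (rule has_derivative_eq_rhs[OF DERIV_compose_FDERIV[OF DERIV_flat_exp R]])
      (simp add: D_def e_def fun_eq_iff)
  moreover have "(\<lambda>x. D x w) \<in> bump_algebra a R" for w
    unfolding D_def e_def by (intro bump_algebra.intros)
  ultimately show ?case by blast
next
  case (add f g)
  then obtain D D' where D: "\<forall>x. (f has_derivative D x) (at x)" "\<forall>w. (\<lambda>x. D x w) \<in> bump_algebra a R"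
    "\<forall>x. (g has_derivative D' x) (at x)" "\<forall>w. (\<lambda>x. D' x w) \<in> bump_algebra a R" by blast
  then show ?case
    by (intro exI[of _ "\<lambda>x w. D x w + D' x w"])
      (auto intro: bump_algebra.add intro!: has_derivative_add)
next
  case (mult f g)
  then obtain D D' where D: "\<forall>x. (f has_derivative D x) (at x)" "\<forall>w. (\<lambda>x. D x w) \<in> bump_algebra a R"
    "\<forall>x. (g has_derivative D' x) (at x)" "\<forall>w. (\<lambda>x. D' x w) \<in> bump_algebra a R" by blast
  have "(\<lambda>x. f x * D' x w + D x w * g x) \<in> bump_algebra a R" for w
    using bump_algebra.add[OF bump_algebra.mult[OF mult.hyps(1) D(4)[rule_format]]
        bump_algebra.mult[OF D(2)[rule_format] mult.hyps(2)]] .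
  then show ?case using D
    by (intro exI[of _ "\<lambda>x w. f x * D' x w + D x w * g x"]) (auto intro!: has_derivative_mult)
qed

lemma bump_algebra_smooth:
  assumes "f \<in> bump_algebra a R"
  shows "Ck_on k UNIV f"
  using assms
proof (induction k arbitrary: f)
  case 0
  then obtain D where "\<forall>x. (f has_derivative D x) (at x)" using bump_algebra_derivative by blast
  then show ?case using has_derivative_continuous by (fastforce simp: continuous_on_eq_continuous_at)
next
  case (Suc k)
  then obtain D where D: "\<forall>x. (f has_derivative D x) (at x)" "\<forall>w. (\<lambda>x. D x w) \<in> bump_algebra a R"
    using bump_algebra_derivative by blast
  then have "frechet_derivative f (at x) = D x" for x by (metis frechet_derivative_at)
  then show ?case using D Suc.IH by (auto simp: differentiable_def)
qed

lemma bump_test_function: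
  fixes a :: "real^'n"
  assumes "cball a r \<subseteq> \<Omega>" "0 < r"
  obtains \<phi> where "\<phi> \<in> test_functions \<Omega>" "\<And>x. 0 \<le> \<phi> x" "\<And>x. x \<in> ball a r \<Longrightarrow> 0 < \<phi> x"
proof -
  define \<phi> where "\<phi> x = flat_exp 0 (r\<^sup>2 - (x - a) \<bullet> (x - a))" for x
  have pos: "0 < \<phi> x \<longleftrightarrow> x \<in> ball a r" "0 \<le> \<phi> x" for x
  proof -
    have "(x - a) \<bullet> (x - a) < r\<^sup>2 \<longleftrightarrow> norm (x - a) < r"
      using assms(2) by (simp add: norm_lt_square)
    then show "0 < \<phi> x \<longleftrightarrow> x \<in> ball a r"
      by (auto simp: \<phi>_def flat_exp_def dist_norm norm_minus_commute)
    show "0 \<le> \<phi> x" by (simp add: \<phi>_def flat_exp_def)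
  qed
  then have "{x. \<phi> x \<noteq> 0} \<subseteq> cball a r"
    by (metis (mono_tags, lifting) ball_subset_cball less_le mem_Collect_eq subset_eq)
  then have sub: "closure {x. \<phi> x \<noteq> 0} \<subseteq> cball a r" by (simp add: closure_minimal)
  then have "compact (closure {x. \<phi> x \<noteq> 0})"
    by (meson bounded_cball bounded_subset closed_closure compact_eq_bounded_closed)
  moreover have "smooth_fun_on UNIV \<phi>"
    unfolding smooth_fun_on_def \<phi>_def using bump_algebra_smooth[OF bump_algebra.flat] by blast
  ultimately have "\<phi> \<in> test_functions \<Omega>"
    using sub assms by (auto simp: test_functions_def)
  then show ?thesis using that pos by blast
qed

section \<open>The space of finite energy functions vanishing outside the domain\<close>

locale fractional_domain =
  fixes \<Omega> :: "(real^'n) set" and s p :: real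
  assumes open_domain: "open \<Omega>" and bounded_domain: "bounded \<Omega>" and domain_nonempty: "\<Omega> \<noteq> {}"
    and s_pos: "0 < s" and s_less_1: "s < 1" and p_gt_1: "1 < p"
begin

abbreviation "X0 \<equiv> X0_space s p \<Omega>"
abbreviation "E \<equiv> energy s p \<Omega>"
abbreviation "G \<equiv> gag_measure s p \<Omega>"
abbreviation "L \<equiv> lebesgue_on \<Omega>"

lemma domain_sets [simp, measurable]: "\<Omega> \<in> sets lebesgue" "\<Omega> \<in> sets borel"
  using open_domain by auto

lemma p_simps [simp]: "0 < p" "0 \<le> p" "1 \<le> p" "p \<noteq> 0"
  using p_gt_1 by auto

lemma measurable_domain: "u \<in> borel_measurable lebesgue \<Longrightarrow> u \<in> borel_measurable L"
  by (rule measurable_restrict_space1)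

lemma finite_measure_domain: "finite_measure L"
proof
  have "emeasure lebesgue \<Omega> < \<infinity>"
    using bounded_domain emeasure_bounded_finite by (simp add: less_top[symmetric])
  then show "emeasure L (space L) \<noteq> \<infinity>" by (simp add: emeasure_restrict_space)
qed

lemma bounded_Lspace:
  assumes "u \<in> borel_measurable lebesgue" "\<And>x. \<bar>u x\<bar> \<le> C" "0 < r"
  shows "u \<in> Lspace L r"
proof (rule LspaceI_dominated[where g = "\<lambda>x. C powr r"])
  interpret finite_measure L by (rule finite_measure_domain)
  show "integrable L (\<lambda>x. C powr r)" by simp
  show "AE x in L. \<bar>u x\<bar> powr r \<le> C powr r" using assms by (auto intro!: powr_mono2)
qed (use assms measurable_domain in auto)

lemma test_functions_Lspace:
  assumes "\<phi> \<in> test_functions \<Omega>"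
  shows "\<phi> \<in> borel_measurable lebesgue" "0 < r \<Longrightarrow> \<phi> \<in> Lspace L r" "diff2 \<phi> \<in> Lspace G p"
proof -
  have cont: "continuous_on UNIV \<phi>" using test_functions_continuous[OF assms] .
  then have "\<phi> \<in> borel_measurable borel" by (rule borel_measurable_continuous_onI)
  then show m: "\<phi> \<in> borel_measurable lebesgue" by (intro measurable_completion) simp
  obtain C where C: "0 \<le> C" "\<And>x. \<bar>\<phi> x\<bar> \<le> C" "\<And>x y. \<bar>\<phi> x - \<phi> y\<bar> \<le> C"
    "\<And>x y. \<bar>\<phi> x - \<phi> y\<bar> \<le> C * norm (x - y)"
    using test_functions_bounded_Lipschitz[OF assms] by blast
  show "\<phi> \<in> Lspace L r" if "0 < r" by (rule bounded_Lspace[OF m C(2) that])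
  show "diff2 \<phi> \<in> Lspace G p"
    by (rule bounded_Lipschitz_energy_finite[OF open_domain bounded_domain s_pos s_less_1 p_gt_1 cont C(1,3,4)])
qed

text \<open>Approximation is expressed through the \<open>p\<close>-th powers of the two seminorms. For these, sums
  are controlled by \<open>\<bar>a + b\<bar>\<^sup>p \<le> 2\<^sup>p (\<bar>a\<bar>\<^sup>p + \<bar>b\<bar>\<^sup>p)\<close>. Since test functions have finite energy, all
  integrals involved converge.\<close>

lemma X0_iff:
  "u \<in> X0 \<longleftrightarrow> u \<in> borel_measurable lebesgue \<and> u \<in> Lspace L p \<and> diff2 u \<in> Lspace G p \<and>
     (\<forall>e>0. \<exists>\<phi>\<in>test_functions \<Omega>. (\<integral>x. \<bar>u x - \<phi> x\<bar> powr p \<partial>L) < e \<and> E (\<lambda>x. u x - \<phi> x) < e)"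
proof -
  have X: "u \<in> X_space s p \<Omega> \<longleftrightarrow>
      u \<in> borel_measurable lebesgue \<and> u \<in> Lspace L p \<and> diff2 u \<in> Lspace G p"
    using set_integrable_gagliardo[OF open_domain, of u s p] Lp_on_eq(1)[of \<Omega> p]
    by (auto simp: X_space_def)
  have norm: "X_norm s p \<Omega> (\<lambda>x. u x - \<phi> x)
      = (\<integral>x. \<bar>u x - \<phi> x\<bar> powr p \<partial>L) powr (1 / p) + E (\<lambda>x. u x - \<phi> x) powr (1 / p)"
    if "u \<in> borel_measurable lebesgue" "\<phi> \<in> test_functions \<Omega>" for \<phi>
    using X0_norm_eq[OF open_domain, of "\<lambda>x. u x - \<phi> x" s p] Lp_on_eq(2)[of \<Omega> p "\<lambda>x. u x - \<phi> x"]
      that test_functions_Lspace(1)[OF that(2)] by (auto simp: X_norm_def)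
  have root_less: "a < e \<longleftrightarrow> a powr (1 / p) < e powr (1 / p)" if "0 \<le> a" "0 < e" for a e :: real
    using powr_less_mono2[of "1 / p" a e] powr_less_mono2[of "1 / p" e a] that
    by (cases a e rule: linorder_cases) auto
  have nn: "0 \<le> (\<integral>x. \<bar>u x - \<phi> x\<bar> powr p \<partial>L)" "0 \<le> E (\<lambda>x. u x - \<phi> x)" for \<phi>
    by (auto simp: energy_nonneg)
  show ?thesis (is "_ \<longleftrightarrow> ?P \<and> ?Q \<and> ?R \<and> (\<forall>e>0. \<exists>\<phi>\<in>_. ?A \<phi> < e \<and> ?B \<phi> < e)")
  proof
    assume u: "u \<in> X0"
    then have X': "?P \<and> ?Q \<and> ?R" using X by (simp add: X0_space_def)
    moreover have "\<exists>\<phi>\<in>test_functions \<Omega>. ?A \<phi> < e \<and> ?B \<phi> < e" if "e > 0" for e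
    proof -
      have "e powr (1 / p) > 0" using that by simp
      then obtain \<phi> where \<phi>: "\<phi> \<in> test_functions \<Omega>" "X_norm s p \<Omega> (\<lambda>x. u x - \<phi> x) < e powr (1 / p)"
        using u unfolding X0_space_def by blast
      then have "?A \<phi> powr (1 / p) + ?B \<phi> powr (1 / p) < e powr (1 / p)"
        using norm X' by simp
      then have "?A \<phi> powr (1 / p) < e powr (1 / p)" "?B \<phi> powr (1 / p) < e powr (1 / p)"
        using powr_ge_zero[of "?A \<phi>" "1 / p"] powr_ge_zero[of "?B \<phi>" "1 / p"] by linarith+
      then show ?thesis using root_less nn that \<phi>(1) by blast
    qed
    ultimately show "?P \<and> ?Q \<and> ?R \<and> (\<forall>e>0. \<exists>\<phi>\<in>test_functions \<Omega>. ?A \<phi> < e \<and> ?B \<phi> < e)" by blast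
  next
    assume R: "?P \<and> ?Q \<and> ?R \<and> (\<forall>e>0. \<exists>\<phi>\<in>test_functions \<Omega>. ?A \<phi> < e \<and> ?B \<phi> < e)"
    have "\<exists>\<phi>\<in>test_functions \<Omega>. X_norm s p \<Omega> (\<lambda>x. u x - \<phi> x) < e" if "e > 0" for e
    proof -
      have e: "(e / 2) powr p > 0" "((e / 2) powr p) powr (1 / p) = e / 2"
        using that by (auto simp: powr_powr)
      then obtain \<phi> where \<phi>: "\<phi> \<in> test_functions \<Omega>" "?A \<phi> < (e / 2) powr p" "?B \<phi> < (e / 2) powr p"
        using R by blast
      then have "?A \<phi> powr (1 / p) < e / 2" "?B \<phi> powr (1 / p) < e / 2"
        using root_less[OF nn(1) e(1)] root_less[OF nn(2) e(1)] e(2) by auto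
      then show ?thesis using norm R \<phi>(1) by (intro bexI[of _ \<phi>]) auto
    qed
    then show "u \<in> X0" using X R by (simp add: X0_space_def)
  qed
qed

lemma X0_measurable: "u \<in> X0 \<Longrightarrow> u \<in> borel_measurable lebesgue"
  and X0_Lspace: "u \<in> X0 \<Longrightarrow> u \<in> Lspace L p"
  and X0_diff2: "u \<in> X0 \<Longrightarrow> diff2 u \<in> Lspace G p"
  by (auto simp: X0_iff)

lemma Lspace_comb:
  "f \<in> Lspace M p \<Longrightarrow> g \<in> Lspace M p \<Longrightarrow> (\<lambda>x. a * f x + b * g x) \<in> Lspace M p"
  by (intro Lspace_add Lspace_scale) auto

lemma integral_comb_le:
  assumes "f \<in> Lspace M p" "g \<in> Lspace M p"
  shows "(\<integral>x. \<bar>a * f x + b * g x\<bar> powr p \<partial>M)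
     \<le> 2 powr p * (\<bar>a\<bar> powr p * (\<integral>x. \<bar>f x\<bar> powr p \<partial>M) + \<bar>b\<bar> powr p * (\<integral>x. \<bar>g x\<bar> powr p \<partial>M))"
  using integral_add_powr_le[OF Lspace_scale[OF assms(1), of a] Lspace_scale[OF assms(2), of b]]
  by (simp add: integral_powr_scale)

lemma test_functions_X0: "\<phi> \<in> test_functions \<Omega> \<Longrightarrow> \<phi> \<in> X0"
  unfolding X0_iff using test_functions_Lspace[of \<phi>]
  by (auto intro!: bexI[of _ \<phi>] simp: energy_def diff2_def)

lemma X0_comb:
  assumes "u \<in> X0" "v \<in> X0"
  shows "(\<lambda>x. a * u x + b * v x) \<in> X0"
  unfolding X0_iff
proof (intro conjI allI impI)
  note u = assms(1)[unfolded X0_iff] and v = assms(2)[unfolded X0_iff]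
  show "(\<lambda>x. a * u x + b * v x) \<in> borel_measurable lebesgue" using u v by auto
  show "(\<lambda>x. a * u x + b * v x) \<in> Lspace L p" using u v Lspace_comb by blast
  show "diff2 (\<lambda>x. a * u x + b * v x) \<in> Lspace G p"
    unfolding diff2_comb using u v Lspace_comb by blast
  fix e :: real assume e: "0 < e"
  define c where "c = 2 powr p * (\<bar>a\<bar> powr p + \<bar>b\<bar> powr p) + 1"
  have c: "c > 0" unfolding c_def by (simp add: add_nonneg_pos)
  have bound: "2 powr p * (\<bar>a\<bar> powr p * x + \<bar>b\<bar> powr p * y) < e"
    if "x < e / c" "y < e / c" "0 \<le> x" "0 \<le> y" for x y
  proof -
    have "2 powr p * (\<bar>a\<bar> powr p * x + \<bar>b\<bar> powr p * y)
       \<le> 2 powr p * (\<bar>a\<bar> powr p * (e / c) + \<bar>b\<bar> powr p * (e / c))"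
      using that by (intro mult_left_mono add_mono) auto
    also have "\<dots> = (2 powr p * (\<bar>a\<bar> powr p + \<bar>b\<bar> powr p)) * (e / c)"
      by (simp only: distrib_left distrib_right mult.assoc)
    also have "\<dots> < c * (e / c)"
      using e c by (intro mult_strict_right_mono) (auto simp: c_def)
    finally show ?thesis using c by simp
  qed
  have "e / c > 0" using e c by simp
  then obtain \<phi> \<psi> where \<phi>: "\<phi> \<in> test_functions \<Omega>" "(\<integral>x. \<bar>u x - \<phi> x\<bar> powr p \<partial>L) < e / c"
      "E (\<lambda>x. u x - \<phi> x) < e / c"
    and \<psi>: "\<psi> \<in> test_functions \<Omega>" "(\<integral>x. \<bar>v x - \<psi> x\<bar> powr p \<partial>L) < e / c"
      "E (\<lambda>x. v x - \<psi> x) < e / c"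
    using u v by meson
  note \<phi>' = test_functions_Lspace(2,3)[OF \<phi>(1)] and \<psi>' = test_functions_Lspace(2,3)[OF \<psi>(1)]
  have eq: "(\<lambda>x. a * u x + b * v x - (a * \<phi> x + b * \<psi> x))
      = (\<lambda>x. a * (u x - \<phi> x) + b * (v x - \<psi> x))"
    by (simp add: fun_eq_iff algebra_simps)
  have Lu: "(\<lambda>x. u x - \<phi> x) \<in> Lspace L p" "(\<lambda>x. v x - \<psi> x) \<in> Lspace L p"
      "diff2 (\<lambda>x. u x - \<phi> x) \<in> Lspace G p" "diff2 (\<lambda>x. v x - \<psi> x) \<in> Lspace G p"
    unfolding diff2_minus using u v \<phi>' \<psi>' by (auto intro!: Lspace_diff)
  have "(\<integral>x. \<bar>a * u x + b * v x - (a * \<phi> x + b * \<psi> x)\<bar> powr p \<partial>L) < e"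
    unfolding fun_cong[OF eq]
    by (rule le_less_trans[OF integral_comb_le[OF Lu(1,2)] bound]) (use \<phi> \<psi> in auto)
  moreover have "E (\<lambda>x. a * u x + b * v x - (a * \<phi> x + b * \<psi> x)) < e"
    unfolding eq energy_def diff2_comb
    by (rule le_less_trans[OF integral_comb_le[OF Lu(3,4)] bound])
      (use \<phi> \<psi> in \<open>auto simp: energy_def\<close>)
  ultimately show "\<exists>\<phi>\<in>test_functions \<Omega>. (\<integral>x. \<bar>a * u x + b * v x - \<phi> x\<bar> powr p \<partial>L) < e \<and>
      E (\<lambda>x. a * u x + b * v x - \<phi> x) < e"
    using test_functions_comb[OF \<phi>(1) \<psi>(1), of a b] by (intro bexI conjI)
qed

text \<open>Along approximating test functions \<open>\<phi>\<^sub>k\<close>, almost everywhere on \<open>\<Omega> \<times> (\<real>\<^sup>n - \<Omega>)\<close> both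
  \<open>\<phi>\<^sub>k x \<longlonglongrightarrow> u x\<close> and \<open>\<phi>\<^sub>k x = \<phi>\<^sub>k x - \<phi>\<^sub>k y \<longlonglongrightarrow> u x - u y\<close>, so \<open>u y = 0\<close>; the domain having
  positive measure, this holds for almost every \<open>y\<close> outside.\<close>

lemma X0_vanishes_outside:
  assumes "u \<in> X0"
  shows "AE x in lebesgue. x \<notin> \<Omega> \<longrightarrow> u x = 0"
proof -
  note u = assms[unfolded X0_iff]
  have "\<exists>\<phi>. \<forall>k::nat. \<phi> k \<in> test_functions \<Omega> \<and> (\<integral>x. \<bar>u x - \<phi> k x\<bar> powr p \<partial>L) < (1/2) ^ k \<and>
      E (\<lambda>x. u x - \<phi> k x) < (1/2) ^ k"
    using u by (intro choice allI) (meson zero_less_power half_gt_zero zero_less_one)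
  then obtain \<phi> where \<phi>: "\<And>k. \<phi> k \<in> test_functions \<Omega>"
    "\<And>k. (\<integral>x. \<bar>u x - \<phi> k x\<bar> powr p \<partial>L) < (1/2) ^ k" "\<And>k. E (\<lambda>x. u x - \<phi> k x) < (1/2) ^ k"
    by blast
  have geo: "summable (\<lambda>k. (1/2 :: real) ^ k)" by (rule summable_geometric) simp
  have sm: "summable (\<lambda>k. \<integral>x. \<bar>\<phi> k x - u x\<bar> powr p \<partial>L)"
    by (rule summable_comparison_test'[OF geo]) (use \<phi>(2) in \<open>auto simp: abs_minus_commute less_imp_le\<close>)
  have sm2: "summable (\<lambda>k. \<integral>z. \<bar>diff2 (\<phi> k) z - diff2 u z\<bar> powr p \<partial>G)"
    by (rule summable_comparison_test'[OF geo])
      (use \<phi>(3) in \<open>auto simp: abs_minus_commute less_imp_le energy_def diff2_minus\<close>)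
  have "AE x in L. (\<lambda>k. \<phi> k x) \<longlonglongrightarrow> u x"
    using Lspace_fast_limit[OF _ test_functions_Lspace(2)[OF \<phi>(1)] _ sm] u by auto
  then have "AE x in lebesgue. x \<in> \<Omega> \<longrightarrow> (\<lambda>k. \<phi> k x) \<longlonglongrightarrow> u x"
    by (simp add: AE_restrict_space_iff)
  then have 1: "AE z in lebesgue. fst z \<in> \<Omega> \<longrightarrow> (\<lambda>k. \<phi> k (fst z)) \<longlonglongrightarrow> u (fst z)"
    by (rule AE_lebesgue_fst)
  have "AE z in G. (\<lambda>k. diff2 (\<phi> k) z) \<longlonglongrightarrow> diff2 u z"
    using Lspace_fast_limit[OF _ test_functions_Lspace(3)[OF \<phi>(1)] _ sm2] u by auto
  then have 2: "AE z in lebesgue. 0 < gag_weight s p \<Omega> z \<longrightarrow> (\<lambda>k. diff2 (\<phi> k) z) \<longlonglongrightarrow> diff2 u z"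
    unfolding gag_measure_def using gag_weight_measurable_lebesgue[OF open_domain]
    by (subst (asm) AE_density) auto
  have "AE z in lebesgue. fst z \<in> \<Omega> \<and> snd z \<notin> \<Omega> \<longrightarrow> u (snd z) = 0"
    using 1 2
  proof eventually_elim
    case (elim z)
    show ?case
    proof
      assume z: "fst z \<in> \<Omega> \<and> snd z \<notin> \<Omega>"
      then have "0 < gag_weight s p \<Omega> z"
        by (cases z) (auto simp: gag_weight_def Q_set_def frac_kernel_def)
      then have "(\<lambda>k. diff2 (\<phi> k) z) \<longlonglongrightarrow> diff2 u z" using elim by blast
      moreover have "diff2 (\<phi> k) z = \<phi> k (fst z)" for k
        using test_functions_zero_outside[OF \<phi>(1)] z by (simp add: diff2_def)
      ultimately have "(\<lambda>k. \<phi> k (fst z)) \<longlonglongrightarrow> diff2 u z" by simp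
      then have "diff2 u z = u (fst z)" using elim z LIMSEQ_unique by blast
      then show "u (snd z) = 0" by (simp add: diff2_def)
    qed
  qed
  then have "AE z in lborel. fst z \<in> \<Omega> \<and> snd z \<notin> \<Omega> \<longrightarrow> u (snd z) = 0"
    by (simp add: AE_completion_iff)
  then have "AE z in (lborel \<Otimes>\<^sub>M lborel). fst z \<in> \<Omega> \<and> snd z \<notin> \<Omega> \<longrightarrow> u (snd z) = 0"
    unfolding lborel_prod .
  then have ae: "AE x in lborel. AE y in lborel. x \<in> \<Omega> \<and> y \<notin> \<Omega> \<longrightarrow> u y = 0"
    by (fastforce dest: lborel_pair.AE_pair)
  have "\<exists>x\<in>\<Omega>. AE y in lborel. x \<in> \<Omega> \<and> y \<notin> \<Omega> \<longrightarrow> u y = 0"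
  proof (rule ccontr)
    assume "\<not> ?thesis"
    then have "AE x in lborel. x \<in> - \<Omega>" using ae by (auto elim: eventually_mono)
    then have "AE x in lebesgue. x \<in> - \<Omega>" by (simp add: AE_completion_iff)
    then have "x \<in> - \<Omega>" for x
      using open_domain by (intro mem_closed_if_AE_lebesgue) auto
    then show False using domain_nonempty by blast
  qed
  then show ?thesis by (auto simp: AE_completion_iff)
qed

end

section \<open>Weak closedness of the energy space\<close>

context fractional_domain
begin

lemma AE_domain:
  assumes "AE x in lebesgue. P x"
  shows "AE x in L. P x"
  using assms by (subst AE_restrict_space_iff) (auto elim: eventually_mono)

lemma diff2_AE_tendsto:
  assumes w: "\<And>k. w k \<in> X0" and lim: "AE x in L. (\<lambda>k. w k x) \<longlonglongrightarrow> u x" and out: "\<And>x. x \<notin> \<Omega> \<Longrightarrow> u x = 0"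
  shows "AE z in G. (\<lambda>k. diff2 (w k) z) \<longlonglongrightarrow> diff2 u z"
proof -
  have "AE x in lebesgue. x \<in> \<Omega> \<longrightarrow> (\<lambda>k. w k x) \<longlonglongrightarrow> u x"
    using lim by (simp add: AE_restrict_space_iff)
  moreover have "AE x in lebesgue. \<forall>k. x \<notin> \<Omega> \<longrightarrow> w k x = 0"
    unfolding AE_all_countable using X0_vanishes_outside[OF w] by blast
  ultimately have "AE x in lebesgue. (\<lambda>k. w k x) \<longlonglongrightarrow> u x"
    by eventually_elim (use out in auto)
  from AE_lebesgue_fst[OF this] AE_lebesgue_snd[OF this]
  have "AE z in lebesgue. (\<lambda>k. diff2 (w k) z) \<longlonglongrightarrow> diff2 u z"
    by eventually_elim (auto simp: diff2_def intro!: tendsto_diff)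
  then show ?thesis by (rule AE_gag_measure[OF open_domain])
qed

text \<open>The limit in \<open>L\<^sup>p\<close> of an energy-bounded sequence stays in the space. Among the functions
  of the space that are \<open>L\<^sup>p\<close>-close to the limit take ones of almost least energy. Midpoints
  of two of them are again close to the limit, so their energy cannot drop, and uniform convexity
  makes such a minimizing sequence converge in energy.\<close>

lemma X0_closed:
  assumes w: "\<And>k. w k \<in> X0" and M: "\<And>k. E (w k) \<le> M"
    and um: "u \<in> borel_measurable lebesgue" and uL: "u \<in> Lspace L p"
    and lim: "(\<lambda>k. \<integral>x. \<bar>w k x - u x\<bar> powr p \<partial>L) \<longlonglongrightarrow> 0"
    and out: "\<And>x. x \<notin> \<Omega> \<Longrightarrow> u x = 0"
  shows "u \<in> X0"
proof -
  define \<delta> where "\<delta> n = (1/2 :: real) ^ n" for n :: nat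
  have d0 [simp]: "0 < \<delta> n" and d1: "\<delta> n \<le> 1" for n
    by (auto simp: \<delta>_def power_le_one)
  have pd: "\<delta> m \<le> \<delta> n" if "n \<le> m" for m n
    unfolding \<delta>_def using that by (rule power_decreasing) auto
  have d_lim: "\<delta> \<longlonglongrightarrow> 0"
    unfolding \<delta>_def by (intro LIMSEQ_realpow_zero) auto
  have geo: "summable \<delta>"
    unfolding \<delta>_def by (rule summable_geometric) simp
  define dd where "dd v = (\<integral>x. \<bar>v x - u x\<bar> powr p \<partial>L)" for v
  define Y where "Y n = {v \<in> X0. dd v \<le> \<delta> n}" for n :: nat
  define a where "a n = Inf (E ` Y n)" for n
  have bdd: "bdd_below (E ` Y n)" for n
    by (rule bdd_belowI[of _ 0]) (auto simp: energy_nonneg)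
  have ex: "\<exists>v. v \<in> Y n \<and> E v \<le> M" for n
  proof -
    have "\<forall>\<^sub>F k in sequentially. dd (w k) < \<delta> n"
      using lim unfolding dd_def by (rule order_tendstoD(2)) simp
    then obtain k where "dd (w k) < \<delta> n" using eventually_happens trivial_limit_sequentially by blast
    then show ?thesis using w M by (intro exI[of _ "w k"]) (auto simp: Y_def)
  qed
  have aM: "a n \<le> M" for n
    using ex[of n] cInf_lower[OF imageI bdd, of _ n] unfolding a_def by (meson order_trans)
  have a_le: "a n \<le> E v" if "v \<in> Y n" for n v
    unfolding a_def using that by (intro cInf_lower bdd) auto
  have Ydec: "Y m \<subseteq> Y n" if "n \<le> m" for m n
    unfolding Y_def using pd[OF that] order_trans by blast
  have "incseq a"
    unfolding incseq_def a_def using ex by (intro allI impI cInf_superset_mono bdd image_mono Ydec) blast+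
  then have "convergent a"
    using aM by (metis incseq_convergent convergentI)
  have "\<exists>v. v \<in> Y n \<and> E v < a n + \<delta> n" for n
  proof -
    have "Inf (E ` Y n) < a n + \<delta> n" unfolding a_def by simp
    moreover have "E ` Y n \<noteq> {}" using ex[of n] by auto
    ultimately obtain y where "y \<in> E ` Y n" "y < a n + \<delta> n"
      using cInf_lessD[of "E ` Y n"] by metis
    then show ?thesis by auto
  qed
  then have "\<exists>v. \<forall>n. v n \<in> Y n \<and> E (v n) < a n + \<delta> n"
    by (intro choice allI)
  then obtain v where v: "\<And>n. v n \<in> Y n" "\<And>n. E (v n) < a n + \<delta> n" by blast
  have vX: "v n \<in> X0" and vd: "dd (v n) \<le> \<delta> n" for n using v(1)[of n] by (auto simp: Y_def)
  have mid: "(\<lambda>x. (v n x + v m x) / 2) \<in> Y n" if "n \<le> m" for n m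
  proof -
    have "(\<lambda>x. (1/2) * v n x + (1/2) * v m x) \<in> X0" by (intro X0_comb vX)
    then have X: "(\<lambda>x. (v n x + v m x) / 2) \<in> X0" by (simp add: add_divide_distrib)
    have i: "integrable L (\<lambda>x. \<bar>f x - u x\<bar> powr p)" if "f \<in> X0" for f
      using Lspace_diff[OF X0_Lspace[OF that] uL] by (simp add: Lspace_def)
    have "dd (\<lambda>x. (v n x + v m x) / 2) \<le> (\<integral>x. (\<bar>v n x - u x\<bar> powr p + \<bar>v m x - u x\<bar> powr p) / 2 \<partial>L)"
      unfolding dd_def
    proof (rule integral_mono)
      fix x
      have eq: "(v n x + v m x) / 2 - u x = ((v n x - u x) + (v m x - u x)) / 2" by (simp add: field_simps)
      show "\<bar>(v n x + v m x) / 2 - u x\<bar> powr p \<le> (\<bar>v n x - u x\<bar> powr p + \<bar>v m x - u x\<bar> powr p) / 2"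
        unfolding eq by (rule powr_midpoint_le[OF p_gt_1])
    qed (use i X vX in auto)
    also have "\<dots> = (dd (v n) + dd (v m)) / 2" unfolding dd_def using i vX by simp
    also have "\<dots> \<le> \<delta> n"
      proof -
      have "a / 2 + b / 2 \<le> c" if "a \<le> c" "b \<le> d" "d \<le> c" for a b c d :: real
        using that by linarith
      from this[OF vd vd pd[OF that]] show ?thesis by (simp only: add_divide_distrib)
    qed
    finally show ?thesis using X by (simp add: Y_def)
  qed
  have D: "diff2 (v n) \<in> Lspace G p" for n using X0_diff2 vX .
  have cauchy: "\<exists>N. \<forall>i\<ge>N. \<forall>j\<ge>N. (\<integral>z. \<bar>diff2 (v i) z - diff2 (v j) z\<bar> powr p \<partial>G) < e" if e: "0 < e" for e
  proof -
    define e' where "e' = e / (4 * (\<bar>M\<bar> + 1))"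
    have e': "0 < e'" using e by (simp add: e'_def)
    obtain C where C: "0 \<le> C" "\<And>a b :: real. \<bar>a - b\<bar> powr p \<le> e' * (\<bar>a\<bar> powr p + \<bar>b\<bar> powr p)
        + C * ((\<bar>a\<bar> powr p + \<bar>b\<bar> powr p) / 2 - \<bar>(a + b) / 2\<bar> powr p)"
      using powr_uniformly_convex[OF p_gt_1 e'] by blast
    obtain l where l: "a \<longlonglongrightarrow> l" using \<open>convergent a\<close> by (auto simp: convergent_def)
    have "(\<lambda>n. C * ((l - a n) + \<delta> n)) \<longlonglongrightarrow> C * ((l - l) + 0)"
        by (intro tendsto_intros l d_lim)
    then have "\<forall>\<^sub>F n in sequentially. C * ((l - a n) + \<delta> n) < e / 2"
      using e by (intro order_tendstoD(2)) auto
    then obtain N where N: "\<And>n. N \<le> n \<Longrightarrow> C * ((l - a n) + \<delta> n) < e / 2"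
      by (auto simp: eventually_sequentially)
    have al: "a n \<le> l" for n using \<open>incseq a\<close> l by (rule incseq_le)
    have E1: "E (v n) \<le> \<bar>M\<bar> + 1" for n
      using v(2)[of n] aM[of n] d1[of n] by linarith
    have main: "(\<integral>z. \<bar>diff2 (v i) z - diff2 (v j) z\<bar> powr p \<partial>G) < e" if ij: "N \<le> i" "i \<le> j" for i j
    proof -
      have I: "integrable G (\<lambda>z. \<bar>diff2 (v k) z\<bar> powr p)" for k using D by (simp add: Lspace_def)
      have Dm: "(\<lambda>z. (diff2 (v i) z + diff2 (v j) z) / 2) \<in> Lspace G p"
        using Lspace_comb[OF D[of i] D[of j], of "1/2" "1/2"] by (simp add: add_divide_distrib)
      have Em: "(\<integral>z. \<bar>(diff2 (v i) z + diff2 (v j) z) / 2\<bar> powr p \<partial>G) = E (\<lambda>x. (v i x + v j x) / 2)"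
      proof -
        have "diff2 (\<lambda>x. (v i x + v j x) / 2) = (\<lambda>z. (diff2 (v i) z + diff2 (v j) z) / 2)"
          by (simp add: diff2_def fun_eq_iff add_divide_distrib diff_divide_distrib)
        then show ?thesis unfolding energy_def by simp
      qed
      have arith: "(x + y) / 2 - z \<le> (b - c) + d"
        if "x < c + d" "y < c' + d'" "c \<le> z" "c' \<le> b" "c \<le> b" "d' \<le> d" for x y z b c d c' d' :: real
        using that by (simp add: field_simps)
      have half: "e / (4 * m) * (2 * m) = e / 2" if "m > 0" for m :: real
        using that by (simp add: field_simps)
      have "(\<integral>z. \<bar>diff2 (v i) z - diff2 (v j) z\<bar> powr p \<partial>G)
        \<le> (\<integral>z. e' * (\<bar>diff2 (v i) z\<bar> powr p + \<bar>diff2 (v j) z\<bar> powr p)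
           + C * ((\<bar>diff2 (v i) z\<bar> powr p + \<bar>diff2 (v j) z\<bar> powr p) / 2
           - \<bar>(diff2 (v i) z + diff2 (v j) z) / 2\<bar> powr p) \<partial>G)"
        using Lspace_integrable[OF Lspace_diff[OF D D]] I Lspace_integrable[OF Dm] C(2)
        by (intro integral_mono) auto
      also have "\<dots> = e' * (E (v i) + E (v j)) + C * ((E (v i) + E (v j)) / 2 - E (\<lambda>x. (v i x + v j x) / 2))"
        unfolding Em[symmetric] unfolding energy_def using I Lspace_integrable[OF Dm] by simp
      also have "\<dots> \<le> e' * (2 * (\<bar>M\<bar> + 1)) + C * ((l - a i) + \<delta> i)"
      proof (intro add_mono mult_left_mono)
        show "E (v i) + E (v j) \<le> 2 * (\<bar>M\<bar> + 1)" using add_mono[OF E1[of i] E1[of j]] by simp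
        show "(E (v i) + E (v j)) / 2 - E (\<lambda>x. (v i x + v j x) / 2) \<le> (l - a i) + \<delta> i"
          by (rule arith[OF v(2) v(2) a_le[OF mid[OF ij(2)]] al al pd[OF ij(2)]])
      qed (use e' C in auto)
      also have "\<dots> < e / 2 + e / 2"
        using N[OF ij(1)] half[of "\<bar>M\<bar> + 1"] by (intro add_le_less_mono) (auto simp: e'_def)
      finally show ?thesis by simp
    qed
    show ?thesis
    proof (intro exI[of _ N] allI impI)
      fix i j assume "N \<le> i" "N \<le> j"
      then show "(\<integral>z. \<bar>diff2 (v i) z - diff2 (v j) z\<bar> powr p \<partial>G) < e"
        using main[of i j] main[of j i] by (cases "i \<le> j") (auto simp: abs_minus_commute)
    qed
  qed
  obtain F where F: "F \<in> Lspace G p" "(\<lambda>k. \<integral>z. \<bar>diff2 (v k) z - F z\<bar> powr p \<partial>G) \<longlonglongrightarrow> 0"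
    using Lspace_complete[OF _ D cauchy] by auto
  have dn: "0 \<le> dd f" for f unfolding dd_def by (intro integral_nonneg_AE AE_I2) simp
  obtain \<sigma> where \<sigma>: "strict_mono \<sigma>"
    "\<And>k. \<bar>\<integral>z. \<bar>diff2 (v (\<sigma> k)) z - F z\<bar> powr p \<partial>G\<bar> < \<delta> k"
    using subseq_below[OF F(2), of "\<lambda>k. \<delta> k"] by auto
  have sm: "summable (\<lambda>k. \<integral>z. \<bar>diff2 (v (\<sigma> k)) z - F z\<bar> powr p \<partial>G)"
    by (rule summable_comparison_test'[OF geo]) (use \<sigma>(2) in \<open>auto simp: less_imp_le\<close>)
  have sm2: "summable (\<lambda>k. \<integral>x. \<bar>v (\<sigma> k) x - u x\<bar> powr p \<partial>L)"
  proof (rule summable_comparison_test'[OF geo])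
    fix k
    have "dd (v (\<sigma> k)) \<le> \<delta> k"
      using vd[of "\<sigma> k"] pd[OF seq_suble[OF \<sigma>(1)], of k] by (rule order_trans)
    then show "norm (\<integral>x. \<bar>v (\<sigma> k) x - u x\<bar> powr p \<partial>L) \<le> \<delta> k"
      using dn[of "v (\<sigma> k)"] by (simp add: dd_def)
  qed
  have 1: "AE z in G. (\<lambda>k. diff2 (v (\<sigma> k)) z) \<longlonglongrightarrow> F z"
    using Lspace_fast_limit[OF _ D F(1) sm] by auto
  have "AE x in L. (\<lambda>k. v (\<sigma> k) x) \<longlonglongrightarrow> u x"
    using Lspace_fast_limit[OF _ X0_Lspace[OF vX] uL sm2] by auto
  then have "AE z in G. (\<lambda>k. diff2 (v (\<sigma> k)) z) \<longlonglongrightarrow> diff2 u z"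
    by (rule diff2_AE_tendsto[OF vX]) (rule out)
  with 1 have FD: "AE z in G. F z = diff2 u z"
    by eventually_elim (rule LIMSEQ_unique)
  have Dum: "diff2 u \<in> borel_measurable G"
    unfolding measurable_gag_measure using diff2_measurable[OF um] .
  have Du: "diff2 u \<in> Lspace G p"
    by (rule LspaceI_dominated[OF Dum Lspace_integrable[OF F(1)]]) (use FD in auto)
  have En: "(\<lambda>k. E (\<lambda>x. v k x - u x)) \<longlonglongrightarrow> 0"
  proof -
    have "E (\<lambda>x. v k x - u x) = (\<integral>z. \<bar>diff2 (v k) z - F z\<bar> powr p \<partial>G)" for k
      unfolding energy_def diff2_minus
      using Dum Lspace_measurable[OF D[of k]] Lspace_measurable[OF F(1)] FD
      by (intro integral_cong_AE) auto
    then show ?thesis using F(2) by simp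
  qed
  show ?thesis
    unfolding X0_iff
  proof (intro conjI um uL Du allI impI)
    fix e :: real assume e: "0 < e"
    define e' where "e' = e / (2 powr p * 2)"
    have e': "0 < e'" using e by (simp add: e'_def)
    have "\<forall>\<^sub>F k in sequentially. \<delta> k < e'" using d_lim e' by (rule order_tendstoD(2))
    moreover have "\<forall>\<^sub>F k in sequentially. E (\<lambda>x. v k x - u x) < e'" using En e' by (rule order_tendstoD(2))
    ultimately have "\<forall>\<^sub>F k in sequentially. \<delta> k < e' \<and> E (\<lambda>x. v k x - u x) < e'"
      by eventually_elim simp
    then obtain k where k: "\<delta> k < e'" "E (\<lambda>x. v k x - u x) < e'"
      using eventually_happens trivial_limit_sequentially by blast
    obtain \<phi> where \<phi>: "\<phi> \<in> test_functions \<Omega>" "(\<integral>x. \<bar>v k x - \<phi> x\<bar> powr p \<partial>L) < e'" "E (\<lambda>x. v k x - \<phi> x) < e'"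
      using vX[of k] e' unfolding X0_iff by blast
    note t = test_functions_Lspace[OF \<phi>(1)]
    have e2: "2 powr p * (x + y) < e" if "x < e'" "y < e'" for x y
    proof -
      have "2 powr p * (x + y) < 2 powr p * (e' + e')" using that by (intro mult_strict_left_mono) auto
      then show ?thesis by (simp add: e'_def)
    qed
    have "(\<integral>x. \<bar>u x - \<phi> x\<bar> powr p \<partial>L) < e"
    proof -
      have "(\<integral>x. \<bar>(v k x - \<phi> x) - (v k x - u x)\<bar> powr p \<partial>L) \<le> 2 powr p * ((\<integral>x. \<bar>v k x - \<phi> x\<bar> powr p \<partial>L) + dd (v k))"
        unfolding dd_def using X0_Lspace[OF vX] t uL by (intro integral_diff_powr_le Lspace_diff) auto
      also have "\<dots> < e" using \<phi> k vd[of k] by (intro e2) auto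
      finally show ?thesis by simp
    qed
    moreover have "E (\<lambda>x. u x - \<phi> x) < e"
    proof -
      have "(\<integral>z. \<bar>diff2 (\<lambda>x. v k x - \<phi> x) z - diff2 (\<lambda>x. v k x - u x) z\<bar> powr p \<partial>G)
        \<le> 2 powr p * (E (\<lambda>x. v k x - \<phi> x) + E (\<lambda>x. v k x - u x))"
        unfolding energy_def using D Du t
        by (intro integral_diff_powr_le) (auto simp: diff2_minus intro!: Lspace_diff)
      also have "\<dots> < e" using \<phi> k by (intro e2) auto
      finally show ?thesis by (simp add: energy_def diff2_minus)
    qed
    ultimately show "\<exists>\<phi>\<in>test_functions \<Omega>. (\<integral>x. \<bar>u x - \<phi> x\<bar> powr p \<partial>L) < e \<and> E (\<lambda>x. u x - \<phi> x) < e"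
      using \<phi>(1) by blast
  qed
qed

end

section \<open>Dyadic averages\<close>

text \<open>The half-open dyadic cube of side \<open>1 / 2\<^sup>k\<close> that contains \<open>x\<close>. Describing it by integer parts makes
  lying in a common cell an equivalence relation.\<close>

definition cell :: "nat \<Rightarrow> real^'n \<Rightarrow> (real^'n) set" where
  "cell k x = {y. \<forall>i. \<lfloor>2 ^ k * y $ i\<rfloor> = \<lfloor>2 ^ k * x $ i\<rfloor>}"

definition cell_volume :: "nat \<Rightarrow> nat \<Rightarrow> real" where
  "cell_volume n k = (1 / 2 ^ k) ^ n"

definition dyadic_avg :: "nat \<Rightarrow> (real^'n \<Rightarrow> real) \<Rightarrow> real^'n \<Rightarrow> real" where
  "dyadic_avg k u x = (\<integral>y. indicator (cell k x) y * u y \<partial>lborel) / cell_volume CARD('n) k"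

lemma cell_volume_pos [simp]: "0 < cell_volume n k"
  by (simp add: cell_volume_def)

lemma cell_eq: "y \<in> cell k x \<Longrightarrow> cell k y = cell k x"
  by (auto simp: cell_def)

lemma cell_Suc: "cell (Suc k) x \<subseteq> cell k x"
proof
  fix y assume "y \<in> cell (Suc k) x"
  have "\<lfloor>2 ^ k * t\<rfloor> = \<lfloor>2 ^ Suc k * t\<rfloor> div 2" for t :: real
    using floor_divide_real_eq_div[of 2 "2 ^ Suc k * t"] by simp
  then show "y \<in> cell k x" using \<open>y \<in> cell (Suc k) x\<close> unfolding cell_def by simp
qed

lemma cell_pred_measurable:
  "{z :: (real^'n) \<times> (real^'n). snd z \<in> cell k (fst z)} \<in> sets (borel \<Otimes>\<^sub>M borel)"
proof -
  have "{z :: (real^'n) \<times> (real^'n). snd z \<in> cell k (fst z)}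
     = (\<Inter>i\<in>UNIV. {z \<in> space (borel \<Otimes>\<^sub>M borel).
          real_of_int \<lfloor>2 ^ k * snd z $ i\<rfloor> = real_of_int \<lfloor>2 ^ k * fst z $ i\<rfloor>})"
    by (auto simp: cell_def space_pair_measure)
  also have "\<dots> \<in> sets (borel \<Otimes>\<^sub>M borel)"
  proof -
    have [measurable]: "(\<lambda>z :: (real^'n) \<times> (real^'n). snd z $ i) \<in> borel_measurable (borel \<Otimes>\<^sub>M borel)"
      "(\<lambda>z :: (real^'n) \<times> (real^'n). fst z $ i) \<in> borel_measurable (borel \<Otimes>\<^sub>M borel)" for i
      by (rule measurable_compose[OF measurable_snd] measurable_compose[OF measurable_fst], simp)+
    have "(\<lambda>z :: (real^'n) \<times> (real^'n). real_of_int \<lfloor>2 ^ k * snd z $ i\<rfloor>) \<in> borel_measurable (borel \<Otimes>\<^sub>M borel)"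
      "(\<lambda>z :: (real^'n) \<times> (real^'n). real_of_int \<lfloor>2 ^ k * fst z $ i\<rfloor>) \<in> borel_measurable (borel \<Otimes>\<^sub>M borel)" for i
      by measurable
    then show ?thesis by (intro sets.finite_INT borel_measurable_eq) auto
  qed
  finally show ?thesis .
qed

lemma cell_indicator_measurable:
  "(\<lambda>z. indicator (cell k (fst z)) (snd z) :: real) \<in> borel_measurable (borel \<Otimes>\<^sub>M (borel :: (real^'n) measure))"
proof -
  have eq: "(\<lambda>z. indicator (cell k (fst z)) (snd z) :: real)
     = indicator {z :: (real^'n) \<times> (real^'n). snd z \<in> cell k (fst z)}"
    by (auto simp: fun_eq_iff indicator_def)
  show ?thesis unfolding eq by (rule borel_measurable_indicator[OF cell_pred_measurable])
qed

lemma cell_measurable [measurable]: "cell k (x :: real^'n) \<in> sets borel"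
proof -
  have "cell k x = (\<Inter>i\<in>UNIV. {y \<in> space borel.
          real_of_int \<lfloor>2 ^ k * y $ i\<rfloor> = real_of_int \<lfloor>2 ^ k * x $ i\<rfloor>})"
    by (auto simp: cell_def)
  also have "\<dots> \<in> sets borel" by (intro sets.finite_INT) measurable
  finally show ?thesis .
qed

lemma emeasure_cell: "emeasure lborel (cell k (x :: real^'n)) = ennreal (cell_volume CARD('n) k)"
proof -
  define a :: "real^'n" where "a = (\<chi> i. real_of_int \<lfloor>2 ^ k * x $ i\<rfloor> / 2 ^ k)"
  define b :: "real^'n" where "b = (\<chi> i. (real_of_int \<lfloor>2 ^ k * x $ i\<rfloor> + 1) / 2 ^ k)"
  have mem: "\<lfloor>2 ^ k * y $ i\<rfloor> = \<lfloor>2 ^ k * x $ i\<rfloor> \<longleftrightarrow> a $ i \<le> y $ i \<and> y $ i < b $ i" for y :: "real^'n" and i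
    unfolding a_def b_def floor_eq_iff by (simp add: divide_le_eq less_divide_eq mult.commute)
  have 1: "box a b \<subseteq> cell k x" "cell k x \<subseteq> cbox a b"
    unfolding cell_def mem by (auto simp: mem_box_cart less_imp_le)
  have ba: "(b - a) \<bullet> i = 1 / 2 ^ k" if "i \<in> Basis" for i
    using that by (auto simp: a_def b_def Basis_vec_def inner_axis diff_divide_distrib[symmetric])
  have le: "a \<bullet> i \<le> b \<bullet> i" if "i \<in> Basis" for i
  proof -
    have "0 \<le> (b - a) \<bullet> i" unfolding ba[OF that] by simp
    then show ?thesis by (simp add: inner_diff_left)
  qed
  have 2: "emeasure lborel (box a b) = ennreal (cell_volume CARD('n) k)"
    "emeasure lborel (cbox a b) = ennreal (cell_volume CARD('n) k)"
    using le ba by (simp_all add: emeasure_lborel_box emeasure_lborel_cbox cell_volume_def)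
  show ?thesis
    using emeasure_mono[OF 1(1), of lborel] emeasure_mono[OF 1(2), of lborel] 2 by auto
qed

lemma norm_diff_cell:
  assumes "y \<in> cell k (x :: real^'n)"
  shows "norm (x - y) \<le> real CARD('n) / 2 ^ k"
proof -
  have "\<bar>(x - y) $ i\<bar> \<le> 1 / 2 ^ k" for i
  proof -
    have "\<lfloor>2 ^ k * y $ i\<rfloor> = \<lfloor>2 ^ k * x $ i\<rfloor>" using assms by (simp add: cell_def)
    then have "\<bar>2 ^ k * x $ i - 2 ^ k * y $ i\<bar> \<le> 1" by linarith
    then have "\<bar>2 ^ k * (x $ i - y $ i)\<bar> \<le> 1" by (simp only: right_diff_distrib)
    then show ?thesis by (simp add: abs_mult pos_le_divide_eq mult.commute)
  qed
  then have "(\<Sum>i\<in>UNIV. \<bar>(x - y) $ i\<bar>) \<le> (\<Sum>i\<in>(UNIV::'n set). 1 / 2 ^ k)" by (intro sum_mono)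
  then show ?thesis using norm_le_l1_cart[of "x - y"] by simp
qed

lemma dyadic_avg_cong_cell: "y \<in> cell k x \<Longrightarrow> dyadic_avg k u y = dyadic_avg k u x"
  by (simp add: dyadic_avg_def cell_eq)

lemma dyadic_avg_measurable [measurable]:
  assumes [measurable]: "u \<in> borel_measurable borel"
  shows "dyadic_avg k u \<in> borel_measurable (borel :: (real^'n) measure)"
proof -
  have [measurable]: "(\<lambda>z. indicator (cell k (fst z)) (snd z) :: real) \<in> borel_measurable (borel \<Otimes>\<^sub>M (borel :: (real^'n) measure))"
    by (rule cell_indicator_measurable)
  have "(\<lambda>(x, y). indicator (cell k x) y * u y) \<in> borel_measurable (borel \<Otimes>\<^sub>M lborel)"
    using cell_indicator_measurable[of k] by (simp add: case_prod_beta')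
  then have "(\<lambda>x. \<integral>y. indicator (cell k x) y * u y \<partial>lborel) \<in> borel_measurable borel"
    by (rule lborel.borel_measurable_lebesgue_integral)
  then show ?thesis unfolding dyadic_avg_def by measurable
qed

lemma integral_indicator_cell: "(\<integral>y. indicator (cell k (x::real^'n)) y \<partial>lborel) = cell_volume CARD('n) k"
  and integrable_indicator_cell: "integrable lborel (indicator (cell k (x::real^'n)) :: _ \<Rightarrow> real)"
  using emeasure_cell[of k x] by (auto simp: measure_def)

text \<open>Jensen's inequality for the average over the cell, obtained from Hoelder's inequality with the
  indicator of the cell as second factor.\<close>

lemma dyadic_avg_Jensen:
  assumes u: "integrable lborel (u :: real^'n \<Rightarrow> real)" and p: "1 < p"
  shows "ennreal (\<bar>u x - dyadic_avg k u x\<bar> powr p)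
    \<le> ennreal (1 / cell_volume CARD('n) k) * (\<integral>\<^sup>+y. ennreal (indicator (cell k x) y * \<bar>u x - u y\<bar> powr p) \<partial>lborel)"
proof (cases "(\<integral>\<^sup>+y. ennreal (indicator (cell k x) y * \<bar>u x - u y\<bar> powr p) \<partial>lborel) = \<infinity>")
  case True
  moreover have "ennreal (1 / cell_volume CARD('n) k) \<noteq> 0" by (simp add: ennreal_eq_0_iff not_le)
  ultimately show ?thesis by (simp only: ennreal_mult_top infinity_ennreal_def) simp
next
  case False
  have [measurable]: "u \<in> borel_measurable borel" using u by auto
  define V where "V = cell_volume CARD('n) k"
  have V: "V > 0" by (simp add: V_def)
  define f where "f y = indicator (cell k x) y * (u x - u y)" for y
  define g where "g y = (indicator (cell k x) y :: real)" for y
  have fp: "\<bar>f y\<bar> powr p = indicator (cell k x) y * \<bar>u x - u y\<bar> powr p" for y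
    by (simp add: f_def indicator_def)
  have fm [measurable]: "f \<in> borel_measurable borel" unfolding f_def by measurable
  have "integrable lborel (\<lambda>y. \<bar>f y\<bar> powr p)"
    unfolding fp by (rule integrableI_nonneg) (use False in \<open>auto simp: less_top[symmetric]\<close>)
  then have f: "f \<in> Lspace lborel p" by (simp add: Lspace_def)
  define q where "q = p / (p - 1)"
  have q: "1 < q" "1 / p + 1 / q = 1" using p by (auto simp: q_def field_simps)
  have gq: "\<bar>g y\<bar> powr q = indicator (cell k x) y" for y
    by (simp add: g_def indicator_def)
  have g: "g \<in> Lspace lborel q"
  proof -
    have "g \<in> borel_measurable borel" unfolding g_def by measurable
    moreover have "integrable lborel (\<lambda>y. \<bar>g y\<bar> powr q)"
      unfolding gq by (rule integrable_indicator_cell)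
    ultimately show ?thesis by (simp add: Lspace_def)
  qed
  have fg: "f y * g y = f y" for y by (simp add: f_def g_def indicator_def)
  have intf: "integrable lborel f" using Holder_integral(1)[OF f g p q] by (simp add: fg)
  let ?I = "\<integral>y. \<bar>f y\<bar> powr p \<partial>lborel"
  have H1: "(\<integral>y. \<bar>f y\<bar> \<partial>lborel) \<le> ?I powr (1 / p) * V powr (1 / q)"
    using Holder_integral(2)[OF f g p q] unfolding fg gq integral_indicator_cell V_def .
  have H2: "u x - dyadic_avg k u x = (\<integral>y. f y \<partial>lborel) / V"
  proof -
    have iu: "integrable lborel (\<lambda>y. indicator (cell k x) y * u y)"
      using integrable_real_mult_indicator[OF _ u, of "cell k x"] by (simp add: mult.commute)
    have "(\<integral>y. f y \<partial>lborel) = (\<integral>y. u x * indicator (cell k x) y - indicator (cell k x) y * u y \<partial>lborel)"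
      by (intro Bochner_Integration.integral_cong refl) (simp add: f_def algebra_simps)
    also have "\<dots> = u x * V - (\<integral>y. indicator (cell k x) y * u y \<partial>lborel)"
    proof -
      have "(\<integral>y. u x * indicator (cell k x) y \<partial>lborel) = u x * V"
        unfolding V_def integral_indicator_cell[symmetric, of k x] by simp
      moreover have "integrable lborel (\<lambda>y. u x * indicator (cell k x) y)"
        using integrable_indicator_cell[of k x] by simp
      ultimately show ?thesis using iu by (simp only: Bochner_Integration.integral_diff)
    qed
    finally show ?thesis using V by (simp add: dyadic_avg_def V_def[symmetric] diff_divide_distrib)
  qed
  have H3: "\<bar>\<integral>y. f y \<partial>lborel\<bar> \<le> (\<integral>y. \<bar>f y\<bar> \<partial>lborel)"
    using integral_norm_bound[of lborel f] by simp
  have "\<bar>u x - dyadic_avg k u x\<bar> = \<bar>\<integral>y. f y \<partial>lborel\<bar> / V"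
    unfolding H2 using V by (simp add: abs_divide)
  also have "\<dots> \<le> ?I powr (1 / p) * V powr (1 / q) / V"
    using V by (intro divide_right_mono order_trans[OF H3 H1]) auto
  finally have "\<bar>u x - dyadic_avg k u x\<bar> \<le> ?I powr (1 / p) * V powr (1 / q) / V" .
  then have "\<bar>u x - dyadic_avg k u x\<bar> powr p \<le> (?I powr (1 / p) * V powr (1 / q) / V) powr p"
    using p by (intro powr_mono2) auto
  also have "\<dots> = ?I * (V powr (p / q) / V powr p)"
    using V p by (simp add: powr_mult powr_divide powr_powr)
  also have "p / q = p - 1" using p by (simp add: q_def)
  also have "V powr (p - 1) / V powr p = 1 / V"
    using V by (simp add: powr_diff)
  finally have "\<bar>u x - dyadic_avg k u x\<bar> powr p \<le> 1 / V * ?I" by simp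
  then have "ennreal (\<bar>u x - dyadic_avg k u x\<bar> powr p) \<le> ennreal (1 / V) * ennreal ?I"
    using V by (simp add: ennreal_mult[symmetric] ennreal_leI)
  also have "ennreal ?I = (\<integral>\<^sup>+y. ennreal (\<bar>f y\<bar> powr p) \<partial>lborel)"
    using Lspace_integrable[OF f] by (intro nn_integral_eq_integral[symmetric]) auto
  finally show ?thesis by (simp add: fp V_def)
qed

definition full_energy :: "real \<Rightarrow> real \<Rightarrow> (real^'n \<Rightarrow> real) \<Rightarrow> ennreal" where
  "full_energy s p u = (\<integral>\<^sup>+z. ennreal (\<bar>diff2 u z\<bar> powr p / frac_kernel s p (fst z) (snd z)) \<partial>lborel)"

text \<open>Averaging over cells of side \<open>1 / 2\<^sup>k\<close> costs \<open>2 powr (- k s)\<close> in \<open>L\<^sup>p\<close>, because two points of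
  one cell have distance at most \<open>n / 2\<^sup>k\<close>.\<close>

lemma dyadic_avg_error:
  assumes u: "integrable lborel (u :: real^'n \<Rightarrow> real)" and p: "1 < p" and s: "0 < s"
  shows "(\<integral>\<^sup>+x. ennreal (\<bar>u x - dyadic_avg k u x\<bar> powr p) \<partial>lborel)
    \<le> ennreal (real CARD('n) powr (real CARD('n) + p * s) * (2 powr (- (p * s))) ^ k) * full_energy s p u"
proof -
  have [measurable]: "u \<in> borel_measurable borel" using u by auto
  define d where "d = real CARD('n) + p * s"
  have d: "d > 0" unfolding d_def using p s by (simp add: add_pos_pos)
  define V where "V = cell_volume CARD('n) k"
  have V: "V > 0" by (simp add: V_def)
  define c where "c = (real CARD('n) / 2 ^ k) powr d"
  have c0: "0 \<le> c" by (simp add: c_def)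
  define ind where "ind z = (indicator (cell k (fst z)) (snd z) :: real)" for z :: "(real^'n) \<times> (real^'n)"
  have [measurable]: "ind \<in> borel_measurable (borel \<Otimes>\<^sub>M borel)"
    unfolding ind_def by (rule cell_indicator_measurable)
  have [measurable]: "diff2 u \<in> borel_measurable (borel \<Otimes>\<^sub>M borel)" unfolding diff2_def by measurable
  have m: "(\<lambda>z. ennreal (ind z * \<bar>diff2 u z\<bar> powr p)) \<in> borel_measurable (borel \<Otimes>\<^sub>M borel)" by measurable
  have m2: "(\<lambda>z. ennreal (\<bar>diff2 u z\<bar> powr p / frac_kernel s p (fst z) (snd z))) \<in> borel_measurable (borel \<Otimes>\<^sub>M borel)"
    using frac_kernel_measurable[of s p] by measurable
  have point: "ind z * \<bar>diff2 u z\<bar> powr p \<le> c * (\<bar>diff2 u z\<bar> powr p / frac_kernel s p (fst z) (snd z))" for z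
  proof (cases "snd z \<in> cell k (fst z) \<and> fst z \<noteq> snd z")
    case True
    have "frac_kernel s p (fst z) (snd z) \<le> c"
      unfolding frac_kernel_def c_def d_def[symmetric] using norm_diff_cell True d by (intro powr_mono2) auto
    moreover have "0 < frac_kernel s p (fst z) (snd z)" using True by (simp add: frac_kernel_def)
    ultimately have "\<bar>diff2 u z\<bar> powr p \<le> c * (\<bar>diff2 u z\<bar> powr p / frac_kernel s p (fst z) (snd z))"
      using mult_left_mono[of "frac_kernel s p (fst z) (snd z)" c "\<bar>diff2 u z\<bar> powr p"]
      by (simp add: pos_le_divide_eq mult.commute)
    then show ?thesis using True by (simp add: ind_def)
  next
    case False
    then have 0: "ind z * \<bar>diff2 u z\<bar> powr p = 0"
      by (cases "fst z = snd z") (auto simp: ind_def diff2_def)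
    have "0 \<le> c * (\<bar>diff2 u z\<bar> powr p / frac_kernel s p (fst z) (snd z))"
      using c0 by (simp add: frac_kernel_def)
    with 0 show ?thesis by (rule ord_eq_le_trans)
  qed
  have "(\<integral>\<^sup>+x. ennreal (\<bar>u x - dyadic_avg k u x\<bar> powr p) \<partial>lborel)
     \<le> (\<integral>\<^sup>+x. ennreal (1 / V) * (\<integral>\<^sup>+y. ennreal (ind (x, y) * \<bar>diff2 u (x, y)\<bar> powr p) \<partial>lborel) \<partial>lborel)"
    using dyadic_avg_Jensen[OF u p] by (intro nn_integral_mono) (simp add: ind_def diff2_def V_def)
  also have "\<dots> = ennreal (1 / V) * (\<integral>\<^sup>+x. (\<integral>\<^sup>+y. ennreal (ind (x, y) * \<bar>diff2 u (x, y)\<bar> powr p) \<partial>lborel) \<partial>lborel)"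
    using m by (intro nn_integral_cmult) measurable
  also have "(\<integral>\<^sup>+x. (\<integral>\<^sup>+y. ennreal (ind (x, y) * \<bar>diff2 u (x, y)\<bar> powr p) \<partial>lborel) \<partial>lborel)
     = (\<integral>\<^sup>+z. ennreal (ind z * \<bar>diff2 u z\<bar> powr p) \<partial>(lborel \<Otimes>\<^sub>M lborel))"
    using m by (subst lborel.nn_integral_fst[symmetric]) auto
  also have "\<dots> \<le> (\<integral>\<^sup>+z. ennreal c * ennreal (\<bar>diff2 u z\<bar> powr p / frac_kernel s p (fst z) (snd z)) \<partial>(lborel \<Otimes>\<^sub>M lborel))"
    using point c0 by (intro nn_integral_mono) (simp add: ennreal_mult'[symmetric] ennreal_leI)
  also have "\<dots> = ennreal c * full_energy s p u"
    unfolding full_energy_def lborel_prod[symmetric] using m2 by (intro nn_integral_cmult) auto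
  finally have "(\<integral>\<^sup>+x. ennreal (\<bar>u x - dyadic_avg k u x\<bar> powr p) \<partial>lborel)
     \<le> ennreal (1 / V) * (ennreal c * full_energy s p u)"
    by (simp add: mult_left_mono)
  also have "\<dots> = ennreal (c / V) * full_energy s p u"
    using V c0 by (simp add: mult.assoc[symmetric] ennreal_mult'[symmetric])
  also have "c / V = real CARD('n) powr d * (2 powr (- (p * s))) ^ k"
  proof -
    have e: "(2::real) ^ k = 2 powr real k" by (simp add: powr_realpow)
    have "V = (2 powr real k) powr (- real CARD('n))"
      by (simp add: V_def cell_volume_def powr_minus powr_realpow power_one_over e[symmetric] divide_inverse power_inverse)
    moreover have "c = real CARD('n) powr d / (2 powr real k) powr d"
      unfolding c_def e by (rule powr_divide)
    ultimately have "c / V = real CARD('n) powr d *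
        (1 / ((2 powr real k) powr d * (2 powr real k) powr (- real CARD('n))))"
      by simp
    moreover have "(2 powr (- (p * s))) ^ k = 2 powr (real k * (- (p * s)))"
      by (simp add: powr_realpow[symmetric] powr_powr mult.commute)
    moreover have "1 / ((2 powr real k) powr d * (2 powr real k) powr (- real CARD('n))) = 2 powr (real k * (- (p * s)))"
      unfolding powr_powr powr_add[symmetric] powr_minus_divide[symmetric]
      by (rule arg_cong[where f = "\<lambda>x. 2 powr x"]) (simp add: d_def algebra_simps)
    ultimately show ?thesis by (simp only:)
  qed
  finally show ?thesis by (simp add: d_def)
qed

lemma powr_add_le_weighted:
  fixes x y r \<tau> :: real
  assumes r: "1 \<le> r" and \<tau>: "0 < \<tau>" "\<tau> < 1" and xy: "0 \<le> x" "0 \<le> y"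
  shows "(x + y) powr r \<le> (1 - \<tau>) powr (1 - r) * x powr r + \<tau> powr (1 - r) * y powr r"
proof -
  have ge1: "z \<le> c powr (1 - r) * z" if "0 < c" "c < 1" "0 \<le> z" for c z :: real
  proof -
    have "1 powr (r - 1) \<le> (1 / c) powr (r - 1)" using that r by (intro powr_mono2) auto
    then have "1 \<le> c powr (1 - r)" using that by (simp add: powr_divide powr_diff)
    then show ?thesis using that(3) mult_right_mono by fastforce
  qed
  have scale: "c * (z / c) powr r = c powr (1 - r) * z powr r" if "0 < c" for c z :: real
    using that by (simp add: powr_divide powr_diff)
  consider "x = 0" | "y = 0" | "0 < x" "0 < y" using xy by linarith
  then show ?thesis
  proof cases
    case 1
    then show ?thesis using ge1[OF \<tau>, of "y powr r"] by simp
  next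
    case 2
    then show ?thesis using ge1[of "1 - \<tau>" "x powr r"] \<tau> by simp
  next
    case 3
    have "(x + y) powr r = ((1 - \<tau>) *\<^sub>R (x / (1 - \<tau>)) + \<tau> *\<^sub>R (y / \<tau>)) powr r"
      using \<tau> by simp
    also have "\<dots> \<le> (1 - \<tau>) * (x / (1 - \<tau>)) powr r + \<tau> * (y / \<tau>) powr r"
      using \<tau> 3 by (intro convex_onD[OF powr_convex[OF r]]) auto
    finally show ?thesis using scale[of "1 - \<tau>" x] scale[of \<tau> y] \<tau> by simp
  qed
qed

text \<open>Jensen's inequality with geometric weights \<open>(1 - \<tau>) \<tau>\<^sup>j\<close>, with a constant that does not depend on the
  number of terms.\<close>

lemma sum_powr_le_weighted:
  fixes a :: "nat \<Rightarrow> real"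
  assumes r: "1 \<le> r" and \<tau>: "0 < \<tau>" "\<tau> < 1" and a: "\<And>j. 0 \<le> a j"
  shows "(\<Sum>j<N. a j) powr r \<le> (\<Sum>j<N. (1 - \<tau>) powr (1 - r) * (\<tau> powr (1 - r)) ^ j * a j powr r)"
  using a
proof (induction N arbitrary: a)
  case (Suc N)
  have "(\<Sum>j<Suc N. a j) powr r = (a 0 + (\<Sum>j<N. a (Suc j))) powr r"
    by (simp only: sum.lessThan_Suc_shift)
  also have "\<dots> \<le> (1 - \<tau>) powr (1 - r) * a 0 powr r + \<tau> powr (1 - r) * (\<Sum>j<N. a (Suc j)) powr r"
    using Suc.prems by (intro powr_add_le_weighted r \<tau> sum_nonneg) auto
  also have "\<dots> \<le> (1 - \<tau>) powr (1 - r) * a 0 powr r + \<tau> powr (1 - r) *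
      (\<Sum>j<N. (1 - \<tau>) powr (1 - r) * (\<tau> powr (1 - r)) ^ j * a (Suc j) powr r)"
    using Suc.prems by (intro add_left_mono mult_left_mono Suc.IH) auto
  also have "\<dots> = (\<Sum>j<Suc N. (1 - \<tau>) powr (1 - r) * (\<tau> powr (1 - r)) ^ j * a j powr r)"
    by (simp add: sum.lessThan_Suc_shift sum_distrib_left mult_ac del: sum.lessThan_Suc)
  finally show ?case .
qed simp

lemma cell_constant_bound:
  fixes w :: "real^'n \<Rightarrow> real"
  assumes w: "\<And>x y. y \<in> cell k x \<Longrightarrow> w y = w x"
    and le: "(\<integral>\<^sup>+x. ennreal (\<bar>w x\<bar> powr p) \<partial>lborel) \<le> ennreal t" and t: "0 \<le> t"
  shows "\<bar>w x\<bar> powr p \<le> t / cell_volume CARD('n) k"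
proof -
  have "ennreal (\<bar>w x\<bar> powr p * cell_volume CARD('n) k) = ennreal (\<bar>w x\<bar> powr p) * emeasure lborel (cell k x)"
    by (simp add: emeasure_cell ennreal_mult'[symmetric])
  also have "\<dots> = (\<integral>\<^sup>+y. ennreal (\<bar>w x\<bar> powr p) * indicator (cell k x) y \<partial>lborel)"
    by (rule nn_integral_cmult_indicator[symmetric]) simp
  also have "\<dots> \<le> (\<integral>\<^sup>+y. ennreal (\<bar>w y\<bar> powr p) \<partial>lborel)"
    using w[of _ x] by (intro nn_integral_mono) (auto simp: indicator_def)
  also have "\<dots> \<le> ennreal t" by (rule le)
  finally have "\<bar>w x\<bar> powr p * cell_volume CARD('n) k \<le> t" using t by (simp add: ennreal_le_iff)
  then show ?thesis by (simp add: pos_le_divide_eq)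
qed

text \<open>The rate at which dyadic approximation in \<open>L\<^sup>r\<close> improves. For \<open>p s < n\<close> it is positive exactly when \<open>r\<close> is
  below the critical exponent \<open>n p / (n - p s)\<close>.\<close>

definition sobolev_gap :: "nat \<Rightarrow> real \<Rightarrow> real \<Rightarrow> real \<Rightarrow> real" where
  "sobolev_gap n s p r = s - real n * (1 / p - 1 / r)"

text \<open>Passing from one dyadic level to the next changes the averages by a function that is
  constant on small cells. For such functions \<open>L\<^sup>p\<close> controls the supremum, hence \<open>L\<^sup>r\<close>, with a
  loss that the decay in \<open>L\<^sup>p\<close> outweighs exactly for subcritical \<open>r\<close>.\<close>

lemma dyadic_increment:
  assumes u: "integrable lborel (u :: real^'n \<Rightarrow> real)" and p: "1 < p" "p < r" and s: "0 < s"
    and A: "0 \<le> A" "full_energy s p u \<le> ennreal A"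
  defines "C1 \<equiv> 2 powr p * 2 * real CARD('n) powr (real CARD('n) + p * s)"
  shows "(\<integral>\<^sup>+x. ennreal (\<bar>dyadic_avg (Suc k) u x - dyadic_avg k u x\<bar> powr r) \<partial>lborel)
    \<le> ennreal (C1 powr (r / p) * 2 powr (real CARD('n) * (r - p) / p) * A powr (r / p)
        * (2 powr (- (sobolev_gap CARD('n) s p r * r))) ^ k)"
proof -
  have [measurable]: "u \<in> borel_measurable borel" using u by auto
  define w where "w x = dyadic_avg (Suc k) u x - dyadic_avg k u x" for x
  have [measurable]: "w \<in> borel_measurable borel" unfolding w_def by measurable
  define N where "N = real CARD('n) powr (real CARD('n) + p * s)"
  define b where "b = (2::real) powr (- (p * s))"
  have b: "0 < b" "b \<le> 1" using p s by (auto simp: b_def intro!: less_imp_le[OF powr_less_one])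
  have N0: "0 \<le> N" by (simp add: N_def)
  define t where "t = C1 * b ^ k * A"
  have t0: "0 \<le> t" using A b by (simp add: t_def C1_def)
  have err: "(\<integral>\<^sup>+x. ennreal (\<bar>u x - dyadic_avg j u x\<bar> powr p) \<partial>lborel) \<le> ennreal (N * b ^ k * A)" if "k \<le> j" for j
  proof -
    have "(\<integral>\<^sup>+x. ennreal (\<bar>u x - dyadic_avg j u x\<bar> powr p) \<partial>lborel) \<le> ennreal (N * b ^ j) * full_energy s p u"
      unfolding N_def b_def by (rule dyadic_avg_error[OF u p(1) s])
    also have "\<dots> \<le> ennreal (N * b ^ k) * ennreal A"
      using A b N0 power_decreasing[OF that, of b] by (intro mult_mono ennreal_leI mult_left_mono) auto
    finally show ?thesis using N0 b A by (simp add: ennreal_mult'[symmetric])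
  qed
  have "(\<integral>\<^sup>+x. ennreal (\<bar>w x\<bar> powr p) \<partial>lborel)
     \<le> (\<integral>\<^sup>+x. ennreal (2 powr p) * (ennreal (\<bar>u x - dyadic_avg k u x\<bar> powr p) + ennreal (\<bar>u x - dyadic_avg (Suc k) u x\<bar> powr p)) \<partial>lborel)"
  proof (rule nn_integral_mono)
    fix x
    have "\<bar>w x\<bar> powr p \<le> 2 powr p * (\<bar>u x - dyadic_avg k u x\<bar> powr p + \<bar>u x - dyadic_avg (Suc k) u x\<bar> powr p)"
      using abs_diff_powr_le[of p "u x - dyadic_avg k u x" "u x - dyadic_avg (Suc k) u x"] p by (simp add: w_def)
    then show "ennreal (\<bar>w x\<bar> powr p) \<le> ennreal (2 powr p) * (ennreal (\<bar>u x - dyadic_avg k u x\<bar> powr p) + ennreal (\<bar>u x - dyadic_avg (Suc k) u x\<bar> powr p))"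
      by (simp add: ennreal_mult'[symmetric] ennreal_plus[symmetric] ennreal_leI del: ennreal_plus)
  qed
  also have "\<dots> = ennreal (2 powr p) * ((\<integral>\<^sup>+x. ennreal (\<bar>u x - dyadic_avg k u x\<bar> powr p) \<partial>lborel)
      + (\<integral>\<^sup>+x. ennreal (\<bar>u x - dyadic_avg (Suc k) u x\<bar> powr p) \<partial>lborel))"
    by (simp add: nn_integral_cmult nn_integral_add)
  also have "\<dots> \<le> ennreal (2 powr p) * (ennreal (N * b ^ k * A) + ennreal (N * b ^ k * A))"
    by (intro mult_left_mono add_mono err) auto
  also have "\<dots> = ennreal (2 powr p * (N * b ^ k * A + N * b ^ k * A))"
    using N0 b A by (simp add: ennreal_mult'[symmetric] ennreal_plus[symmetric] del: ennreal_plus)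
  also have "2 powr p * (N * b ^ k * A + N * b ^ k * A) = t"
    by (simp add: t_def C1_def N_def)
  finally have wp: "(\<integral>\<^sup>+x. ennreal (\<bar>w x\<bar> powr p) \<partial>lborel) \<le> ennreal t" .
  define V where "V = cell_volume CARD('n) (Suc k)"
  have V: "0 < V" by (simp add: V_def)
  have const: "w y = w x" if "y \<in> cell (Suc k) x" for x y
    unfolding w_def using that cell_Suc dyadic_avg_cong_cell by (metis subsetD)
  have sup: "\<bar>w x\<bar> powr p \<le> t / V" for x
    unfolding V_def using cell_constant_bound[OF const wp t0] .
  define e where "e = (r - p) / p"
  have e: "0 < e" "p + p * e = r" "1 + e = r / p" using p by (auto simp: e_def field_simps)
  have "(\<integral>\<^sup>+x. ennreal (\<bar>w x\<bar> powr r) \<partial>lborel) \<le> (\<integral>\<^sup>+x. ennreal ((t / V) powr e) * ennreal (\<bar>w x\<bar> powr p) \<partial>lborel)"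
  proof (rule nn_integral_mono)
    fix x
    have "\<bar>w x\<bar> powr r = (\<bar>w x\<bar> powr p) powr e * \<bar>w x\<bar> powr p"
      unfolding powr_powr powr_add[symmetric] using e(2) by (simp add: add.commute)
    also have "\<dots> \<le> (t / V) powr e * \<bar>w x\<bar> powr p"
      using sup e by (intro mult_right_mono powr_mono2) auto
    finally show "ennreal (\<bar>w x\<bar> powr r) \<le> ennreal ((t / V) powr e) * ennreal (\<bar>w x\<bar> powr p)"
      by (simp add: ennreal_mult'[symmetric] ennreal_leI)
  qed
  also have "\<dots> = ennreal ((t / V) powr e) * (\<integral>\<^sup>+x. ennreal (\<bar>w x\<bar> powr p) \<partial>lborel)"
    by (rule nn_integral_cmult) measurable
  also have "\<dots> \<le> ennreal ((t / V) powr e) * ennreal t"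
    by (intro mult_left_mono wp) auto
  also have "\<dots> = ennreal ((t / V) powr e * t)"
    using t0 by (simp add: ennreal_mult'[symmetric])
  also have "(t / V) powr e * t = t powr (r / p) * V powr (- e)"
  proof (cases "t = 0")
    case False
    then have "t powr (r / p) = t powr e * t"
      using t0 powr_add[of t 1 e] e(3) by simp
    then show ?thesis using t0 V by (simp add: powr_divide powr_minus_divide)
  qed simp
  also have "t powr (r / p) = C1 powr (r / p) * (b ^ k) powr (r / p) * A powr (r / p)"
    by (simp add: t_def powr_mult)
  also have "(b ^ k) powr (r / p) = 2 powr (- (real k * s * r))"
    using p by (simp add: b_def powr_realpow[symmetric] powr_powr mult_ac)
  also have "V powr (- e) = 2 powr (real (Suc k) * real CARD('n) * e)"
  proof -
    have "V = 2 powr (- (real (Suc k) * real CARD('n)))"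
      unfolding V_def cell_volume_def
      by (simp add: powr_minus powr_realpow[symmetric] power_one_over powr_powr[symmetric] divide_inverse power_inverse del: of_nat_Suc power_Suc)
    then show ?thesis by (simp only: powr_powr minus_mult_minus)
  qed
  also have "C1 powr (r / p) * 2 powr (- (real k * s * r)) * A powr (r / p) * 2 powr (real (Suc k) * real CARD('n) * e)
    = C1 powr (r / p) * 2 powr (real CARD('n) * (r - p) / p) * A powr (r / p)
        * (2 powr (- (sobolev_gap CARD('n) s p r * r))) ^ k"
  proof -
    have "2 powr (- (real k * s * r)) * 2 powr (real (Suc k) * real CARD('n) * e)
       = 2 powr (real CARD('n) * (r - p) / p) * (2 powr (real k * (- (sobolev_gap CARD('n) s p r * r))) :: real)"
      unfolding powr_add[symmetric]
    proof (rule arg_cong[where f = "\<lambda>x. 2 powr x"])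
      have "(1 / p - 1 / r) * r = e" using p by (simp add: e_def field_simps)
      then have gr: "sobolev_gap CARD('n) s p r * r = s * r - real CARD('n) * e"
        by (simp only: sobolev_gap_def left_diff_distrib mult.assoc)
      have ne: "real CARD('n) * (r - p) / p = real CARD('n) * e" by (simp add: e_def)
      show "- (real k * s * r) + real (Suc k) * real CARD('n) * e
          = real CARD('n) * (r - p) / p + real k * (- (sobolev_gap CARD('n) s p r * r))"
        unfolding gr ne by (simp add: algebra_simps)
    qed
    moreover have "(2::real) powr (real k * (- (sobolev_gap CARD('n) s p r * r))) = (2 powr (- (sobolev_gap CARD('n) s p r * r))) ^ k"
      by (simp add: powr_realpow[symmetric] powr_powr mult.commute)
    ultimately show ?thesis by (simp only: mult_ac)
  qed
  finally show ?thesis by (simp only: w_def)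
qed

text \<open>The \<open>L\<^sup>p\<close> errors are summable over the levels, hence so are the \<open>p\<close>-th powers of the pointwise errors
  almost everywhere.\<close>

lemma dyadic_avg_AE_tendsto:
  assumes u: "integrable lborel (u :: real^'n \<Rightarrow> real)" and p: "1 < p" and s: "0 < s"
    and A: "0 \<le> A" "full_energy s p u \<le> ennreal A"
  shows "AE x in lborel. (\<lambda>k. dyadic_avg k u x) \<longlonglongrightarrow> u x"
proof -
  have [measurable]: "u \<in> borel_measurable borel" using u by auto
  define N where "N = real CARD('n) powr (real CARD('n) + p * s)"
  define b where "b = (2::real) powr (- (p * s))"
  have b: "0 < b" "b < 1" using p s by (auto simp: b_def intro!: powr_less_one)
  have N0: "0 \<le> N" by (simp add: N_def)
  have err: "(\<integral>\<^sup>+x. ennreal (\<bar>u x - dyadic_avg k u x\<bar> powr p) \<partial>lborel) \<le> ennreal (N * A * b ^ k)" for k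
  proof -
    have "(\<integral>\<^sup>+x. ennreal (\<bar>u x - dyadic_avg k u x\<bar> powr p) \<partial>lborel) \<le> ennreal (N * b ^ k) * full_energy s p u"
      unfolding N_def b_def by (rule dyadic_avg_error[OF u p s])
    also have "\<dots> \<le> ennreal (N * b ^ k) * ennreal A"
      using A by (intro mult_left_mono) auto
    finally show ?thesis using N0 b A by (simp add: ennreal_mult'[symmetric] mult_ac)
  qed
  have "(\<integral>\<^sup>+x. (\<Sum>k. ennreal (\<bar>u x - dyadic_avg k u x\<bar> powr p)) \<partial>lborel)
      = (\<Sum>k. \<integral>\<^sup>+x. ennreal (\<bar>u x - dyadic_avg k u x\<bar> powr p) \<partial>lborel)"
    by (rule nn_integral_suminf) measurable
  also have "\<dots> \<le> (\<Sum>k. ennreal (N * A * b ^ k))"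
    by (intro suminf_le err) auto
  also have "\<dots> < \<infinity>"
    using N0 A b by (subst suminf_ennreal2) (auto intro!: summable_mult summable_geometric)
  finally have "AE x in lborel. (\<Sum>k. ennreal (\<bar>u x - dyadic_avg k u x\<bar> powr p)) \<noteq> \<infinity>"
    by (intro nn_integral_PInf_AE) auto
  then show ?thesis
  proof eventually_elim
    case (elim x)
    then have "summable (\<lambda>k. \<bar>u x - dyadic_avg k u x\<bar> powr p)"
      by (intro summable_suminf_not_top) auto
    then have "(\<lambda>k. \<bar>u x - dyadic_avg k u x\<bar> powr p) \<longlonglongrightarrow> 0" by (rule summable_LIMSEQ_zero)
    then have "(\<lambda>k. (\<bar>u x - dyadic_avg k u x\<bar> powr p) powr (1 / p)) \<longlonglongrightarrow> 0 powr (1 / p)"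
      using p by (intro tendsto_powr') auto
    then have "(\<lambda>k. \<bar>u x - dyadic_avg k u x\<bar>) \<longlonglongrightarrow> 0" using p by (simp add: powr_powr)
    then have "(\<lambda>k. u x - dyadic_avg k u x) \<longlonglongrightarrow> 0" by (simp add: tendsto_rabs_zero_iff)
    then have "(\<lambda>k. u x - (u x - dyadic_avg k u x)) \<longlonglongrightarrow> u x - 0" by (intro tendsto_intros)
    then show ?case by simp
  qed
qed

text \<open>The quantitative form of the compact Sobolev embedding: below the critical exponent,
  functions of bounded energy are approximated by their dyadic averages in \<open>L\<^sup>r\<close> at a uniform
  geometric rate. The increments decay geometrically, and convexity with geometric weights adds
  their \<open>r\<close>-th powers.\<close>

theorem dyadic_approximation:
  fixes s p r :: real
  assumes p: "1 < p" "p < r" and s: "0 < s" and gap: "0 < sobolev_gap CARD('n) s p r"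
  shows "\<exists>C\<ge>0. \<forall>(u :: real^'n \<Rightarrow> real) A k. integrable lborel u \<longrightarrow> 0 \<le> A \<longrightarrow>
    full_energy s p u \<le> ennreal A \<longrightarrow>
    (\<integral>\<^sup>+x. ennreal (\<bar>u x - dyadic_avg k u x\<bar> powr r) \<partial>lborel)
      \<le> ennreal (C * A powr (r / p) * (2 powr (- (sobolev_gap CARD('n) s p r * r))) ^ k)"
proof -
  define \<delta> where "\<delta> = sobolev_gap CARD('n) s p r"
  define \<tau> where "\<tau> = (2::real) powr (- \<delta>)"
  have \<tau>: "0 < \<tau>" "\<tau> < 1" using gap by (auto simp: \<tau>_def \<delta>_def intro!: powr_less_one)
  define B where "B = (2 powr p * 2 * real CARD('n) powr (real CARD('n) + p * s)) powr (r / p)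
      * 2 powr (real CARD('n) * (r - p) / p)"
  have B0: "0 \<le> B" by (simp add: B_def)
  define \<rho> where "\<rho> = (2::real) powr (- (\<delta> * r))"
  have \<rho>0: "0 < \<rho>" by (simp add: \<rho>_def)
  have ratio: "\<tau> powr (1 - r) * \<rho> = \<tau>"
    unfolding \<tau>_def \<rho>_def powr_powr powr_add[symmetric]
    by (rule arg_cong[where f = "\<lambda>x. 2 powr x"]) (simp add: algebra_simps)
  define C where "C = (1 - \<tau>) powr (1 - r) * B / (1 - \<tau>)"
  have C0: "0 \<le> C" using \<tau> B0 by (simp add: C_def)
  have main: "(\<integral>\<^sup>+x. ennreal (\<bar>u x - dyadic_avg k u x\<bar> powr r) \<partial>lborel) \<le> ennreal (C * A powr (r / p) * \<rho> ^ k)"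
    if u: "integrable lborel u" and A: "0 \<le> A" "full_energy s p u \<le> ennreal A" for u :: "real^'n \<Rightarrow> real" and A k
  proof -
    have [measurable]: "u \<in> borel_measurable borel" using u by auto
    define w where "w j x = dyadic_avg (Suc j) u x - dyadic_avg j u x" for j x
    have [measurable]: "w j \<in> borel_measurable borel" for j unfolding w_def by measurable
    have inc: "(\<integral>\<^sup>+x. ennreal (\<bar>w j x\<bar> powr r) \<partial>lborel) \<le> ennreal (B * A powr (r / p) * \<rho> ^ j)" for j
      using dyadic_increment[OF u p s A, of j] by (simp add: w_def B_def \<rho>_def \<delta>_def)
    define c where "c j = (1 - \<tau>) powr (1 - r) * (\<tau> powr (1 - r)) ^ j" for j
    have c0: "0 \<le> c j" for j by (simp add: c_def)
    have step: "(\<integral>\<^sup>+x. ennreal (\<bar>dyadic_avg (k + N) u x - dyadic_avg k u x\<bar> powr r) \<partial>lborel)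
        \<le> ennreal (C * A powr (r / p) * \<rho> ^ k)" for N
    proof -
      have pt: "\<bar>dyadic_avg (k + N) u x - dyadic_avg k u x\<bar> powr r \<le> (\<Sum>j<N. c j * \<bar>w (k + j) x\<bar> powr r)" for x
      proof -
        have "dyadic_avg (k + N) u x - dyadic_avg k u x = (\<Sum>j<N. w (k + j) x)"
          using sum_lessThan_telescope[of "\<lambda>j. dyadic_avg (k + j) u x" N] by (simp add: w_def)
        then have "\<bar>dyadic_avg (k + N) u x - dyadic_avg k u x\<bar> \<le> (\<Sum>j<N. \<bar>w (k + j) x\<bar>)"
          by (simp add: sum_abs)
        then have "\<bar>dyadic_avg (k + N) u x - dyadic_avg k u x\<bar> powr r \<le> (\<Sum>j<N. \<bar>w (k + j) x\<bar>) powr r"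
          using p by (intro powr_mono2) auto
        also have "\<dots> \<le> (\<Sum>j<N. c j * \<bar>w (k + j) x\<bar> powr r)"
          unfolding c_def using p \<tau> by (intro sum_powr_le_weighted) auto
        finally show ?thesis .
      qed
      have "(\<integral>\<^sup>+x. ennreal (\<bar>dyadic_avg (k + N) u x - dyadic_avg k u x\<bar> powr r) \<partial>lborel)
          \<le> (\<integral>\<^sup>+x. (\<Sum>j<N. ennreal (c j) * ennreal (\<bar>w (k + j) x\<bar> powr r)) \<partial>lborel)"
      proof (rule nn_integral_mono)
        fix x
        have "ennreal (\<bar>dyadic_avg (k + N) u x - dyadic_avg k u x\<bar> powr r) \<le> ennreal (\<Sum>j<N. c j * \<bar>w (k + j) x\<bar> powr r)"
          by (rule ennreal_leI[OF pt])
        also have "\<dots> = (\<Sum>j<N. ennreal (c j) * ennreal (\<bar>w (k + j) x\<bar> powr r))"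
          using c0 by (simp add: sum_ennreal[symmetric] ennreal_mult')
        finally show "ennreal (\<bar>dyadic_avg (k + N) u x - dyadic_avg k u x\<bar> powr r)
            \<le> (\<Sum>j<N. ennreal (c j) * ennreal (\<bar>w (k + j) x\<bar> powr r))" .
      qed
      also have "\<dots> = (\<Sum>j<N. ennreal (c j) * (\<integral>\<^sup>+x. ennreal (\<bar>w (k + j) x\<bar> powr r) \<partial>lborel))"
        by (simp add: nn_integral_sum nn_integral_cmult)
      also have "\<dots> \<le> (\<Sum>j<N. ennreal (c j) * ennreal (B * A powr (r / p) * \<rho> ^ (k + j)))"
        by (intro sum_mono mult_left_mono inc) auto
      also have "\<dots> = ennreal (\<Sum>j<N. c j * (B * A powr (r / p) * \<rho> ^ (k + j)))"
        using c0 B0 \<rho>0 by (simp add: sum_ennreal[symmetric] ennreal_mult')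
      also have "(\<Sum>j<N. c j * (B * A powr (r / p) * \<rho> ^ (k + j)))
          = (1 - \<tau>) powr (1 - r) * B * A powr (r / p) * \<rho> ^ k * (\<Sum>j<N. \<tau> ^ j)"
      proof -
        have "c j * (B * A powr (r / p) * \<rho> ^ (k + j)) = (1 - \<tau>) powr (1 - r) * B * A powr (r / p) * \<rho> ^ k * \<tau> ^ j" for j
        proof -
          have "\<tau> ^ j = (\<tau> powr (1 - r)) ^ j * \<rho> ^ j" using ratio by (metis power_mult_distrib)
          then show ?thesis by (simp only: c_def power_add mult_ac)
        qed
        then show ?thesis by (simp only: sum_distrib_left)
      qed
      also have "ennreal \<dots> \<le> ennreal (C * A powr (r / p) * \<rho> ^ k)"
      proof (rule ennreal_leI)
        have "(\<Sum>j<N. \<tau> ^ j) \<le> (\<Sum>j. \<tau> ^ j)"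
          using \<tau> by (intro sum_le_suminf summable_geometric) auto
        also have "\<dots> = 1 / (1 - \<tau>)" using \<tau> by (intro suminf_geometric) auto
        finally have "(1 - \<tau>) powr (1 - r) * B * A powr (r / p) * \<rho> ^ k * (\<Sum>j<N. \<tau> ^ j)
          \<le> (1 - \<tau>) powr (1 - r) * B * A powr (r / p) * \<rho> ^ k * (1 / (1 - \<tau>))"
          using B0 \<rho>0 by (intro mult_left_mono) auto
        then show "(1 - \<tau>) powr (1 - r) * B * A powr (r / p) * \<rho> ^ k * (\<Sum>j<N. \<tau> ^ j) \<le> C * A powr (r / p) * \<rho> ^ k"
          by (simp add: C_def mult_ac)
      qed
      finally show ?thesis .
    qed
    have "(\<integral>\<^sup>+x. ennreal (\<bar>u x - dyadic_avg k u x\<bar> powr r) \<partial>lborel)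
       = (\<integral>\<^sup>+x. liminf (\<lambda>N. ennreal (\<bar>dyadic_avg (k + N) u x - dyadic_avg k u x\<bar> powr r)) \<partial>lborel)"
    proof (rule nn_integral_cong_AE)
      show "AE x in lborel. ennreal (\<bar>u x - dyadic_avg k u x\<bar> powr r)
          = liminf (\<lambda>N. ennreal (\<bar>dyadic_avg (k + N) u x - dyadic_avg k u x\<bar> powr r))"
        using dyadic_avg_AE_tendsto[OF u p(1) s A]
      proof eventually_elim
        case (elim x)
        have "(\<lambda>N. dyadic_avg (k + N) u x) \<longlonglongrightarrow> u x"
          using LIMSEQ_ignore_initial_segment[OF elim, of k] by (simp add: add.commute)
        then have "(\<lambda>N. \<bar>dyadic_avg (k + N) u x - dyadic_avg k u x\<bar> powr r) \<longlonglongrightarrow> \<bar>u x - dyadic_avg k u x\<bar> powr r"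
          using p by (intro tendsto_powr' tendsto_intros) auto
        then have "(\<lambda>N. ennreal (\<bar>dyadic_avg (k + N) u x - dyadic_avg k u x\<bar> powr r)) \<longlonglongrightarrow> ennreal (\<bar>u x - dyadic_avg k u x\<bar> powr r)"
          by (rule tendsto_ennrealI)
        then show ?case by (rule lim_imp_Liminf[OF trivial_limit_sequentially, symmetric])
      qed
    qed
    also have "\<dots> \<le> liminf (\<lambda>N. \<integral>\<^sup>+x. ennreal (\<bar>dyadic_avg (k + N) u x - dyadic_avg k u x\<bar> powr r) \<partial>lborel)"
      by (rule nn_integral_liminf) measurable
    also have "\<dots> \<le> liminf (\<lambda>N::nat. ennreal (C * A powr (r / p) * \<rho> ^ k))"
      by (intro Liminf_mono always_eventually allI step)
    also have "\<dots> = ennreal (C * A powr (r / p) * \<rho> ^ k)" by (simp add: Liminf_const)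
    finally show ?thesis .
  qed
  show ?thesis
    using C0 main unfolding \<rho>_def \<delta>_def by blast
qed

section \<open>Compactness\<close>

context fractional_domain
begin

lemma Lspace_mono_exponent:
  assumes "f \<in> Lspace L b" "0 < a" "a \<le> b"
  shows "f \<in> Lspace L a"
proof (rule LspaceI_dominated[where g = "\<lambda>x. 1 + \<bar>f x\<bar> powr b"])
  interpret finite_measure L by (rule finite_measure_domain)
  show "integrable L (\<lambda>x. 1 + \<bar>f x\<bar> powr b)" using Lspace_integrable[OF assms(1)] by simp
  show "AE x in L. \<bar>f x\<bar> powr a \<le> 1 + \<bar>f x\<bar> powr b"
    using abs_powr_le_1_plus assms by blast
qed (use assms Lspace_measurable in auto)

text \<open>Fubini's theorem is applied to Borel functions only. Setting the representative to zero outside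
  \<open>\<Omega>\<close> makes its energy over the whole space equal to the one over \<open>Q\<close>.\<close>

lemma X0_Borel_version:
  assumes v: "v \<in> X0"
  obtains v' where "v' \<in> borel_measurable borel" "AE x in lebesgue. v x = v' x"
    "integrable lborel v'" "(\<integral>x. \<bar>v' x\<bar> \<partial>lborel) \<le> measure lebesgue \<Omega> + (\<integral>x. \<bar>v x\<bar> powr p \<partial>L)"
    "full_energy s p v' \<le> ennreal (E v)"
proof -
  interpret F: finite_measure L by (rule finite_measure_domain)
  obtain v0 where v0: "v0 \<in> borel_measurable borel" "AE x in lebesgue. v x = v0 x"
    using lebesgue_measurable_Borel_version[OF X0_measurable[OF v]] .
  define v' where "v' x = indicator \<Omega> x * v0 x" for x
  have vm [measurable]: "v' \<in> borel_measurable borel"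
    using v0(1) unfolding v'_def by measurable
  have ae: "AE x in lebesgue. v x = v' x"
    using v0(2) X0_vanishes_outside[OF v] by eventually_elim (auto simp: v'_def indicator_def)
  have vl: "v' \<in> borel_measurable lebesgue" by (intro measurable_completion) simp
  have aeL: "AE x in L. v x = v' x" using ae by (rule AE_domain)
  have I: "integrable L (\<lambda>x. 1 + \<bar>v x\<bar> powr p)" using Lspace_integrable[OF X0_Lspace[OF v]] by simp
  have le: "AE x in L. \<bar>v' x\<bar> \<le> 1 + \<bar>v x\<bar> powr p"
    using aeL by eventually_elim (use abs_powr_le_1_plus[of 1 p] in simp)
  have iL: "integrable L v'"
    by (rule Bochner_Integration.integrable_bound[OF I measurable_domain[OF vl]]) (use le in auto)
  have ind: "indicator \<Omega> x *\<^sub>R v' x = v' x" for x by (simp add: v'_def indicator_def)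
  have ind2: "indicator \<Omega> x *\<^sub>R \<bar>v' x\<bar> = \<bar>v' x\<bar>" for x by (simp add: v'_def indicator_def)
  have "set_integrable lebesgue \<Omega> v'" using iL set_integral_eq_lebesgue_on(1)[of \<Omega> v'] by simp
  then have "integrable lebesgue v'" unfolding set_integrable_def ind .
  then have int: "integrable lborel v'" using vm by (simp add: integrable_completion)
  have "(\<integral>x. \<bar>v' x\<bar> \<partial>lborel) = (\<integral>x. \<bar>v' x\<bar> \<partial>lebesgue)"
    by (rule integral_completion[symmetric]) simp
  also have "\<dots> = (\<integral>x. \<bar>v' x\<bar> \<partial>L)"
    using set_integral_eq_lebesgue_on(2)[of \<Omega> "\<lambda>x. \<bar>v' x\<bar>"] unfolding set_lebesgue_integral_def ind2 by simp
  also have "\<dots> \<le> (\<integral>x. 1 + \<bar>v x\<bar> powr p \<partial>L)"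
    using iL I le by (intro integral_mono_AE) auto
  also have "\<dots> = measure lebesgue \<Omega> + (\<integral>x. \<bar>v x\<bar> powr p \<partial>L)"
    using Lspace_integrable[OF X0_Lspace[OF v]] by (simp add: measure_restrict_space)
  finally have i1: "(\<integral>x. \<bar>v' x\<bar> \<partial>lborel) \<le> measure lebesgue \<Omega> + (\<integral>x. \<bar>v x\<bar> powr p \<partial>L)" .
  have Dm: "diff2 v' \<in> borel_measurable lebesgue" by (rule diff2_measurable[OF vl])
  have "full_energy s p v' = (\<integral>\<^sup>+z. ennreal (gag_weight s p \<Omega> z) * ennreal (\<bar>diff2 v' z\<bar> powr p) \<partial>lborel)"
    unfolding full_energy_def
  proof (rule nn_integral_cong)
    fix z :: "(real^'n) \<times> (real^'n)"
    have "\<bar>diff2 v' z\<bar> powr p / frac_kernel s p (fst z) (snd z) = gag_weight s p \<Omega> z * \<bar>diff2 v' z\<bar> powr p"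
      by (cases z) (auto simp: gag_weight_def Q_set_def diff2_def v'_def indicator_def)
    then show "ennreal (\<bar>diff2 v' z\<bar> powr p / frac_kernel s p (fst z) (snd z))
        = ennreal (gag_weight s p \<Omega> z) * ennreal (\<bar>diff2 v' z\<bar> powr p)"
      by (simp add: ennreal_mult'[symmetric] gag_weight_nonneg)
  qed
  also have "\<dots> = (\<integral>\<^sup>+z. ennreal (\<bar>diff2 v' z\<bar> powr p) \<partial>G)"
    unfolding gag_measure_def using Dm gag_weight_measurable_lebesgue[OF open_domain]
    by (subst nn_integral_density) (auto simp: nn_integral_completion)
  also have "\<dots> = (\<integral>\<^sup>+z. ennreal (\<bar>diff2 v z\<bar> powr p) \<partial>G)"
  proof (rule nn_integral_cong_AE)
    have "AE z in lebesgue. diff2 v' z = diff2 v z"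
      using AE_lebesgue_fst[OF ae] AE_lebesgue_snd[OF ae] by eventually_elim (simp add: diff2_def)
    from AE_gag_measure[OF open_domain this]
    show "AE z in G. ennreal (\<bar>diff2 v' z\<bar> powr p) = ennreal (\<bar>diff2 v z\<bar> powr p)" by eventually_elim simp
  qed
  also have "\<dots> = ennreal (E v)"
    unfolding energy_def using Lspace_integrable[OF X0_diff2[OF v]] by (intro nn_integral_eq_integral) auto
  finally show ?thesis using that[OF vm ae int i1] by simp
qed

text \<open>Averages over the countably many dyadic cells converge along a diagonal subsequence; with
  the uniform dyadic approximation the subsequence is Cauchy in \<open>L\<^sup>r\<close>.\<close>

lemma X0_Cauchy_subsequence:
  assumes r: "p < r" "0 < sobolev_gap CARD('n) s p r"
    and w: "\<And>k. w k \<in> X0" "\<And>k. E (w k) \<le> M" "\<And>k. (\<integral>x. \<bar>w k x\<bar> powr p \<partial>L) \<le> M"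
  obtains \<sigma> :: "nat \<Rightarrow> nat" where "strict_mono \<sigma>" "\<forall>k. w k \<in> Lspace L r"
    "\<forall>e>0. \<exists>N. \<forall>i\<ge>N. \<forall>j\<ge>N. (\<integral>x. \<bar>w (\<sigma> i) x - w (\<sigma> j) x\<bar> powr r \<partial>L) < e"
proof -
  interpret F: finite_measure L by (rule finite_measure_domain)
  have r1: "1 < r" using r p_gt_1 by simp
  then have r0: "0 \<le> r" by simp
  have M0: "0 \<le> M" using w(2)[of 0] energy_nonneg[of s p \<Omega> "w 0"] by simp
  have "\<exists>v'. v' \<in> borel_measurable borel \<and> (AE x in lebesgue. w k x = v' x) \<and> integrable lborel v' \<and>
      (\<integral>x. \<bar>v' x\<bar> \<partial>lborel) \<le> measure lebesgue \<Omega> + M \<and> full_energy s p v' \<le> ennreal M" for k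
  proof -
    obtain v' where v': "v' \<in> borel_measurable borel" "AE x in lebesgue. w k x = v' x" "integrable lborel v'"
      "(\<integral>x. \<bar>v' x\<bar> \<partial>lborel) \<le> measure lebesgue \<Omega> + (\<integral>x. \<bar>w k x\<bar> powr p \<partial>L)"
      "full_energy s p v' \<le> ennreal (E (w k))" using X0_Borel_version[OF w(1)] .
    have "full_energy s p v' \<le> ennreal M" using v'(5) ennreal_leI[OF w(2)] order_trans by blast
    moreover have "(\<integral>x. \<bar>v' x\<bar> \<partial>lborel) \<le> measure lebesgue \<Omega> + M" using v'(4) w(3)[of k] by linarith
    ultimately show ?thesis using v' by blast
  qed
  then have "\<exists>v. \<forall>k. v k \<in> borel_measurable borel \<and> (AE x in lebesgue. w k x = v k x) \<and> integrable lborel (v k) \<and>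
      (\<integral>x. \<bar>v k x\<bar> \<partial>lborel) \<le> measure lebesgue \<Omega> + M \<and> full_energy s p (v k) \<le> ennreal M"
    by (intro choice allI)
  then obtain v where v: "\<And>k. v k \<in> borel_measurable borel" "\<And>k. AE x in lebesgue. w k x = v k x"
    "\<And>k. integrable lborel (v k)" "\<And>k. (\<integral>x. \<bar>v k x\<bar> \<partial>lborel) \<le> measure lebesgue \<Omega> + M"
    "\<And>k. full_energy s p (v k) \<le> ennreal M" by blast
  define B where "B = measure lebesgue \<Omega> + M"
  note [measurable] = v(1)
  obtain C where C0: "0 \<le> C" and Capp: "\<forall>(u :: real^'n \<Rightarrow> real) A k. integrable lborel u \<longrightarrow> 0 \<le> A \<longrightarrow>
    full_energy s p u \<le> ennreal A \<longrightarrow>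
    (\<integral>\<^sup>+x. ennreal (\<bar>u x - dyadic_avg k u x\<bar> powr r) \<partial>lborel)
      \<le> ennreal (C * A powr (r / p) * (2 powr (- (sobolev_gap CARD('n) s p r * r))) ^ k)"
    using dyadic_approximation[OF p_gt_1 r(1) s_pos r(2)] by auto
  note C = C0 Capp[rule_format, OF v(3) M0 v(5)]
  define a where "a k = C * M powr (r / p) * (2 powr (- (sobolev_gap CARD('n) s p r * r))) ^ k" for k
  have a0: "0 \<le> a k" for k using C(1) by (simp add: a_def)
  have alim: "a \<longlonglongrightarrow> C * M powr (r / p) * 0"
    unfolding a_def using r r1 by (intro tendsto_mult_left LIMSEQ_realpow_zero) (auto intro!: powr_less_one)
  have cellint: "\<bar>\<integral>y. indicator (cell k x) y * v j y \<partial>lborel\<bar> \<le> B" for k x j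
  proof -
    have i: "integrable lborel (\<lambda>y. indicator (cell k x) y * v j y)"
      using integrable_real_mult_indicator[OF _ v(3), of "cell k x" j] by (simp add: mult.commute)
    have "\<bar>\<integral>y. indicator (cell k x) y * v j y \<partial>lborel\<bar> \<le> (\<integral>y. \<bar>indicator (cell k x) y * v j y\<bar> \<partial>lborel)"
      using integral_norm_bound[of lborel "\<lambda>y. indicator (cell k x) y * v j y"] by simp
    also have "\<dots> \<le> (\<integral>y. \<bar>v j y\<bar> \<partial>lborel)"
      using i v(3)[of j] by (intro integral_mono) (auto simp: indicator_def)
    finally show ?thesis using v(4)[of j] by (simp add: B_def)
  qed
  define pt where "pt k m = ((\<chi> i. real_of_int (m i) / 2 ^ k) :: real^'n)" for k :: nat and m
  have cell_pt: "cell k x = cell k (pt k (\<lambda>i. \<lfloor>2 ^ k * x $ i\<rfloor>))" for k x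
    by (simp add: cell_def pt_def)
  \<comment> \<open>A cell is determined by its level and its integer corner, so there are countably many.\<close>
  define f where "f j km = (\<integral>y. indicator (cell (fst km) (pt (fst km) (snd km))) y * v j y \<partial>lborel)"
    for j and km :: "nat \<times> ('n \<Rightarrow> int)"
  have fb: "norm (f j km) \<le> B" for j km unfolding f_def using cellint by simp
  have "\<exists>\<sigma> :: nat \<Rightarrow> nat. strict_mono \<sigma> \<and> (\<forall>km. \<exists>l. (\<lambda>j. f (\<sigma> j) km) \<longlonglongrightarrow> l)"
  proof (rule function_convergent_subsequence[of UNIV f B])
    fix \<sigma> :: "nat \<Rightarrow> nat"
    assume "strict_mono \<sigma>" "\<And>km. km \<in> UNIV \<Longrightarrow> \<exists>l. (\<lambda>j. f (\<sigma> j) km) \<longlonglongrightarrow> l"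
    then show ?thesis by blast
  qed (use fb in auto)
  then obtain \<sigma> :: "nat \<Rightarrow> nat" where \<sigma>: "strict_mono \<sigma>" "\<And>km. \<exists>l. (\<lambda>j. f (\<sigma> j) km) \<longlonglongrightarrow> l"
    by blast
  have "\<exists>l. (\<lambda>j. dyadic_avg k (v (\<sigma> j)) x) \<longlonglongrightarrow> l" for k x
  proof -
    obtain l where "(\<lambda>j. f (\<sigma> j) (k, \<lambda>i. \<lfloor>2 ^ k * x $ i\<rfloor>)) \<longlonglongrightarrow> l" using \<sigma>(2) by blast
    then have "(\<lambda>j. f (\<sigma> j) (k, \<lambda>i. \<lfloor>2 ^ k * x $ i\<rfloor>) / cell_volume CARD('n) k) \<longlonglongrightarrow> l / cell_volume CARD('n) k"
      by (intro tendsto_divide tendsto_const) (simp_all add: less_imp_neq[symmetric])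
    then show ?thesis unfolding f_def dyadic_avg_def by (auto simp: cell_pt[symmetric])
  qed
  then have "\<exists>g. \<forall>k x. (\<lambda>j. dyadic_avg k (v (\<sigma> j)) x) \<longlonglongrightarrow> g k x"
    by (intro choice allI)
  then obtain g where g: "\<And>k x. (\<lambda>j. dyadic_avg k (v (\<sigma> j)) x) \<longlonglongrightarrow> g k x" by blast
  have vl: "v j \<in> borel_measurable lebesgue" for j using v(1) by (intro measurable_completion) simp
  have Pl: "dyadic_avg k (v j) \<in> borel_measurable lebesgue" for k j
    by (intro measurable_completion) simp
  have gb: "g k \<in> borel_measurable borel" for k
    by (rule borel_measurable_LIMSEQ_real[OF g]) simp
  have gl: "g k \<in> borel_measurable lebesgue" for k using gb by (intro measurable_completion) simp
  have Pb: "\<bar>dyadic_avg k (v j) x\<bar> \<le> B / cell_volume CARD('n) k" for k j x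
    using cellint[of k x j] by (simp add: dyadic_avg_def abs_divide divide_right_mono less_imp_le)
  have gB: "\<bar>g k x\<bar> \<le> B / cell_volume CARD('n) k" for k x
    using tendsto_rabs[OF g] by (rule LIMSEQ_le_const2) (use Pb in blast)
  have PL: "dyadic_avg k (v j) \<in> Lspace L r" for k j using bounded_Lspace[OF Pl Pb] r1 by simp
  have gL: "g k \<in> Lspace L r" for k using bounded_Lspace[OF gl gB] r1 by simp
  have err: "(\<lambda>x. v j x - dyadic_avg k (v j) x) \<in> Lspace L r"
    "(\<integral>x. \<bar>v j x - dyadic_avg k (v j) x\<bar> powr r \<partial>L) \<le> a k" for j k
  proof -
    let ?h = "\<lambda>x. \<bar>v j x - dyadic_avg k (v j) x\<bar> powr r"
    have m: "?h \<in> borel_measurable L" using measurable_domain[OF vl] measurable_domain[OF Pl] by measurable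
    have "(\<integral>\<^sup>+x. ennreal (?h x) \<partial>L) = (\<integral>\<^sup>+x. ennreal (?h x) * indicator \<Omega> x \<partial>lebesgue)"
      by (subst nn_integral_restrict_space) auto
    also have "\<dots> \<le> (\<integral>\<^sup>+x. ennreal (?h x) \<partial>lebesgue)"
      by (intro nn_integral_mono) (auto simp: indicator_def)
    also have "\<dots> \<le> ennreal (a k)" using C(2) by (simp add: nn_integral_completion a_def)
    finally have le: "(\<integral>\<^sup>+x. ennreal (?h x) \<partial>L) \<le> ennreal (a k)" .
    then have i: "integrable L ?h" using m by (intro integrableI_nonneg) (auto simp: le_less_trans)
    then show "(\<lambda>x. v j x - dyadic_avg k (v j) x) \<in> Lspace L r"
      using measurable_domain[OF vl] measurable_domain[OF Pl] by (simp add: Lspace_def)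
    show "(\<integral>x. ?h x \<partial>L) \<le> a k"
      using le a0 nn_integral_eq_integral[OF i] by (simp add: ennreal_le_iff)
  qed
  have vL: "v j \<in> Lspace L r" for j
    using Lspace_add[OF err(1)[of j 0] PL[of 0 j] r0] by simp
  have aeL: "AE x in L. w k x = v k x" for k using v(2) by (rule AE_domain)
  have wL: "w k \<in> Lspace L r" for k
    by (rule LspaceI_dominated[OF measurable_domain[OF X0_measurable[OF w(1)]] Lspace_integrable[OF vL[of k]]])
      (use aeL[of k] in auto)
  have conv: "(\<lambda>j. \<integral>x. \<bar>dyadic_avg k (v (\<sigma> j)) x - g k x\<bar> powr r \<partial>L) \<longlonglongrightarrow> 0" for k
  proof -
    have "(\<lambda>j. \<integral>x. \<bar>dyadic_avg k (v (\<sigma> j)) x - g k x\<bar> powr r \<partial>L) \<longlonglongrightarrow> (\<integral>x. 0 \<partial>L)"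
    proof (rule integral_dominated_convergence[where w = "\<lambda>x. (2 * (B / cell_volume CARD('n) k)) powr r"])
      show "(\<lambda>x. \<bar>dyadic_avg k (v (\<sigma> j)) x - g k x\<bar> powr r) \<in> borel_measurable L" for j
        using measurable_domain[OF Pl] measurable_domain[OF gl] by measurable
      show "AE x in L. (\<lambda>j. \<bar>dyadic_avg k (v (\<sigma> j)) x - g k x\<bar> powr r) \<longlonglongrightarrow> 0"
      proof (rule AE_I2)
        fix x
        have "(\<lambda>j. \<bar>dyadic_avg k (v (\<sigma> j)) x - g k x\<bar> powr r) \<longlonglongrightarrow> \<bar>g k x - g k x\<bar> powr r"
          using r1 by (intro tendsto_powr' tendsto_intros g) auto
        then show "(\<lambda>j. \<bar>dyadic_avg k (v (\<sigma> j)) x - g k x\<bar> powr r) \<longlonglongrightarrow> 0" by simp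
      qed
      show "AE x in L. norm (\<bar>dyadic_avg k (v (\<sigma> j)) x - g k x\<bar> powr r) \<le> (2 * (B / cell_volume CARD('n) k)) powr r" for j
      proof (rule AE_I2)
        fix x
        have "\<bar>dyadic_avg k (v (\<sigma> j)) x - g k x\<bar> \<le> 2 * (B / cell_volume CARD('n) k)"
          using Pb[of k "\<sigma> j" x] gB[of k x] by linarith
        then show "norm (\<bar>dyadic_avg k (v (\<sigma> j)) x - g k x\<bar> powr r) \<le> (2 * (B / cell_volume CARD('n) k)) powr r"
          using r0 by (simp add: powr_mono2)
      qed
    qed auto
    then show ?thesis by simp
  qed
  have "\<exists>N. \<forall>i\<ge>N. \<forall>j\<ge>N. (\<integral>x. \<bar>w (\<sigma> i) x - w (\<sigma> j) x\<bar> powr r \<partial>L) < e" if e: "0 < e" for e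
  proof -
    \<comment> \<open>The bound for the power of a sum is used twice in succession and costs \<open>2 powr r\<close> each time; four
      error terms remain.\<close>
    define e' where "e' = e / (2 powr r * 2 powr r * 4)"
    have e': "0 < e'" using e by (simp add: e'_def)
    have "\<forall>\<^sub>F k in sequentially. a k < e'" using alim e' by (intro order_tendstoD(2)) auto
    then obtain k where k: "a k < e'" using eventually_happens trivial_limit_sequentially by blast
    have "\<forall>\<^sub>F j in sequentially. (\<integral>x. \<bar>dyadic_avg k (v (\<sigma> j)) x - g k x\<bar> powr r \<partial>L) < e'"
      using conv e' by (rule order_tendstoD(2))
    then obtain N where N: "\<And>j. N \<le> j \<Longrightarrow> (\<integral>x. \<bar>dyadic_avg k (v (\<sigma> j)) x - g k x\<bar> powr r \<partial>L) < e'"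
      by (auto simp: eventually_sequentially)
    have h: "(\<integral>x. \<bar>v (\<sigma> j) x - g k x\<bar> powr r \<partial>L) < 2 powr r * (2 * e')" if "N \<le> j" for j
    proof -
      have "(\<integral>x. \<bar>(v (\<sigma> j) x - dyadic_avg k (v (\<sigma> j)) x) + (dyadic_avg k (v (\<sigma> j)) x - g k x)\<bar> powr r \<partial>L)
        \<le> 2 powr r * ((\<integral>x. \<bar>v (\<sigma> j) x - dyadic_avg k (v (\<sigma> j)) x\<bar> powr r \<partial>L)
          + (\<integral>x. \<bar>dyadic_avg k (v (\<sigma> j)) x - g k x\<bar> powr r \<partial>L))"
        by (rule integral_add_powr_le[OF err(1) Lspace_diff[OF PL gL r0] r0])
      also have "\<dots> < 2 powr r * (2 * e')"
        using N[OF that] err(2)[of "\<sigma> j" k] k by (intro mult_strict_left_mono) auto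
      finally show ?thesis by simp
    qed
    have main: "(\<integral>x. \<bar>w (\<sigma> i) x - w (\<sigma> j) x\<bar> powr r \<partial>L) < e" if ij: "N \<le> i" "N \<le> j" for i j
    proof -
      have "(\<integral>x. \<bar>w (\<sigma> i) x - w (\<sigma> j) x\<bar> powr r \<partial>L)
         = (\<integral>x. \<bar>(v (\<sigma> i) x - g k x) - (v (\<sigma> j) x - g k x)\<bar> powr r \<partial>L)"
      proof (rule integral_cong_AE)
        show "AE x in L. \<bar>w (\<sigma> i) x - w (\<sigma> j) x\<bar> powr r
            = \<bar>(v (\<sigma> i) x - g k x) - (v (\<sigma> j) x - g k x)\<bar> powr r"
          using aeL[of "\<sigma> i"] aeL[of "\<sigma> j"] by eventually_elim simp
      qed (use Lspace_measurable[OF wL] Lspace_measurable[OF vL] Lspace_measurable[OF gL] in measurable)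
      also have "\<dots> \<le> 2 powr r * ((\<integral>x. \<bar>v (\<sigma> i) x - g k x\<bar> powr r \<partial>L) + (\<integral>x. \<bar>v (\<sigma> j) x - g k x\<bar> powr r \<partial>L))"
        by (intro integral_diff_powr_le Lspace_diff vL gL r0)
      also have "\<dots> < 2 powr r * (2 powr r * (2 * e') + 2 powr r * (2 * e'))"
        by (intro mult_strict_left_mono add_strict_mono h ij) auto
      also have "\<dots> = e" by (simp add: e'_def)
      finally show ?thesis .
    qed
    then show ?thesis by blast
  qed
  then show ?thesis using that[OF \<sigma>(1)] wL by blast
qed

text \<open>The majorant lets the lower order functionals pass to the limit by dominated convergence. The
  last item is the lower semicontinuity of the energy, from Fatou's lemma.\<close>

theorem X0_compact:
  assumes r: "p < r" "0 < sobolev_gap CARD('n) s p r"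
    and w: "\<And>k. w k \<in> X0" "\<And>k. E (w k) \<le> M" "\<And>k. (\<integral>x. \<bar>w k x\<bar> powr p \<partial>L) \<le> M"
  obtains u W and \<sigma> :: "nat \<Rightarrow> nat" where "strict_mono \<sigma>" "u \<in> X0" "W \<in> Lspace L r" "\<And>x. 0 \<le> W x"
    "AE x in L. \<forall>k. \<bar>w (\<sigma> k) x\<bar> \<le> W x" "AE x in L. (\<lambda>k. w (\<sigma> k) x) \<longlonglongrightarrow> u x"
    "\<forall>c. (\<forall>\<^sub>F k in sequentially. E (w (\<sigma> k)) \<le> c) \<longrightarrow> E u \<le> c"
proof -
  interpret F: finite_measure L by (rule finite_measure_domain)
  have r1: "1 < r" using r p_gt_1 by simp
  obtain \<sigma>1 :: "nat \<Rightarrow> nat" where \<sigma>1: "strict_mono \<sigma>1" "\<forall>k. w k \<in> Lspace L r"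
    "\<forall>e>0. \<exists>N. \<forall>i\<ge>N. \<forall>j\<ge>N. (\<integral>x. \<bar>w (\<sigma>1 i) x - w (\<sigma>1 j) x\<bar> powr r \<partial>L) < e"
    using X0_Cauchy_subsequence[of r w M, OF r w] by blast
  note wL = \<sigma>1(2)[rule_format]
  obtain g where g: "g \<in> Lspace L r" "(\<lambda>k. \<integral>x. \<bar>w (\<sigma>1 k) x - g x\<bar> powr r \<partial>L) \<longlonglongrightarrow> 0"
    using Lspace_complete[of r "\<lambda>k. w (\<sigma>1 k)" L] \<sigma>1 r1 by auto
  obtain \<sigma>2 where \<sigma>2: "strict_mono \<sigma>2" "\<And>k. \<bar>\<integral>x. \<bar>w (\<sigma>1 (\<sigma>2 k)) x - g x\<bar> powr r \<partial>L\<bar> < (1/2) ^ k"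
    using subseq_below[OF g(2), of "\<lambda>k. (1/2) ^ k"] by auto
  define \<sigma> where "\<sigma> = \<sigma>1 \<circ> \<sigma>2"
  have \<sigma>: "strict_mono \<sigma>" unfolding \<sigma>_def using \<sigma>1(1) \<sigma>2(1) by (rule strict_mono_o)
  have geo: "summable (\<lambda>k. (1/2 :: real) ^ k)" by (rule summable_geometric) simp
  have sm: "summable (\<lambda>k. \<integral>x. \<bar>w (\<sigma> k) x - g x\<bar> powr r \<partial>L)"
    by (rule summable_comparison_test'[OF geo]) (use \<sigma>2(2) in \<open>auto simp: less_imp_le \<sigma>_def\<close>)
  obtain W where W: "W \<in> Lspace L r" "\<And>x. 0 \<le> W x" "AE x in L. \<forall>k. \<bar>w (\<sigma> k) x\<bar> \<le> W x"
    "AE x in L. (\<lambda>k. w (\<sigma> k) x) \<longlonglongrightarrow> g x"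
    using Lspace_fast_limit[OF _ wL g(1) sm] r1 by auto
  define u where "u x = (if x \<in> \<Omega> then g x else 0)" for x
  have out: "\<And>x. x \<notin> \<Omega> \<Longrightarrow> u x = 0" by (simp add: u_def)
  have um: "u \<in> borel_measurable lebesgue"
    unfolding u_def using Lspace_measurable[OF g(1)] by (intro borel_measurable_if_I) auto
  have ug: "AE x in L. u x = g x" by (rule AE_I2) (simp add: u_def)
  have lim: "AE x in L. (\<lambda>k. w (\<sigma> k) x) \<longlonglongrightarrow> u x"
    using W(4) ug by eventually_elim simp
  have uL: "u \<in> Lspace L r"
    by (rule LspaceI_dominated[OF measurable_domain[OF um] Lspace_integrable[OF g(1)]]) (use ug in auto)
  have uLp: "u \<in> Lspace L p" using Lspace_mono_exponent[OF uL] r(1) by simp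
  have uW: "AE x in L. \<bar>u x\<bar> \<le> W x"
    using W(3) lim
  proof eventually_elim
    case (elim x)
    show ?case using tendsto_rabs[OF elim(2)] by (rule LIMSEQ_le_const2) (use elim(1) in blast)
  qed
  have WL: "(\<lambda>x. 2 * W x) \<in> Lspace L p"
    using Lspace_scale[OF Lspace_mono_exponent[OF W(1), of p], of 2] r(1) by simp
  have "(\<lambda>k. \<integral>x. \<bar>w (\<sigma> k) x - u x\<bar> powr p \<partial>L) \<longlonglongrightarrow> (\<integral>x. 0 \<partial>L)"
  proof (rule integral_dominated_convergence[where w = "\<lambda>x. \<bar>2 * W x\<bar> powr p"])
    show "(\<lambda>x. \<bar>w (\<sigma> k) x - u x\<bar> powr p) \<in> borel_measurable L" for k
      using Lspace_measurable[OF wL] Lspace_measurable[OF uL] by measurable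
    show "integrable L (\<lambda>x. \<bar>2 * W x\<bar> powr p)" by (rule Lspace_integrable[OF WL])
    show "AE x in L. (\<lambda>k. \<bar>w (\<sigma> k) x - u x\<bar> powr p) \<longlonglongrightarrow> 0"
      using lim
    proof eventually_elim
      case (elim x)
      then have "(\<lambda>k. \<bar>w (\<sigma> k) x - u x\<bar> powr p) \<longlonglongrightarrow> \<bar>u x - u x\<bar> powr p"
        by (intro tendsto_powr' tendsto_intros) auto
      then show ?case by simp
    qed
    show "AE x in L. norm (\<bar>w (\<sigma> k) x - u x\<bar> powr p) \<le> \<bar>2 * W x\<bar> powr p" for k
      using W(3) uW
    proof eventually_elim
      case (elim x)
      have "\<bar>w (\<sigma> k) x - u x\<bar> \<le> \<bar>2 * W x\<bar>"
        using elim(1)[rule_format, of k] elim(2) by linarith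
      then show ?case by (simp add: powr_mono2)
    qed
  qed simp
  then have limp: "(\<lambda>k. \<integral>x. \<bar>w (\<sigma> k) x - u x\<bar> powr p \<partial>L) \<longlonglongrightarrow> 0" by simp
  have uX: "u \<in> X0" by (rule X0_closed[OF w(1) w(2) um uLp limp out])
  have "E u \<le> c" if "\<forall>\<^sub>F k in sequentially. E (w (\<sigma> k)) \<le> c" for c
  proof -
    have 1: "integrable G (\<lambda>z. \<bar>diff2 (w (\<sigma> k)) z\<bar> powr p)" for k
      using Lspace_integrable[OF X0_diff2[OF w(1)]] .
    have 2: "AE z in G. (\<lambda>k. \<bar>diff2 (w (\<sigma> k)) z\<bar> powr p) \<longlonglongrightarrow> \<bar>diff2 u z\<bar> powr p"
    proof -
      have "AE z in G. (\<lambda>k. diff2 (w (\<sigma> k)) z) \<longlonglongrightarrow> diff2 u z"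
        by (rule diff2_AE_tendsto[OF w(1) lim]) (rule out)
      then show ?thesis by eventually_elim (auto intro!: tendsto_powr' tendsto_intros)
    qed
    have 3: "(\<lambda>z. \<bar>diff2 u z\<bar> powr p) \<in> borel_measurable G"
      using Lspace_measurable[OF X0_diff2[OF uX]] by measurable
    have 4: "0 \<le> \<bar>diff2 (w (\<sigma> k)) z\<bar> powr p" for k z by simp
    show ?thesis
      using Fatou_bound(2)[OF 1 4 2 3 that[unfolded energy_def]] by (simp add: energy_def)
  qed
  then show ?thesis using that[OF \<sigma> uX W(1,2,3) lim] by blast
qed

end

section \<open>An abstract existence principle for concave-convex functionals\<close>

text \<open>The vector space structure enters only through the combinations \<open>comb a x b y\<close>, to be read as
  \<open>a x + b y\<close>. The forms \<open>A'\<close>, \<open>K'\<close> and \<open>B'\<close> are the directional derivatives divided by the degrees \<open>p\<close>, \<open>q\<close>, \<open>r\<close>,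
  which turns Euler's identity into \<open>A' x x = A x\<close> (contained in \<open>linear\<close>) and makes
  \<open>A' = K' + B'\<close> the equation for critical points.\<close>

locale concave_convex =
  fixes X :: "'e set" and comb :: "real \<Rightarrow> 'e \<Rightarrow> real \<Rightarrow> 'e \<Rightarrow> 'e"
    and A K B :: "'e \<Rightarrow> real" and A' K' B' :: "'e \<Rightarrow> 'e \<Rightarrow> real" and p q r cK cB T :: real
  assumes exponents: "1 < q" "q < p" "p < r"
    and comb_in: "\<And>a b x y. x \<in> X \<Longrightarrow> y \<in> X \<Longrightarrow> comb a x b y \<in> X"
    and comb_1_0: "\<And>x y. comb 1 x 0 y = x"
    and A_nonneg: "\<And>x. 0 \<le> A x"
    and homogeneous: "\<And>t x. 0 < t \<Longrightarrow> A (comb t x 0 x) = t powr p * A x"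
      "\<And>t x. 0 < t \<Longrightarrow> K (comb t x 0 x) = t powr q * K x"
      "\<And>t x. 0 < t \<Longrightarrow> B (comb t x 0 x) = t powr r * B x"
    and deriv: "\<And>x y. x \<in> X \<Longrightarrow> y \<in> X \<Longrightarrow> ((\<lambda>t. A (comb 1 x t y)) has_real_derivative p * A' x y) (at 0)"
      "\<And>x y. x \<in> X \<Longrightarrow> y \<in> X \<Longrightarrow> ((\<lambda>t. K (comb 1 x t y)) has_real_derivative q * K' x y) (at 0)"
      "\<And>x y. x \<in> X \<Longrightarrow> y \<in> X \<Longrightarrow> ((\<lambda>t. B (comb 1 x t y)) has_real_derivative r * B' x y) (at 0)"
    and linear: "\<And>x y a b. x \<in> X \<Longrightarrow> y \<in> X \<Longrightarrow> A' x (comb a x b y) = a * A x + b * A' x y"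
      "\<And>x y a b. x \<in> X \<Longrightarrow> y \<in> X \<Longrightarrow> K' x (comb a x b y) = a * K x + b * K' x y"
      "\<And>x y a b. x \<in> X \<Longrightarrow> y \<in> X \<Longrightarrow> B' x (comb a x b y) = a * B x + b * B' x y"
    and growth: "\<And>x. x \<in> X \<Longrightarrow> K x \<le> cK * A x powr (q / p)"
      "\<And>x. x \<in> X \<Longrightarrow> B x \<le> cB * A x powr (r / p)"
    and constants: "0 \<le> cK" "0 < cB"
    and compact: "\<And>x M. (\<And>k. x k \<in> X) \<Longrightarrow> (\<And>k. A (x k) \<le> M) \<Longrightarrow>
      \<exists>x0\<in>X. \<exists>\<sigma> :: nat \<Rightarrow> nat. strict_mono \<sigma> \<and> (\<lambda>k. K (x (\<sigma> k))) \<longlonglongrightarrow> K x0 \<and> (\<lambda>k. B (x (\<sigma> k))) \<longlonglongrightarrow> B x0 \<and>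
        (\<forall>c. (\<forall>\<^sub>F k in sequentially. A (x (\<sigma> k)) \<le> c) \<longrightarrow> A x0 \<le> c)"
    and B_positive: "\<exists>x\<in>X. 0 < B x"
    and threshold: "0 < T" "cK * T powr (q / p) + cB * T powr (r / p) < T"
begin

text \<open>The direct method: along a minimizing sequence \<open>K\<close> and \<open>B\<close> pass to the limit, hence so
  does the value of \<open>A\<close>, which can only drop at the limit point.\<close>

lemma minimizer_exists:
  fixes a b c :: real
  defines "F \<equiv> \<lambda>x. a * A x - b * K x - c * B x"
  assumes a: "0 < a" and C: "C \<subseteq> X" "C \<noteq> {}" and lower: "\<And>x. x \<in> C \<Longrightarrow> lb \<le> F x"
    and coercive: "\<And>x y. x \<in> C \<Longrightarrow> F x \<le> F y + 1 \<Longrightarrow> y \<in> C \<Longrightarrow> A x \<le> M y"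
    and closed: "\<And>x x0 e. (\<And>k::nat. x k \<in> C) \<Longrightarrow> x0 \<in> X \<Longrightarrow> (\<lambda>k. A (x k)) \<longlonglongrightarrow> e \<Longrightarrow> A x0 \<le> e \<Longrightarrow>
      (\<lambda>k. K (x k)) \<longlonglongrightarrow> K x0 \<Longrightarrow> (\<lambda>k. B (x k)) \<longlonglongrightarrow> B x0 \<Longrightarrow> x0 \<in> C"
  shows "\<exists>x0\<in>C. \<forall>x\<in>C. F x0 \<le> F x"
proof -
  define I where "I = Inf (F ` C)"
  have bdd: "bdd_below (F ` C)" using lower by (auto intro!: bdd_belowI[of _ lb])
  have I_le: "I \<le> F x" if "x \<in> C" for x unfolding I_def using that by (intro cInf_lower bdd) auto
  have ex: "\<exists>x. x \<in> C \<and> F x < I + 1 / (real k + 1)" for k :: nat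
  proof -
    have "F ` C \<noteq> {}" using C(2) by simp
    moreover have "Inf (F ` C) < I + 1 / (real k + 1)" by (simp add: I_def)
    ultimately obtain y where "y \<in> F ` C" "y < I + 1 / (real k + 1)" using cInf_lessD[of "F ` C"] by metis
    then show ?thesis by auto
  qed
  then have "\<exists>x. \<forall>k. x k \<in> C \<and> F (x k) < I + 1 / (real k + 1)" by (intro choice allI)
  then obtain x where x: "\<And>k. x k \<in> C" "\<And>k. F (x k) < I + 1 / (real k + 1)" by blast
  have "I + 1 / (real k + 1) \<le> I + 1" for k by simp
  then have "F (x k) \<le> F (x 0) + 1" for k using x(2)[of k] I_le[OF x(1)[of 0]] by (smt (verit))
  then have "A (x k) \<le> M (x 0)" for k using coercive x(1) by blast
  then obtain x0 \<sigma> where x0: "x0 \<in> X" "strict_mono (\<sigma> :: nat \<Rightarrow> nat)" "(\<lambda>k. K (x (\<sigma> k))) \<longlonglongrightarrow> K x0"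
    "(\<lambda>k. B (x (\<sigma> k))) \<longlonglongrightarrow> B x0" "\<And>c. \<forall>\<^sub>F k in sequentially. A (x (\<sigma> k)) \<le> c \<Longrightarrow> A x0 \<le> c"
    using compact[of x "M (x 0)"] x(1) C(1) by blast
  have "(\<lambda>k. F (x k)) \<longlonglongrightarrow> I"
  proof (rule tendsto_sandwich[of "\<lambda>k. I" _ _ "\<lambda>k. I + 1 / (real k + 1)"])
    have "(\<lambda>k. I + 1 / (real k + 1)) \<longlonglongrightarrow> I + 0"
      using LIMSEQ_inverse_real_of_nat by (intro tendsto_intros) (simp add: inverse_eq_divide add.commute)
    then show "(\<lambda>k. I + 1 / (real k + 1)) \<longlonglongrightarrow> I" by simp
  qed (auto intro!: always_eventually less_imp_le x(2) I_le x(1))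
  from LIMSEQ_subseq_LIMSEQ[OF this x0(2)] have FI: "(\<lambda>k. F (x (\<sigma> k))) \<longlonglongrightarrow> I" by (simp add: comp_def)
  define e where "e = (I + b * K x0 + c * B x0) / a"
  have "(\<lambda>k. (F (x (\<sigma> k)) + b * K (x (\<sigma> k)) + c * B (x (\<sigma> k))) / a) \<longlonglongrightarrow> e"
    unfolding e_def using a by (intro tendsto_intros FI x0(3,4)) auto
  moreover have "(F (x (\<sigma> k)) + b * K (x (\<sigma> k)) + c * B (x (\<sigma> k))) / a = A (x (\<sigma> k))" for k
    using a by (simp add: F_def)
  ultimately have Ae: "(\<lambda>k. A (x (\<sigma> k))) \<longlonglongrightarrow> e" by simp
  have "A x0 \<le> e"
  proof (rule field_le_epsilon)
    fix d :: real assume "0 < d"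
    then have "\<forall>\<^sub>F k in sequentially. A (x (\<sigma> k)) < e + d" using Ae by (intro order_tendstoD(2)) auto
    then show "A x0 \<le> e + d" by (intro x0(5)) (auto elim: eventually_mono)
  qed
  moreover from this have "x0 \<in> C" using closed[of "\<lambda>k. x (\<sigma> k)"] x(1) x0 Ae by blast
  moreover have "F x0 \<le> I"
  proof -
    have "a * A x0 \<le> a * e" using a \<open>A x0 \<le> e\<close> by simp
    also have "a * e = I + b * K x0 + c * B x0" using a by (simp add: e_def)
    finally show ?thesis by (simp add: F_def)
  qed
  ultimately show ?thesis using I_le order_trans by blast
qed

lemma DERIV_ray:
  "((\<lambda>t. t powr p * a - t powr q * b - t powr r * c) has_real_derivative (p * a - q * b - r * c)) (at 1)"
  by (auto intro!: derivative_eq_intros)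

text \<open>If \<open>K\<close> is positive somewhere, the functional \<open>A / p - K / q - B / r\<close> takes negative values
  near the origin. Its minimum over the ball \<open>A \<le> T\<close> is interior, because on the sphere \<open>A = T\<close>
  the radial derivative \<open>A - K - B\<close> is positive.\<close>

lemma critical_point_ball:
  assumes x1: "x1 \<in> X" "0 < K x1"
  shows "\<exists>x\<in>X. (0 < K x \<or> 0 < B x) \<and> (\<forall>y\<in>X. A' x y = K' x y + B' x y)"
proof -
  define J where "J x = (1 / p) * A x - (1 / q) * K x - (1 / r) * B x" for x
  have pos: "0 < p" "0 < q" "0 < r" using exponents by auto
  define C where "C = {x \<in> X. A x \<le> T}"
  have KB: "K x \<le> cK * T powr (q / p)" "B x \<le> cB * T powr (r / p)" if "x \<in> C" for x
  proof -
    have "A x powr (q / p) \<le> T powr (q / p)" "A x powr (r / p) \<le> T powr (r / p)"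
      using that pos A_nonneg[of x] by (auto simp: C_def intro!: powr_mono2)
    then have "cK * A x powr (q / p) \<le> cK * T powr (q / p)" "cB * A x powr (r / p) \<le> cB * T powr (r / p)"
      using constants by (auto intro!: mult_left_mono)
    then show "K x \<le> cK * T powr (q / p)" "B x \<le> cB * T powr (r / p)"
      using growth[of x] that by (auto simp: C_def)
  qed
  define \<phi> where "\<phi> t = t powr (p - q) * ((1 / p) * A x1) - t powr 0 * ((1 / q) * K x1) - t powr (r - q) * ((1 / r) * B x1)" for t
  have J_ray: "J (comb t x 0 x) = (1 / p) * (t powr p * A x) - (1 / q) * (t powr q * K x) - (1 / r) * (t powr r * B x)"
    if "0 < t" for t x
    using homogeneous[OF that] by (simp add: J_def)
  have "\<exists>x\<in>C. J x < 0"
  proof -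
    have l: "((\<lambda>t. t powr c) \<longlongrightarrow> 0) (at_right 0)" if "0 < c" for c :: real
    proof -
      have "((\<lambda>t. t powr c) \<longlongrightarrow> 0 powr c) (at_right (0::real))"
        using that by (intro tendsto_powr2 tendsto_intros) (auto simp: eventually_at_filter)
      then show ?thesis by simp
    qed
    have "((\<lambda>t. t powr (p - q) * ((1 / p) * A x1) - (1 / q) * K x1 - t powr (r - q) * ((1 / r) * B x1))
        \<longlongrightarrow> 0 * ((1 / p) * A x1) - (1 / q) * K x1 - 0 * ((1 / r) * B x1)) (at_right 0)"
      using exponents by (intro tendsto_intros l) auto
    then have "\<forall>\<^sub>F t in at_right 0. t powr (p - q) * ((1 / p) * A x1) - (1 / q) * K x1 - t powr (r - q) * ((1 / r) * B x1) < 0"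
      using x1(2) pos by (intro order_tendstoD(2)) auto
    moreover have "((\<lambda>t. t powr p * A x1) \<longlongrightarrow> 0 * A x1) (at_right 0)"
      using pos by (intro tendsto_intros l)
    then have "\<forall>\<^sub>F t in at_right 0. t powr p * A x1 < T"
      using threshold(1) by (intro order_tendstoD(2)) auto
    moreover have "\<forall>\<^sub>F t in at_right 0. (0::real) < t" by (simp add: eventually_at_filter)
    ultimately have "\<forall>\<^sub>F t in at_right 0. (t powr (p - q) * ((1 / p) * A x1) - (1 / q) * K x1 - t powr (r - q) * ((1 / r) * B x1) < 0
        \<and> t powr p * A x1 < T) \<and> (0::real) < t"
      by eventually_elim simp
    from eventually_happens'[OF trivial_limit_at_right_real this]
    obtain t where t: "t powr (p - q) * ((1 / p) * A x1) - (1 / q) * K x1 - t powr (r - q) * ((1 / r) * B x1) < 0"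
      "t powr p * A x1 < T" "0 < t"
      by blast
    have "comb t x1 0 x1 \<in> C"
      using t comb_in[OF x1(1) x1(1)] homogeneous(1)[OF t(3)] by (simp add: C_def)
    moreover have "J (comb t x1 0 x1) = t powr q * (t powr (p - q) * ((1 / p) * A x1) - (1 / q) * K x1 - t powr (r - q) * ((1 / r) * B x1))"
    proof -
      have "t powr q * t powr (p - q) = t powr p" "t powr q * t powr (r - q) = t powr r"
        by (simp_all flip: powr_add)
      then show ?thesis
        unfolding J_ray[OF t(3)] by (simp only: right_diff_distrib mult.assoc[symmetric]) (simp only: mult_ac)
    qed
    ultimately show ?thesis using t by (intro bexI[of _ "comb t x1 0 x1"]) (auto intro!: mult_pos_neg)
  qed
  then obtain x2 where x2: "x2 \<in> C" "J x2 < 0" by blast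
  have "\<exists>x0\<in>C. \<forall>x\<in>C. (1 / p) * A x0 - (1 / q) * K x0 - (1 / r) * B x0 \<le> (1 / p) * A x - (1 / q) * K x - (1 / r) * B x"
  proof (rule minimizer_exists[where lb = "- (1 / q) * (cK * T powr (q / p)) - (1 / r) * (cB * T powr (r / p))" and M = "\<lambda>_. T"])
    show "C \<noteq> {}" using x2 by blast
    fix x assume x: "x \<in> C"
    have "(1 / q) * K x \<le> (1 / q) * (cK * T powr (q / p))" "(1 / r) * B x \<le> (1 / r) * (cB * T powr (r / p))"
      using KB[OF x] pos by (auto intro!: mult_left_mono divide_right_mono)
    moreover have "0 \<le> (1 / p) * A x" using pos A_nonneg by simp
    ultimately show "- (1 / q) * (cK * T powr (q / p)) - (1 / r) * (cB * T powr (r / p)) \<le> (1 / p) * A x - (1 / q) * K x - (1 / r) * B x"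
      by linarith
  next
    fix x :: "nat \<Rightarrow> 'e" and x0 e
    assume "\<And>k. x k \<in> C" "x0 \<in> X" "(\<lambda>k. A (x k)) \<longlonglongrightarrow> e" "A x0 \<le> e"
    moreover from this have "e \<le> T" by (intro LIMSEQ_le_const2[of "\<lambda>k. A (x k)"]) (auto simp: C_def)
    ultimately show "x0 \<in> C" by (simp add: C_def)
  qed (use pos in \<open>auto simp: C_def\<close>)
  then obtain x0 where x0: "x0 \<in> C" "\<And>x. x \<in> C \<Longrightarrow> J x0 \<le> J x" unfolding J_def by blast
  have x0X: "x0 \<in> X" using x0 by (simp add: C_def)
  have Jneg: "J x0 < 0" using x0(2)[OF x2(1)] x2(2) by simp
  have nontriv: "0 < K x0 \<or> 0 < B x0"
  proof (rule ccontr)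
    assume "\<not> ?thesis"
    then have "(1 / q) * K x0 \<le> 0" "(1 / r) * B x0 \<le> 0"
      using pos by (auto intro!: mult_nonneg_nonpos divide_nonpos_pos)
    moreover have "0 \<le> (1 / p) * A x0" using pos A_nonneg by simp
    ultimately have "0 \<le> J x0" unfolding J_def by linarith
    then show False using Jneg by simp
  qed
  have interior: "A x0 < T"
  proof (rule ccontr)
    assume "\<not> A x0 < T"
    then have AT: "A x0 = T" using x0(1) by (simp add: C_def)
    define \<psi> where "\<psi> t = t powr p * ((1 / p) * A x0) - t powr q * ((1 / q) * K x0) - t powr r * ((1 / r) * B x0)" for t
    have "(\<psi> has_real_derivative (p * ((1 / p) * A x0) - q * ((1 / q) * K x0) - r * ((1 / r) * B x0))) (at 1)"
      unfolding \<psi>_def by (rule DERIV_ray)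
    moreover have "p * ((1 / p) * A x0) - q * ((1 / q) * K x0) - r * ((1 / r) * B x0) = T - K x0 - B x0"
      using pos AT by simp
    moreover have "0 < T - K x0 - B x0" using KB[OF x0(1)] threshold(2) by linarith
    ultimately obtain d where d: "d > 0" "\<And>h. 0 < h \<Longrightarrow> h < d \<Longrightarrow> \<psi> (1 - h) < \<psi> 1"
      using DERIV_pos_inc_left[of \<psi>] by metis
    define t where "t = 1 - min (1/2) (d/2)"
    have t: "0 < t" "t < 1" using d by (auto simp: t_def)
    have "\<psi> t < \<psi> 1" unfolding t_def using d by (intro d(2)) auto
    moreover have "\<psi> t = J (comb t x0 0 x0)" unfolding \<psi>_def J_ray[OF t(1)] by simp
    moreover have "\<psi> 1 = J x0" by (simp add: \<psi>_def J_def)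
    moreover have "t powr p \<le> 1" using t pos by (intro powr_le1) auto
    then have "t powr p * T \<le> 1 * T" using threshold(1) by (intro mult_right_mono) auto
    then have "comb t x0 0 x0 \<in> C"
      using comb_in[OF x0X x0X] homogeneous(1)[OF t(1)] AT by (simp add: C_def)
    ultimately show False using x0(2) by fastforce
  qed
  have "A' x0 y = K' x0 y + B' x0 y" if y: "y \<in> X" for y
  proof -
    define \<psi> where "\<psi> t = J (comb 1 x0 t y)" for t
    have "(\<psi> has_real_derivative ((1 / p) * (p * A' x0 y) - (1 / q) * (q * K' x0 y) - (1 / r) * (r * B' x0 y))) (at 0)"
      unfolding \<psi>_def J_def by (intro DERIV_diff DERIV_cmult deriv x0X y)
    then have D: "(\<psi> has_real_derivative (A' x0 y - K' x0 y - B' x0 y)) (at 0)" using pos by simp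
    have "isCont (\<lambda>t. A (comb 1 x0 t y)) 0" using deriv(1)[OF x0X y] by (rule DERIV_isCont)
    then have "((\<lambda>t. A (comb 1 x0 t y)) \<longlongrightarrow> A x0) (nhds 0)" using tendsto_at_iff_tendsto_nhds[of "\<lambda>t. A (comb 1 x0 t y)" 0]
      by (simp add: isCont_def comb_1_0)
    then have "\<forall>\<^sub>F t in nhds 0. A (comb 1 x0 t y) < T" using interior by (rule order_tendstoD(2))
    then obtain d where d: "d > 0" "\<And>t. dist t 0 < d \<Longrightarrow> A (comb 1 x0 t y) < T"
      by (auto simp: eventually_nhds_metric)
    have "A' x0 y - K' x0 y - B' x0 y = 0"
    proof (rule DERIV_local_min[OF D d(1)], intro allI impI)
      fix t assume "\<bar>0 - t\<bar> < d"
      then have "A (comb 1 x0 t y) < T" by (intro d(2)) (simp add: dist_real_def)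
      then have "comb 1 x0 t y \<in> C" using comb_in[OF x0X y] by (simp add: C_def)
      then show "\<psi> 0 \<le> \<psi> t" unfolding \<psi>_def comb_1_0 by (rule x0(2))
    qed
    then show ?thesis by simp
  qed
  then show ?thesis using nontriv x0X by blast
qed

text \<open>If \<open>K\<close> is nowhere positive, the functional is minimized on the Nehari set, in the relaxed
  form \<open>A \<le> K + B\<close>, which is closed under the available convergence. There it agrees up to a
  multiple of the constraint with \<open>F = (1/p - 1/r) A - (1/q - 1/r) K\<close>, which scaling down decreases, so
  a minimizer satisfies the constraint with equality. If it were not critical, a descent
  direction for the functional could be corrected by a multiple of the minimizer to lead into the
  constraint set while still decreasing \<open>F\<close>.\<close>

lemma critical_point_Nehari:
  assumes K: "\<And>x. x \<in> X \<Longrightarrow> K x \<le> 0"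
  shows "\<exists>x\<in>X. (0 < K x \<or> 0 < B x) \<and> (\<forall>y\<in>X. A' x y = K' x y + B' x y)"
proof -
  have pos: "0 < p" "0 < q" "0 < r" using exponents by auto
  define ca where "ca = 1 / p - 1 / r"
  define ck where "ck = 1 / q - 1 / r"
  have c: "0 < ca" "0 < ck" using exponents pos by (auto simp: ca_def ck_def field_simps)
  define F where "F x = ca * A x - ck * K x" for x
  define C where "C = {x \<in> X. 0 < A x \<and> A x \<le> K x + B x}"
  have B_A: "0 < A x" if "x \<in> X" "0 < B x" for x
  proof (rule ccontr)
    assume "\<not> 0 < A x"
    then have "A x = 0" using A_nonneg[of x] by simp
    then show False using growth(2)[OF that(1)] that(2) by simp
  qed
  have ne: "C \<noteq> {}"
  proof -
    obtain x1 where x1: "x1 \<in> X" "0 < B x1" using B_positive by blast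
    define R where "R = (A x1 + \<bar>K x1\<bar>) / B x1"
    have R0: "0 \<le> R" using x1 A_nonneg[of x1] by (simp add: R_def)
    define t where "t = max 1 (R powr (1 / (r - p)))"
    have t: "1 \<le> t" "0 < t" by (auto simp: t_def)
    have "R = (R powr (1 / (r - p))) powr (r - p)" using exponents R0 by (simp add: powr_powr)
    also have "\<dots> \<le> t powr (r - p)" using exponents by (intro powr_mono2) (auto simp: t_def)
    finally have "A x1 + \<bar>K x1\<bar> \<le> t powr (r - p) * B x1" using x1 by (simp add: R_def pos_divide_le_eq)
    then have "t powr p * (A x1 + \<bar>K x1\<bar>) \<le> t powr p * (t powr (r - p) * B x1)" by (intro mult_left_mono) auto
    also have "\<dots> = t powr r * B x1" unfolding mult.assoc[symmetric] powr_add[symmetric] by simp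
    finally have 1: "t powr p * A x1 + t powr p * \<bar>K x1\<bar> \<le> t powr r * B x1" by (simp add: distrib_left)
    have "t powr q * \<bar>K x1\<bar> \<le> t powr p * \<bar>K x1\<bar>"
      using t exponents by (intro mult_right_mono powr_mono) auto
    then have 2: "t powr p * A x1 - t powr q * K x1 \<le> t powr r * B x1"
      using 1 K[OF x1(1)] by simp
    have "comb t x1 0 x1 \<in> C"
      using 2 comb_in[OF x1(1) x1(1)] homogeneous[OF t(2)] B_A[OF x1] t by (simp add: C_def)
    then show ?thesis by blast
  qed
  \<comment> \<open>On the constraint set \<open>A \<le> B \<le> cB A powr (r / p)\<close>, which keeps \<open>A\<close>, and hence the limit of a
    minimizing sequence, away from zero.\<close>
  define \<delta> where "\<delta> = (1 / cB) powr (p / (r - p))"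
  have \<delta>: "0 < \<delta>" using constants by (simp add: \<delta>_def)
  have A_lower: "\<delta> \<le> A x" if "x \<in> C" for x
  proof -
    have x: "0 < A x" "x \<in> X" "A x \<le> B x" using that K[of x] by (auto simp: C_def)
    have "A x \<le> cB * A x powr (r / p)" using x(3) growth(2)[OF x(2)] by simp
    also have "A x powr (r / p) = A x powr ((r - p) / p) * A x"
      using powr_add[of "A x" "(r - p) / p" 1] x(1) pos by (simp add: diff_divide_distrib)
    finally have "1 * A x \<le> (cB * A x powr ((r - p) / p)) * A x" by (simp add: mult.assoc)
    then have "1 \<le> cB * A x powr ((r - p) / p)" using x(1) by (simp only: mult_le_cancel_right_pos)
    then have "1 / cB \<le> A x powr ((r - p) / p)" using constants by (simp add: pos_divide_le_eq mult.commute)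
    then have "\<delta> \<le> (A x powr ((r - p) / p)) powr (p / (r - p))"
      unfolding \<delta>_def using constants exponents pos by (intro powr_mono2) auto
    also have "\<dots> = A x" using exponents pos x(1) by (simp add: powr_powr)
    finally show ?thesis .
  qed
  have "\<exists>x0\<in>C. \<forall>x\<in>C. ca * A x0 - ck * K x0 - 0 * B x0 \<le> ca * A x - ck * K x - 0 * B x"
  proof (rule minimizer_exists[where lb = 0 and M = "\<lambda>y. (F y + 1) / ca"])
    show "C \<subseteq> X" by (auto simp: C_def)
    fix x assume x: "x \<in> C"
    have ckK: "ck * K x \<le> 0" using c K[of x] x by (auto simp: C_def intro!: mult_nonneg_nonpos)
    moreover have "0 \<le> ca * A x" using c A_nonneg[of x] by simp
    ultimately show "0 \<le> ca * A x - ck * K x - 0 * B x" by linarith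
    fix y assume "ca * A x - ck * K x - 0 * B x \<le> ca * A y - ck * K y - 0 * B y + 1"
    then have "ca * A x \<le> F y + 1" using ckK by (simp add: F_def)
    then show "A x \<le> (F y + 1) / ca" using c by (simp add: pos_le_divide_eq mult.commute)
  next
    fix x :: "nat \<Rightarrow> 'e" and x0 e
    assume x: "\<And>k. x k \<in> C" "x0 \<in> X" "(\<lambda>k. A (x k)) \<longlonglongrightarrow> e" "A x0 \<le> e"
      "(\<lambda>k. K (x k)) \<longlonglongrightarrow> K x0" "(\<lambda>k. B (x k)) \<longlonglongrightarrow> B x0"
    have "e \<le> K x0 + B x0"
      by (rule LIMSEQ_le[OF x(3) tendsto_add[OF x(5,6)]]) (use x(1) in \<open>auto simp: C_def\<close>)
    moreover have "\<delta> \<le> e"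
      by (rule LIMSEQ_le_const[OF x(3)]) (use A_lower[OF x(1)] in blast)
    ultimately have "0 < B x0" using \<delta> K[OF x(2)] by linarith
    then show "x0 \<in> C" using B_A x(2,4) \<open>e \<le> K x0 + B x0\<close> by (simp add: C_def)
  qed (use c ne in auto)
  then obtain x0 where x0: "x0 \<in> C" "\<And>x. x \<in> C \<Longrightarrow> F x0 \<le> F x" unfolding F_def by auto
  have x0X: "x0 \<in> X" and A0: "0 < A x0" using x0 by (auto simp: C_def)
  have equality: "A x0 = K x0 + B x0"
  proof (rule ccontr)
    assume "A x0 \<noteq> K x0 + B x0"
    then have less: "A x0 < K x0 + B x0" using x0(1) by (auto simp: C_def)
    have "((\<lambda>t. t powr p * A x0 - t powr q * K x0 - t powr r * B x0) \<longlongrightarrow> 1 powr p * A x0 - 1 powr q * K x0 - 1 powr r * B x0) (at_left 1)"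
      by (intro tendsto_intros) auto
    then have "\<forall>\<^sub>F t in at_left 1. t powr p * A x0 - t powr q * K x0 - t powr r * B x0 < 0"
      using less by (intro order_tendstoD(2)) auto
    moreover have "\<forall>\<^sub>F t in at_left 1. (0::real) < t \<and> t < 1"
      using eventually_at_left_real[of 0 1] by (auto elim: eventually_mono)
    ultimately have "\<forall>\<^sub>F t in at_left 1. t powr p * A x0 - t powr q * K x0 - t powr r * B x0 < 0 \<and> 0 < t \<and> t < 1"
      by eventually_elim simp
    from eventually_happens'[OF trivial_limit_at_left_real this]
    obtain t where t: "t powr p * A x0 - t powr q * K x0 - t powr r * B x0 < 0" "0 < t" "t < 1"
      by blast
    have "comb t x0 0 x0 \<in> C"
      using t comb_in[OF x0X x0X] homogeneous[OF t(2)] A0 by (simp add: C_def)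
    from x0(2)[OF this] have "ca * A x0 - ck * K x0 \<le> ca * (t powr p * A x0) - ck * (t powr q * K x0)"
      unfolding F_def homogeneous[OF t(2)] .
    moreover have "t powr p < 1" "t powr q \<le> 1"
      using powr_less_mono2[of p t 1] powr_less_mono2[of q t 1] t pos by auto
    then have "ca * (t powr p * A x0) < ca * (1 * A x0)" "ck * (1 * K x0) \<le> ck * (t powr q * K x0)"
      using c A0 mult_right_mono_neg[OF _ K[OF x0X], of "t powr q" 1]
      by (auto intro!: mult_strict_left_mono mult_strict_right_mono mult_left_mono)
    ultimately show False by simp
  qed
  have "0 < B x0" using equality A0 K[OF x0X] by linarith
  moreover have "A' x0 y = K' x0 y + B' x0 y" if y: "y \<in> X" for y
  proof (rule ccontr)
    define D where "D = A' x0 y - K' x0 y - B' x0 y"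
    assume "A' x0 y \<noteq> K' x0 y + B' x0 y"
    then have "D \<noteq> 0" by (simp add: D_def)
    define b where "b = - sgn D"
    have bD: "b * D = - \<bar>D\<bar>" by (simp add: b_def sgn_if)
    define E0 where "E0 = p * A x0 - q * K x0 - r * B x0"
    define Ey where "Ey = p * A' x0 y - q * K' x0 y - r * B' x0 y"
    have "E0 = - ((r - p) * A x0) + (r - q) * K x0"
      using equality by (simp add: E0_def algebra_simps)
    moreover have "0 < (r - p) * A x0" using A0 exponents by simp
    moreover have "(r - q) * K x0 \<le> 0" using K[OF x0X] exponents by (intro mult_nonneg_nonpos) auto
    ultimately have E0: "E0 < 0" by linarith
    \<comment> \<open>With \<open>E0\<close> and \<open>Ey\<close> the derivatives of \<open>A - K - B\<close> in the directions of the minimizer and of \<open>y\<close>, the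
      coefficient \<open>a\<close> makes this derivative negative, but so small that \<open>F\<close> still decreases.\<close>
    define a where "a = (- (r * \<bar>D\<bar> / 2) - b * Ey) / E0"
    have aE: "a * E0 + b * Ey = - (r * \<bar>D\<bar> / 2)" using E0 by (simp add: a_def)
    define z where "z = comb a x0 b y"
    have z: "z \<in> X" unfolding z_def by (rule comb_in[OF x0X y])
    have lin: "A' x0 z = a * A x0 + b * A' x0 y" "K' x0 z = a * K x0 + b * K' x0 y" "B' x0 z = a * B x0 + b * B' x0 y"
      unfolding z_def by (rule linear[OF x0X y])+
    have Gz: "p * A' x0 z - q * K' x0 z - r * B' x0 z = - (r * \<bar>D\<bar> / 2)"
      unfolding aE[symmetric] E0_def Ey_def lin by (simp add: algebra_simps)
    have "A' x0 z - K' x0 z - B' x0 z = a * (A x0 - K x0 - B x0) + b * D"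
      unfolding lin D_def by (simp add: algebra_simps)
    then have Jz: "A' x0 z - K' x0 z - B' x0 z = - \<bar>D\<bar>" using equality bD by simp
    have "ca * (p * A' x0 z) - ck * (q * K' x0 z) = (A' x0 z - K' x0 z - B' x0 z) - (p * A' x0 z - q * K' x0 z - r * B' x0 z) / r"
      using pos by (simp add: ca_def ck_def field_simps)
    then have Fz: "ca * (p * A' x0 z) - ck * (q * K' x0 z) = - (\<bar>D\<bar> / 2)"
      unfolding Gz Jz using pos by simp
    have "((\<lambda>t. F (comb 1 x0 t z)) has_real_derivative ca * (p * A' x0 z) - ck * (q * K' x0 z)) (at 0)"
      unfolding F_def by (intro DERIV_diff DERIV_cmult deriv x0X z)
    then obtain d1 where d1: "d1 > 0" "\<And>t. 0 < t \<Longrightarrow> t < d1 \<Longrightarrow> F (comb 1 x0 (0 + t) z) < F (comb 1 x0 0 z)"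
      using DERIV_neg_dec_right[of "\<lambda>t. F (comb 1 x0 t z)"] Fz \<open>D \<noteq> 0\<close> by (metis half_gt_zero neg_less_0_iff_less zero_less_abs_iff)
    have "((\<lambda>t. A (comb 1 x0 t z) - K (comb 1 x0 t z) - B (comb 1 x0 t z)) has_real_derivative
        p * A' x0 z - q * K' x0 z - r * B' x0 z) (at 0)"
      by (intro DERIV_diff deriv x0X z)
    moreover have "p * A' x0 z - q * K' x0 z - r * B' x0 z < 0" unfolding Gz using pos \<open>D \<noteq> 0\<close> by simp
    ultimately have "\<exists>d>0. \<forall>t>0. t < d \<longrightarrow>
        A (comb 1 x0 (0 + t) z) - K (comb 1 x0 (0 + t) z) - B (comb 1 x0 (0 + t) z) < A (comb 1 x0 0 z) - K (comb 1 x0 0 z) - B (comb 1 x0 0 z)"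
      by (rule DERIV_neg_dec_right)
    then obtain d2 where d2: "d2 > 0" "\<And>t. 0 < t \<Longrightarrow> t < d2 \<Longrightarrow>
        A (comb 1 x0 (0 + t) z) - K (comb 1 x0 (0 + t) z) - B (comb 1 x0 (0 + t) z) < A (comb 1 x0 0 z) - K (comb 1 x0 0 z) - B (comb 1 x0 0 z)"
      by blast
    have "isCont (\<lambda>t. A (comb 1 x0 t z)) 0" using deriv(1)[OF x0X z] by (rule DERIV_isCont)
    then have "((\<lambda>t. A (comb 1 x0 t z)) \<longlongrightarrow> A x0) (nhds 0)" using tendsto_at_iff_tendsto_nhds[of "\<lambda>t. A (comb 1 x0 t z)" 0]
      by (simp add: isCont_def comb_1_0)
    then have "\<forall>\<^sub>F t in nhds 0. 0 < A (comb 1 x0 t z)" using A0 by (rule order_tendstoD(1))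
    then obtain d3 where d3: "d3 > 0" "\<And>t. dist t 0 < d3 \<Longrightarrow> 0 < A (comb 1 x0 t z)"
      by (auto simp: eventually_nhds_metric)
    define t where "t = min (min d1 d2) d3 / 2"
    have t: "0 < t" "t < d1" "t < d2" "t < d3" using d1(1) d2(1) d3(1) by (auto simp: t_def min_def)
    have "comb 1 x0 t z \<in> C"
      using d2(2)[OF t(1,3)] d3(2)[of t] t comb_in[OF x0X z] equality by (simp add: C_def comb_1_0 dist_real_def)
    then have "F x0 \<le> F (comb 1 x0 t z)" by (rule x0(2))
    then show False using d1(2)[OF t(1,2)] by (simp add: comb_1_0)
  qed
  ultimately show ?thesis using x0X by blast
qed

theorem critical_point_exists:
  "\<exists>x\<in>X. (0 < K x \<or> 0 < B x) \<and> (\<forall>y\<in>X. A' x y = K' x y + B' x y)"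
  using critical_point_ball critical_point_Nehari by (meson not_less)

end

section \<open>Derivatives of power functionals\<close>

lemma abs_powr_pred_bound:
  fixes F G t \<rho> :: real
  assumes "1 < \<rho>" "\<bar>t\<bar> < 1"
  shows "\<bar>\<bar>F + t * G\<bar> powr (\<rho> - 2) * (F + t * G) * G\<bar> \<le> (\<bar>F\<bar> + \<bar>G\<bar>) powr \<rho>"
    and "\<bar>F + t * G\<bar> powr \<rho> \<le> (\<bar>F\<bar> + \<bar>G\<bar>) powr \<rho>"
proof -
  have "\<bar>t * G\<bar> \<le> 1 * \<bar>G\<bar>" unfolding abs_mult using assms by (intro mult_right_mono) auto
  then have le: "\<bar>F + t * G\<bar> \<le> \<bar>F\<bar> + \<bar>G\<bar>" by linarith
  then show "\<bar>F + t * G\<bar> powr \<rho> \<le> (\<bar>F\<bar> + \<bar>G\<bar>) powr \<rho>" using assms by (intro powr_mono2) auto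
  have "\<bar>\<bar>F + t * G\<bar> powr (\<rho> - 2) * (F + t * G) * G\<bar> = \<bar>F + t * G\<bar> powr (\<rho> - 1) * \<bar>G\<bar>"
    using abs_abs_powr_minus_2_times[of "F + t * G" \<rho>] by (simp add: abs_mult)
  also have "\<dots> \<le> (\<bar>F\<bar> + \<bar>G\<bar>) powr (\<rho> - 1) * (\<bar>F\<bar> + \<bar>G\<bar>) powr 1"
    using le assms by (intro mult_mono powr_mono2) auto
  also have "\<dots> = (\<bar>F\<bar> + \<bar>G\<bar>) powr \<rho>" unfolding powr_add[symmetric] by simp
  finally show "\<bar>\<bar>F + t * G\<bar> powr (\<rho> - 2) * (F + t * G) * G\<bar> \<le> (\<bar>F\<bar> + \<bar>G\<bar>) powr \<rho>" .
qed

lemma DERIV_abs_powr_line: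
  fixes F G t \<rho> :: real
  assumes "1 < \<rho>"
  shows "((\<lambda>t. \<bar>F + t * G\<bar> powr \<rho>) has_real_derivative \<rho> * (\<bar>F + t * G\<bar> powr (\<rho> - 2) * (F + t * G) * G)) (at t)"
proof -
  have "((\<lambda>t. F + t * G) has_real_derivative G) (at t)" by (auto intro!: derivative_eq_intros)
  from DERIV_chain2[OF DERIV_abs_powr[OF assms] this] show ?thesis by (simp add: mult.assoc)
qed

lemma
  fixes F G a :: "'a \<Rightarrow> real"
  assumes \<rho>: "1 < \<rho>" and m [measurable]: "a \<in> borel_measurable M" "F \<in> borel_measurable M" "G \<in> borel_measurable M"
    and int: "integrable M (\<lambda>x. \<bar>a x\<bar> * (\<bar>F x\<bar> + \<bar>G x\<bar>) powr \<rho>)"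
  shows DERIV_weighted_powr: "((\<lambda>t. \<integral>x. a x * \<bar>F x + t * G x\<bar> powr \<rho> \<partial>M) has_real_derivative
      \<rho> * (\<integral>x. a x * (\<bar>F x\<bar> powr (\<rho> - 2) * F x * G x) \<partial>M)) (at 0)"
    and integrable_weighted_powr_derivative: "integrable M (\<lambda>x. a x * (\<bar>F x\<bar> powr (\<rho> - 2) * F x * G x))"
proof -
  let ?H = "\<lambda>t x. a x * \<bar>F x + t * G x\<bar> powr \<rho>"
  let ?H' = "\<lambda>t x. \<rho> * (a x * (\<bar>F x + t * G x\<bar> powr (\<rho> - 2) * (F x + t * G x) * G x))"
  have 1: "integrable M (?H t)" if "\<bar>t\<bar> < 1" for t
    by (rule Bochner_Integration.integrable_bound[OF int])
      (use abs_powr_pred_bound(2)[OF \<rho> that] in \<open>auto simp: abs_mult intro!: AE_I2 mult_left_mono\<close>)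
  have 2: "((\<lambda>t. ?H t x) has_real_derivative ?H' t x) (at t)" for t x
    using DERIV_cmult[OF DERIV_abs_powr_line[OF \<rho>], of "a x" "F x" "G x" t] by (simp add: mult_ac)
  have 3: "\<bar>?H' t x\<bar> \<le> \<rho> * (\<bar>a x\<bar> * (\<bar>F x\<bar> + \<bar>G x\<bar>) powr \<rho>)" if "\<bar>t\<bar> < 1" for t x
    using abs_powr_pred_bound(1)[OF \<rho> that, of "F x" "G x"] \<rho>
    by (simp only: abs_mult[of "\<rho>"] abs_mult[of "a x"]) (auto intro!: mult_left_mono)
  have 4: "?H' 0 \<in> borel_measurable M" by measurable
  have 5: "integrable M (\<lambda>x. \<rho> * (\<bar>a x\<bar> * (\<bar>F x\<bar> + \<bar>G x\<bar>) powr \<rho>))" using int by simp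
  note D = has_real_derivative_integral_at_0[of M ?H ?H', OF 1 2 3 5 4]
  show "((\<lambda>t. \<integral>x. a x * \<bar>F x + t * G x\<bar> powr \<rho> \<partial>M) has_real_derivative
      \<rho> * (\<integral>x. a x * (\<bar>F x\<bar> powr (\<rho> - 2) * F x * G x) \<partial>M)) (at 0)"
    using D(1) by simp
  show "integrable M (\<lambda>x. a x * (\<bar>F x\<bar> powr (\<rho> - 2) * F x * G x))"
    using D(2) \<rho> by simp
qed

lemma powr_mult_le_sum:
  fixes U V \<alpha> \<beta> :: real
  assumes "0 \<le> U" "0 \<le> V" "0 < \<alpha>" "0 < \<beta>"
  shows "U powr \<alpha> * V powr \<beta> \<le> U powr (\<alpha> + \<beta>) + V powr (\<alpha> + \<beta>)"
proof -
  define W where "W = max U V"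
  have "U powr \<alpha> * V powr \<beta> \<le> W powr \<alpha> * W powr \<beta>"
    using assms by (intro mult_mono powr_mono2) (auto simp: W_def)
  also have "\<dots> = W powr (\<alpha> + \<beta>)" by (simp add: powr_add)
  also have "\<dots> \<le> U powr (\<alpha> + \<beta>) + V powr (\<alpha> + \<beta>)" by (simp add: W_def max_def)
  finally show ?thesis .
qed

lemma
  fixes F G F2 G2 a :: "'a \<Rightarrow> real"
  assumes \<alpha>\<beta>: "1 < \<alpha>" "1 < \<beta>"
    and m [measurable]: "a \<in> borel_measurable M" "F \<in> borel_measurable M" "G \<in> borel_measurable M"
      "F2 \<in> borel_measurable M" "G2 \<in> borel_measurable M"
    and int: "integrable M (\<lambda>x. \<bar>a x\<bar> * ((\<bar>F x\<bar> + \<bar>G x\<bar>) powr (\<alpha> + \<beta>) + (\<bar>F2 x\<bar> + \<bar>G2 x\<bar>) powr (\<alpha> + \<beta>)))"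
  shows DERIV_product_powr: "((\<lambda>t. \<integral>x. a x * (\<bar>F x + t * G x\<bar> powr \<alpha> * \<bar>F2 x + t * G2 x\<bar> powr \<beta>) \<partial>M) has_real_derivative
      \<alpha> * (\<integral>x. a x * (\<bar>F x\<bar> powr (\<alpha> - 2) * F x * G x * \<bar>F2 x\<bar> powr \<beta>) \<partial>M)
      + \<beta> * (\<integral>x. a x * (\<bar>F x\<bar> powr \<alpha> * (\<bar>F2 x\<bar> powr (\<beta> - 2) * F2 x * G2 x)) \<partial>M)) (at 0)"
    and integrable_product_powr_derivative1: "integrable M (\<lambda>x. a x * (\<bar>F x\<bar> powr (\<alpha> - 2) * F x * G x * \<bar>F2 x\<bar> powr \<beta>))"
    and integrable_product_powr_derivative2: "integrable M (\<lambda>x. a x * (\<bar>F x\<bar> powr \<alpha> * (\<bar>F2 x\<bar> powr (\<beta> - 2) * F2 x * G2 x)))"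
proof -
  let ?W = "\<lambda>x. (\<bar>F x\<bar> + \<bar>G x\<bar>) powr (\<alpha> + \<beta>) + (\<bar>F2 x\<bar> + \<bar>G2 x\<bar>) powr (\<alpha> + \<beta>)"
  let ?P1 = "\<lambda>t x. \<bar>F x + t * G x\<bar> powr (\<alpha> - 2) * (F x + t * G x) * G x * \<bar>F2 x + t * G2 x\<bar> powr \<beta>"
  let ?P2 = "\<lambda>t x. \<bar>F x + t * G x\<bar> powr \<alpha> * (\<bar>F2 x + t * G2 x\<bar> powr (\<beta> - 2) * (F2 x + t * G2 x) * G2 x)"
  let ?H = "\<lambda>t x. a x * (\<bar>F x + t * G x\<bar> powr \<alpha> * \<bar>F2 x + t * G2 x\<bar> powr \<beta>)"
  let ?H' = "\<lambda>t x. \<alpha> * (a x * ?P1 t x) + \<beta> * (a x * ?P2 t x)"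
  have W: "(\<bar>F x\<bar> + \<bar>G x\<bar>) powr \<alpha> * (\<bar>F2 x\<bar> + \<bar>G2 x\<bar>) powr \<beta> \<le> ?W x" for x
    using powr_mult_le_sum \<alpha>\<beta> by simp
  have b0: "\<bar>\<bar>F x + t * G x\<bar> powr \<alpha> * \<bar>F2 x + t * G2 x\<bar> powr \<beta>\<bar> \<le> ?W x" if "\<bar>t\<bar> < 1" for t x
  proof -
    have "\<bar>F x + t * G x\<bar> powr \<alpha> * \<bar>F2 x + t * G2 x\<bar> powr \<beta> \<le> (\<bar>F x\<bar> + \<bar>G x\<bar>) powr \<alpha> * (\<bar>F2 x\<bar> + \<bar>G2 x\<bar>) powr \<beta>"
      using abs_powr_pred_bound(2)[OF \<alpha>\<beta>(1) that] abs_powr_pred_bound(2)[OF \<alpha>\<beta>(2) that] by (intro mult_mono) auto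
    then show ?thesis using W[of x] by simp
  qed
  have b1: "\<bar>?P1 t x\<bar> \<le> ?W x" if "\<bar>t\<bar> < 1" for t x
  proof -
    have "\<bar>?P1 t x\<bar> = \<bar>\<bar>F x + t * G x\<bar> powr (\<alpha> - 2) * (F x + t * G x) * G x\<bar> * \<bar>F2 x + t * G2 x\<bar> powr \<beta>"
      unfolding abs_mult[of _ "\<bar>F2 x + t * G2 x\<bar> powr \<beta>"] by simp
    also have "\<dots> \<le> (\<bar>F x\<bar> + \<bar>G x\<bar>) powr \<alpha> * (\<bar>F2 x\<bar> + \<bar>G2 x\<bar>) powr \<beta>"
      using abs_powr_pred_bound(1)[OF \<alpha>\<beta>(1) that] abs_powr_pred_bound(2)[OF \<alpha>\<beta>(2) that] by (intro mult_mono) auto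
    finally show ?thesis using W[of x] by simp
  qed
  have b2: "\<bar>?P2 t x\<bar> \<le> ?W x" if "\<bar>t\<bar> < 1" for t x
  proof -
    have "\<bar>?P2 t x\<bar> = \<bar>F x + t * G x\<bar> powr \<alpha> * \<bar>\<bar>F2 x + t * G2 x\<bar> powr (\<beta> - 2) * (F2 x + t * G2 x) * G2 x\<bar>"
      unfolding abs_mult[of "\<bar>F x + t * G x\<bar> powr \<alpha>"] by simp
    also have "\<dots> \<le> (\<bar>F x\<bar> + \<bar>G x\<bar>) powr \<alpha> * (\<bar>F2 x\<bar> + \<bar>G2 x\<bar>) powr \<beta>"
      using abs_powr_pred_bound(1)[OF \<alpha>\<beta>(2) that] abs_powr_pred_bound(2)[OF \<alpha>\<beta>(1) that] by (intro mult_mono) auto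
    finally show ?thesis using W[of x] by simp
  qed
  have bound: "integrable M (\<lambda>x. a x * P x)"
    if "\<And>x. \<bar>P x\<bar> \<le> ?W x" "P \<in> borel_measurable M" for P
    by (rule Bochner_Integration.integrable_bound[OF int])
      (use that in \<open>auto simp: abs_mult intro!: AE_I2 mult_left_mono intro: order_trans[OF _ abs_ge_self]\<close>)
  have 1: "integrable M (?H t)" if "\<bar>t\<bar> < 1" for t
    by (rule bound[OF b0[OF that]]) measurable
  have P1: "integrable M (\<lambda>x. a x * ?P1 0 x)" by (rule bound[OF b1]) (simp, measurable)
  have P2: "integrable M (\<lambda>x. a x * ?P2 0 x)" by (rule bound[OF b2]) (simp, measurable)
  show "integrable M (\<lambda>x. a x * (\<bar>F x\<bar> powr (\<alpha> - 2) * F x * G x * \<bar>F2 x\<bar> powr \<beta>))" using P1 by simp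
  show "integrable M (\<lambda>x. a x * (\<bar>F x\<bar> powr \<alpha> * (\<bar>F2 x\<bar> powr (\<beta> - 2) * F2 x * G2 x)))" using P2 by simp
  have 2: "((\<lambda>t. ?H t x) has_real_derivative ?H' t x) (at t)" for t x
    by (rule DERIV_cong[OF DERIV_cmult[OF DERIV_mult[OF DERIV_abs_powr_line[OF \<alpha>\<beta>(1)] DERIV_abs_powr_line[OF \<alpha>\<beta>(2)]]]])
      (simp add: algebra_simps)
  have 3: "\<bar>?H' t x\<bar> \<le> (\<alpha> + \<beta>) * (\<bar>a x\<bar> * ?W x)" if "\<bar>t\<bar> < 1" for t x
  proof -
    have scaled: "\<bar>c * (a x * P)\<bar> \<le> c * (\<bar>a x\<bar> * Q)" if "0 \<le> c" "\<bar>P\<bar> \<le> Q" for c P Q :: real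
    proof -
      have "\<bar>c * (a x * P)\<bar> = c * (\<bar>a x\<bar> * \<bar>P\<bar>)" using that(1) by (simp add: abs_mult)
      also have "\<dots> \<le> c * (\<bar>a x\<bar> * Q)" by (intro mult_left_mono that abs_ge_zero)
      finally show ?thesis .
    qed
    have "\<bar>\<alpha> * (a x * ?P1 t x)\<bar> \<le> \<alpha> * (\<bar>a x\<bar> * ?W x)"
      by (rule scaled[OF _ b1[OF that]]) (use \<alpha>\<beta> in simp)
    moreover have "\<bar>\<beta> * (a x * ?P2 t x)\<bar> \<le> \<beta> * (\<bar>a x\<bar> * ?W x)"
      by (rule scaled[OF _ b2[OF that]]) (use \<alpha>\<beta> in simp)
    ultimately show ?thesis unfolding distrib_right[of \<alpha> \<beta>] by (intro order_trans[OF abs_triangle_ineq] add_mono)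
  qed
  have 4: "?H' 0 \<in> borel_measurable M" by measurable
  have 5: "integrable M (\<lambda>x. (\<alpha> + \<beta>) * (\<bar>a x\<bar> * ?W x))" using int by simp
  have "((\<lambda>t. \<integral>x. ?H t x \<partial>M) has_real_derivative (\<integral>x. ?H' 0 x \<partial>M)) (at 0)"
    by (rule has_real_derivative_integral_at_0(1)[of M ?H ?H', OF 1 2 3 5 4])
  moreover have "(\<integral>x. ?H' 0 x \<partial>M) = \<alpha> * (\<integral>x. a x * ?P1 0 x \<partial>M) + \<beta> * (\<integral>x. a x * ?P2 0 x \<partial>M)"
    using P1 P2 by simp
  ultimately show "((\<lambda>t. \<integral>x. a x * (\<bar>F x + t * G x\<bar> powr \<alpha> * \<bar>F2 x + t * G2 x\<bar> powr \<beta>) \<partial>M) has_real_derivative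
      \<alpha> * (\<integral>x. a x * (\<bar>F x\<bar> powr (\<alpha> - 2) * F x * G x * \<bar>F2 x\<bar> powr \<beta>) \<partial>M)
      + \<beta> * (\<integral>x. a x * (\<bar>F x\<bar> powr \<alpha> * (\<bar>F2 x\<bar> powr (\<beta> - 2) * F2 x * G2 x)) \<partial>M)) (at 0)"
    by simp
qed

section \<open>The threshold on the parameters\<close>

text \<open>Hoelder's inequality on a two-point space.\<close>

lemma Holder_two_terms:
  fixes a b x y \<theta> :: real
  assumes \<theta>: "0 < \<theta>" "\<theta> < 1" and nn: "0 \<le> a" "0 \<le> b" "0 \<le> x" "0 \<le> y"
  shows "a * x powr \<theta> + b * y powr \<theta>
    \<le> (a powr (1 / (1 - \<theta>)) + b powr (1 / (1 - \<theta>))) powr (1 - \<theta>) * (x + y) powr \<theta>"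
proof -
  define P where "P = 1 / (1 - \<theta>)"
  define N where "N = a powr P + b powr P"
  define Z where "Z = x + y"
  show ?thesis
  proof (cases "N = 0 \<or> Z = 0")
    case True
    then show ?thesis
    proof
      assume "N = 0"
      then have "a powr P = 0 \<and> b powr P = 0"
        unfolding N_def by (simp only: add_nonneg_eq_0_iff powr_ge_zero)
      then show ?thesis by simp
    next
      assume "Z = 0"
      then have "x = 0" "y = 0" using nn by (auto simp: Z_def)
      then show ?thesis by simp
    qed
  next
    case False
    then have NZ: "0 < N" "0 < Z" using nn by (auto simp: N_def Z_def less_le)
    have piece: "c * z powr \<theta> \<le> ((1 - \<theta>) * (c powr P / N) + \<theta> * (z / Z)) * (N powr (1 - \<theta>) * Z powr \<theta>)"
      if "0 \<le> c" "0 \<le> z" for c z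
    proof (cases "c = 0 \<or> z = 0")
      case True
      have "0 \<le> ((1 - \<theta>) * (c powr P / N) + \<theta> * (z / Z)) * (N powr (1 - \<theta>) * Z powr \<theta>)"
        using \<theta> NZ that by (intro mult_nonneg_nonneg add_nonneg_nonneg) auto
      then show ?thesis using True by auto
    next
      case False
      then have cz: "0 < c" "0 < z" using that by auto
      have "(c powr P / N) powr (1 - \<theta>) * (z / Z) powr \<theta> \<le> (1 - \<theta>) * (c powr P / N) + \<theta> * (z / Z)"
        using \<theta> cz NZ by (intro Youngs_inequality_0) auto
      moreover have "(c powr P / N) powr (1 - \<theta>) * (z / Z) powr \<theta> = c * z powr \<theta> / (N powr (1 - \<theta>) * Z powr \<theta>)"
        using \<theta> cz by (simp add: powr_divide powr_powr P_def)
      moreover have "0 < N powr (1 - \<theta>) * Z powr \<theta>" using NZ by simp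
      ultimately show ?thesis by (simp add: pos_divide_le_eq)
    qed
    have "a * x powr \<theta> + b * y powr \<theta> \<le> ((1 - \<theta>) * (a powr P / N) + \<theta> * (x / Z)) * (N powr (1 - \<theta>) * Z powr \<theta>)
       + ((1 - \<theta>) * (b powr P / N) + \<theta> * (y / Z)) * (N powr (1 - \<theta>) * Z powr \<theta>)"
      using piece nn by (intro add_mono) auto
    also have "\<dots> = ((1 - \<theta>) * ((a powr P + b powr P) / N) + \<theta> * ((x + y) / Z)) * (N powr (1 - \<theta>) * Z powr \<theta>)"
      by (simp add: add_divide_distrib algebra_simps)
    also have "\<dots> = N powr (1 - \<theta>) * Z powr \<theta>"
      using NZ unfolding N_def[symmetric] Z_def[symmetric] by simp
    finally show ?thesis by (simp add: N_def Z_def P_def)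
  qed
qed

text \<open>The constant in the definition of the parameter set is exactly what makes the radial
  derivative \<open>A - K - B\<close> positive on the sphere \<open>A = T\<close>, where \<open>T\<close> is the maximum point of
  \<open>T powr (1 - q / p) - 2 S powr (- r / p) T powr ((r - q) / p)\<close>.\<close>

lemma threshold_inequality:
  fixes p q r S N :: real
  assumes e: "1 < q" "q < p" "p < r" and S: "0 < S" and N: "0 \<le> N"
    and less: "N < ((p - q) / (2 * (r - q)) * S powr (r / p)) powr (p / (r - p)) *
      (S powr (- q / p) * ((r - q) / (r - p))) powr (- (p / (p - q)))"
  defines "T \<equiv> ((p - q) / (2 * (r - q)) * S powr (r / p)) powr (p / (r - p))"
  shows "0 < T" "S powr (- q / p) * N powr ((p - q) / p) * T powr (q / p) + 2 * S powr (- r / p) * T powr (r / p) < T"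
proof -
  have pos: "0 < p" "0 < q" "0 < r" "0 < r - q" "0 < r - p" "0 < p - q" using e by auto
  define b where "b = (p - q) / (2 * (r - q)) * S powr (r / p)"
  have b: "0 < b" using pos S by (simp add: b_def)
  have Tb: "T = b powr (p / (r - p))" by (simp add: T_def b_def)
  show T: "0 < T" using b by (simp add: Tb)
  define c where "c = S powr (- q / p) * ((r - q) / (r - p))"
  have c: "0 < c" using pos S by (simp add: c_def)
  have "T powr ((r - p) / p) = b" using pos b by (simp add: Tb powr_powr)
  moreover have "T powr (r / p) = T powr ((r - p) / p) * T"
    using powr_add[of T "(r - p) / p" 1] T pos by (simp add: diff_divide_distrib)
  ultimately have "T powr (r / p) = b * T" by simp
  moreover have "2 * S powr (- r / p) * b = (p - q) / (r - q)"
  proof -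
    have "S powr (- r / p) * S powr (r / p) = 1" using S unfolding powr_add[symmetric] by simp
    moreover have "2 * S powr (- r / p) * b = 2 * ((p - q) / (2 * (r - q))) * (S powr (- r / p) * S powr (r / p))"
      by (simp only: b_def mult_ac)
    moreover have "2 * ((p - q) / (2 * (r - q))) = (p - q) / (r - q)"
      unfolding times_divide_eq_right by (rule mult_divide_mult_cancel_left) simp
    ultimately show ?thesis by (simp only: mult_1_right)
  qed
  ultimately have B: "2 * S powr (- r / p) * T powr (r / p) = (p - q) / (r - q) * T" by (simp add: mult.assoc[symmetric])
  have "N powr ((p - q) / p) < (T * c powr (- (p / (p - q)))) powr ((p - q) / p)"
    using N less pos by (intro powr_less_mono2) (auto simp: T_def c_def)
  also have "\<dots> = T powr ((p - q) / p) / c"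
  proof -
    have "- (p / (p - q)) * ((p - q) / p) = -1" using pos by (simp add: field_simps)
    then have "(c powr (- (p / (p - q)))) powr ((p - q) / p) = 1 / c"
      unfolding powr_powr using c by (simp add: powr_neg_one)
    then show ?thesis unfolding powr_mult by simp
  qed
  finally have "N powr ((p - q) / p) * c < T powr ((p - q) / p)" using c by (simp add: pos_less_divide_eq)
  then have "N powr ((p - q) / p) * c * T powr (q / p) < T powr ((p - q) / p) * T powr (q / p)"
    using T by (intro mult_strict_right_mono) auto
  also have "\<dots> = T" using T pos unfolding powr_add[symmetric] by (simp add: add_divide_distrib[symmetric])
  finally have "(S powr (- q / p) * N powr ((p - q) / p) * T powr (q / p)) * ((r - q) / (r - p)) < T"
    by (simp add: c_def mult_ac)
  then have "S powr (- q / p) * N powr ((p - q) / p) * T powr (q / p) < T / ((r - q) / (r - p))"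
    using pos by (subst pos_less_divide_eq) auto
  also have "T / ((r - q) / (r - p)) = (r - p) / (r - q) * T" by simp
  finally have "S powr (- q / p) * N powr ((p - q) / p) * T powr (q / p) + 2 * S powr (- r / p) * T powr (r / p)
      < (r - p) / (r - q) * T + (p - q) / (r - q) * T"
    unfolding B by simp
  also have "\<dots> = T"
  proof -
    have "(r - p) / (r - q) + (p - q) / (r - q) = 1" using pos by (simp add: add_divide_distrib[symmetric])
    then show ?thesis by (simp only: distrib_right[symmetric] mult_1_left)
  qed
  finally show "S powr (- q / p) * N powr ((p - q) / p) * T powr (q / p) + 2 * S powr (- r / p) * T powr (r / p) < T" .
qed

section \<open>The functionals of the system\<close>

lemma convergent_subsequence_of_pair:
  fixes a b :: "nat \<Rightarrow> real"
  assumes "\<And>k. 0 \<le> a k" "\<And>k. 0 \<le> b k" "\<And>k. a k + b k \<le> M"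
  obtains \<sigma> :: "nat \<Rightarrow> nat" and e1 e2 where "strict_mono \<sigma>" "(\<lambda>k. a (\<sigma> k)) \<longlonglongrightarrow> e1" "(\<lambda>k. b (\<sigma> k)) \<longlonglongrightarrow> e2"
proof -
  have "range (\<lambda>k. (a k, b k)) \<subseteq> cbox (0, 0) (M, M)"
  proof
    fix x assume "x \<in> range (\<lambda>k. (a k, b k))"
    then obtain k where "x = (a k, b k)" by blast
    then show "x \<in> cbox (0, 0) (M, M)"
      using assms(1)[of k] assms(2)[of k] assms(3)[of k] by (simp add: cbox_Pair_eq)
  qed
  then have "bounded (range (\<lambda>k. (a k, b k)))" using bounded_cbox bounded_subset by blast
  then obtain e and \<sigma> :: "nat \<Rightarrow> nat" where \<sigma>: "strict_mono \<sigma>" "((\<lambda>k. (a k, b k)) \<circ> \<sigma>) \<longlonglongrightarrow> e"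
    using bounded_imp_convergent_subsequence by blast
  have "(\<lambda>k. a (\<sigma> k)) \<longlonglongrightarrow> fst e" "(\<lambda>k. b (\<sigma> k)) \<longlonglongrightarrow> snd e"
    using tendsto_fst[OF \<sigma>(2)] tendsto_snd[OF \<sigma>(2)] by (simp_all add: comp_def)
  then show ?thesis using that \<sigma>(1) by blast
qed

definition pair_comb :: "real \<Rightarrow> ('a \<Rightarrow> real) \<times> ('a \<Rightarrow> real) \<Rightarrow> real \<Rightarrow> ('a \<Rightarrow> real) \<times> ('a \<Rightarrow> real) \<Rightarrow> ('a \<Rightarrow> real) \<times> ('a \<Rightarrow> real)" where
  "pair_comb a w b z = ((\<lambda>x. a * fst w x + b * fst z x), (\<lambda>x. a * snd w x + b * snd z x))"

text \<open>The Sobolev inequality is stated as a hypothesis with the constant \<open>S\<close>, so that the bounds below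
  carry the same constant as the set of admissible parameters. Here \<open>l\<close> and \<open>m\<close> stand for \<open>\<lambda>\<close> and \<open>\<mu>\<close>.\<close>

locale concave_convex_system = fractional_domain \<Omega> s p
  for \<Omega> :: "(real^'n) set" and s p :: real +
  fixes q \<alpha> \<beta> l m S :: real and f g h :: "real^'n \<Rightarrow> real"
  assumes q: "1 < q" "q < p" and \<alpha>\<beta>: "1 < \<alpha>" "1 < \<beta>" "p < \<alpha> + \<beta>"
    and gap: "0 < sobolev_gap CARD('n) s p (\<alpha> + \<beta>)"
    and f: "f \<in> Lspace (lebesgue_on \<Omega>) (q_star \<alpha> \<beta> q)" and g: "g \<in> Lspace (lebesgue_on \<Omega>) (q_star \<alpha> \<beta> q)"
    and h: "h \<in> borel_measurable (lebesgue_on \<Omega>)" "\<And>x. x \<in> \<Omega> \<Longrightarrow> 0 \<le> h x" "\<And>x. x \<in> \<Omega> \<Longrightarrow> h x \<le> 1"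
    and S: "0 < S"
    and Sobolev: "\<And>u. u \<in> X0_space s p \<Omega> \<Longrightarrow> u \<in> Lspace (lebesgue_on \<Omega>) (\<alpha> + \<beta>)"
      "\<And>u. u \<in> X0_space s p \<Omega> \<Longrightarrow> (\<integral>x. \<bar>u x\<bar> powr (\<alpha> + \<beta>) \<partial>lebesgue_on \<Omega>)
         \<le> S powr (- (\<alpha> + \<beta>) / p) * energy s p \<Omega> u powr ((\<alpha> + \<beta>) / p)"
    and h_active: "\<exists>w\<in>X0_space s p \<Omega>. 0 < (\<integral>x. h x * (\<bar>w x\<bar> powr \<alpha> * \<bar>w x\<bar> powr \<beta>) \<partial>lebesgue_on \<Omega>)"
begin

abbreviation "r \<equiv> \<alpha> + \<beta>"

definition "Nf = (\<integral>x. \<bar>f x\<bar> powr q_star \<alpha> \<beta> q \<partial>L) powr (1 / q_star \<alpha> \<beta> q)"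
definition "Ng = (\<integral>x. \<bar>g x\<bar> powr q_star \<alpha> \<beta> q \<partial>L) powr (1 / q_star \<alpha> \<beta> q)"
definition "N = (\<bar>l\<bar> * Nf) powr (p / (p - q)) + (\<bar>m\<bar> * Ng) powr (p / (p - q))"

definition "A w = E (fst w) + E (snd w)"
definition "K w = (\<integral>x. l * f x * \<bar>fst w x\<bar> powr q \<partial>L) + (\<integral>x. m * g x * \<bar>snd w x\<bar> powr q \<partial>L)"
definition "B w = 2 * (\<integral>x. h x * (\<bar>fst w x\<bar> powr \<alpha> * \<bar>snd w x\<bar> powr \<beta>) \<partial>L)"

definition "A' w z = (\<integral>y. \<bar>diff2 (fst w) y\<bar> powr (p - 2) * diff2 (fst w) y * diff2 (fst z) y \<partial>G)
  + (\<integral>y. \<bar>diff2 (snd w) y\<bar> powr (p - 2) * diff2 (snd w) y * diff2 (snd z) y \<partial>G)"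
definition "K' w z = (\<integral>x. l * f x * (\<bar>fst w x\<bar> powr (q - 2) * fst w x * fst z x) \<partial>L)
  + (\<integral>x. m * g x * (\<bar>snd w x\<bar> powr (q - 2) * snd w x * snd z x) \<partial>L)"
definition "B' w z = 2 * \<alpha> / r * (\<integral>x. h x * (\<bar>fst w x\<bar> powr (\<alpha> - 2) * fst w x * fst z x * \<bar>snd w x\<bar> powr \<beta>) \<partial>L)
  + 2 * \<beta> / r * (\<integral>x. h x * (\<bar>fst w x\<bar> powr \<alpha> * (\<bar>snd w x\<bar> powr (\<beta> - 2) * snd w x * snd z x)) \<partial>L)"

lemma r_gt: "1 < r" "0 < r" "q < r" "p < r"
  using q \<alpha>\<beta> p_gt_1 by auto

lemma Holder_weight:
  assumes a: "a \<in> Lspace L (q_star \<alpha> \<beta> q)" and w: "w \<in> Lspace L r"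
  shows "integrable L (\<lambda>x. a x * \<bar>w x\<bar> powr q)"
    and "(\<integral>x. \<bar>a x * \<bar>w x\<bar> powr q\<bar> \<partial>L)
      \<le> (\<integral>x. \<bar>a x\<bar> powr q_star \<alpha> \<beta> q \<partial>L) powr (1 / q_star \<alpha> \<beta> q) * (\<integral>x. \<bar>w x\<bar> powr r \<partial>L) powr (q / r)"
proof -
  have e: "1 < q_star \<alpha> \<beta> q" "1 < r / q" "1 / q_star \<alpha> \<beta> q + 1 / (r / q) = 1"
  proof -
    show "1 < q_star \<alpha> \<beta> q" "1 < r / q" using r_gt q by (auto simp: q_star_def)
    have "1 / q_star \<alpha> \<beta> q + 1 / (r / q) = (r - q) / r + q / r" by (simp add: q_star_def)
    also have "\<dots> = r / r" by (simp only: add_divide_distrib[symmetric] diff_add_cancel)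
    also have "\<dots> = 1" using r_gt by simp
    finally show "1 / q_star \<alpha> \<beta> q + 1 / (r / q) = 1" .
  qed
  have pw: "\<bar>\<bar>w x\<bar> powr q\<bar> powr (r / q) = \<bar>w x\<bar> powr r" for x using q by (simp add: powr_powr)
  have wq: "(\<lambda>x. \<bar>w x\<bar> powr q) \<in> Lspace L (r / q)"
    using q by (intro Lspace_powr[OF w]) auto
  show "integrable L (\<lambda>x. a x * \<bar>w x\<bar> powr q)" by (rule Holder_integral(1)[OF a wq e])
  show "(\<integral>x. \<bar>a x * \<bar>w x\<bar> powr q\<bar> \<partial>L)
      \<le> (\<integral>x. \<bar>a x\<bar> powr q_star \<alpha> \<beta> q \<partial>L) powr (1 / q_star \<alpha> \<beta> q) * (\<integral>x. \<bar>w x\<bar> powr r \<partial>L) powr (q / r)"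
    using Holder_integral(2)[OF a wq e] unfolding pw by simp
qed

lemma Sobolev_power:
  assumes u: "u \<in> X0" and c: "0 < c"
  shows "(\<integral>x. \<bar>u x\<bar> powr r \<partial>L) powr (c / r) \<le> S powr (- c / p) * E u powr (c / p)"
proof -
  have "(\<integral>x. \<bar>u x\<bar> powr r \<partial>L) powr (c / r) \<le> (S powr (- r / p) * E u powr (r / p)) powr (c / r)"
    using Sobolev(2)[OF u] c r_gt by (intro powr_mono2) auto
  also have "\<dots> = S powr (- c / p) * E u powr (c / p)"
  proof -
    have "R / p * (c / R) = c / p" "- R / p * (c / R) = - c / p" if "R \<noteq> 0" for R :: real
      using that by (simp_all add: field_simps)
    from this[of r] show ?thesis using r_gt by (simp only: powr_mult powr_powr)
  qed
  finally show ?thesis .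
qed

lemma weight_term_le:
  assumes a: "a \<in> Lspace L (q_star \<alpha> \<beta> q)" and u: "u \<in> X0"
  shows "(\<integral>x. c * a x * \<bar>u x\<bar> powr q \<partial>L)
    \<le> S powr (- q / p) * (\<bar>c\<bar> * (\<integral>x. \<bar>a x\<bar> powr q_star \<alpha> \<beta> q \<partial>L) powr (1 / q_star \<alpha> \<beta> q) * E u powr (q / p))"
proof -
  let ?n = "(\<integral>x. \<bar>a x\<bar> powr q_star \<alpha> \<beta> q \<partial>L) powr (1 / q_star \<alpha> \<beta> q)"
  have "(\<integral>x. c * a x * \<bar>u x\<bar> powr q \<partial>L) = c * (\<integral>x. a x * \<bar>u x\<bar> powr q \<partial>L)"
    by (simp add: mult.assoc)
  also have "\<dots> \<le> \<bar>c\<bar> * \<bar>\<integral>x. a x * \<bar>u x\<bar> powr q \<partial>L\<bar>"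
    using abs_ge_self[of "c * (\<integral>x. a x * \<bar>u x\<bar> powr q \<partial>L)"] by (simp add: abs_mult)
  also have "\<dots> \<le> \<bar>c\<bar> * (\<integral>x. \<bar>a x * \<bar>u x\<bar> powr q\<bar> \<partial>L)"
    using integral_norm_bound[of L "\<lambda>x. a x * \<bar>u x\<bar> powr q"] by (intro mult_left_mono) auto
  also have "\<dots> \<le> \<bar>c\<bar> * (?n * (\<integral>x. \<bar>u x\<bar> powr r \<partial>L) powr (q / r))"
    by (intro mult_left_mono Holder_weight(2)[OF a Sobolev(1)[OF u]]) auto
  also have "\<dots> \<le> \<bar>c\<bar> * (?n * (S powr (- q / p) * E u powr (q / p)))"
    using q by (intro mult_left_mono Sobolev_power[OF u]) auto
  finally show ?thesis by (simp only: mult_ac)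
qed

lemma K_growth:
  assumes w: "fst w \<in> X0" "snd w \<in> X0"
  shows "K w \<le> S powr (- q / p) * N powr ((p - q) / p) * A w powr (q / p)"
proof -
  have \<theta>: "0 < q / p" "q / p < 1" "1 / (1 - q / p) = p / (p - q)" "1 - q / p = (p - q) / p"
    using q by (auto simp: field_simps)
  have nn: "0 \<le> \<bar>l\<bar> * Nf" "0 \<le> \<bar>m\<bar> * Ng" by (auto simp: Nf_def Ng_def)
  have "K w \<le> S powr (- q / p) * (\<bar>l\<bar> * Nf * E (fst w) powr (q / p)) + S powr (- q / p) * (\<bar>m\<bar> * Ng * E (snd w) powr (q / p))"
    unfolding K_def Nf_def Ng_def by (intro add_mono weight_term_le f g w)
  also have "\<dots> = S powr (- q / p) * ((\<bar>l\<bar> * Nf) * E (fst w) powr (q / p) + (\<bar>m\<bar> * Ng) * E (snd w) powr (q / p))"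
    by (simp only: distrib_left)
  also have "\<dots> \<le> S powr (- q / p) * (N powr ((p - q) / p) * A w powr (q / p))"
    using Holder_two_terms[OF \<theta>(1,2) nn energy_nonneg energy_nonneg, of s p \<Omega> "fst w" s p \<Omega> "snd w"]
    unfolding \<theta>(3) \<theta>(4) by (intro mult_left_mono) (auto simp: N_def A_def)
  finally show ?thesis by (simp only: mult.assoc)
qed

lemma B_growth:
  assumes w: "fst w \<in> X0" "snd w \<in> X0"
  shows "B w \<le> 2 * S powr (- r / p) * A w powr (r / p)"
proof -
  let ?U = "\<lambda>x. \<bar>fst w x\<bar> powr \<alpha>" and ?V = "\<lambda>x. \<bar>snd w x\<bar> powr \<beta>"
  note u = Sobolev(1)[OF w(1)] and v = Sobolev(1)[OF w(2)]
  have e: "1 < r / \<alpha>" "1 < r / \<beta>" "1 / (r / \<alpha>) + 1 / (r / \<beta>) = 1"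
  proof -
    show "1 < r / \<alpha>" "1 < r / \<beta>" using \<alpha>\<beta> by auto
    have "1 / (R / \<alpha>) + 1 / (R / \<beta>) = r / R" for R
      by (simp add: add_divide_distrib)
    then have "1 / (r / \<alpha>) + 1 / (r / \<beta>) = r / r" .
    also have "\<dots> = 1" using r_gt by simp
    finally show "1 / (r / \<alpha>) + 1 / (r / \<beta>) = 1" .
  qed
  have pU: "\<bar>?U x\<bar> powr (r / \<alpha>) = \<bar>fst w x\<bar> powr r" and pV: "\<bar>?V x\<bar> powr (r / \<beta>) = \<bar>snd w x\<bar> powr r" for x
    using \<alpha>\<beta> by (simp_all add: powr_powr)
  have U: "?U \<in> Lspace L (r / \<alpha>)" using \<alpha>\<beta> by (intro Lspace_powr[OF u]) auto
  have V: "?V \<in> Lspace L (r / \<beta>)" using \<alpha>\<beta> by (intro Lspace_powr[OF v]) auto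
  note H = Holder_integral[OF U V e]
  have "(\<integral>x. h x * (?U x * ?V x) \<partial>L) \<le> (\<integral>x. \<bar>?U x * ?V x\<bar> \<partial>L)"
  proof (cases "integrable L (\<lambda>x. h x * (?U x * ?V x))")
    case True
    then show ?thesis
    proof (rule integral_mono)
      show "integrable L (\<lambda>x. \<bar>?U x * ?V x\<bar>)" using H(1) by simp
      fix x assume "x \<in> space L"
      then have "h x \<le> 1" using h(3) by simp
      then show "h x * (?U x * ?V x) \<le> \<bar>?U x * ?V x\<bar>" using mult_right_mono[of "h x" 1 "?U x * ?V x"] by simp
    qed
  qed (simp add: not_integrable_integral_eq)
  also have "\<dots> \<le> (\<integral>x. \<bar>fst w x\<bar> powr r \<partial>L) powr (\<alpha> / r) * (\<integral>x. \<bar>snd w x\<bar> powr r \<partial>L) powr (\<beta> / r)"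
    using H(2) unfolding pU pV by simp
  also have "\<dots> \<le> (S powr (- \<alpha> / p) * E (fst w) powr (\<alpha> / p)) * (S powr (- \<beta> / p) * E (snd w) powr (\<beta> / p))"
    using \<alpha>\<beta> by (intro mult_mono Sobolev_power w) auto
  also have "\<dots> \<le> (S powr (- \<alpha> / p) * A w powr (\<alpha> / p)) * (S powr (- \<beta> / p) * A w powr (\<beta> / p))"
  proof -
    have "E (fst w) powr (\<alpha> / p) \<le> A w powr (\<alpha> / p)" "E (snd w) powr (\<beta> / p) \<le> A w powr (\<beta> / p)"
      using \<alpha>\<beta> energy_nonneg[of s p \<Omega> "fst w"] energy_nonneg[of s p \<Omega> "snd w"]
      by (auto simp: A_def intro!: powr_mono2)
    then show ?thesis by (intro mult_mono order_refl) auto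
  qed
  also have "\<dots> = S powr (- r / p) * A w powr (r / p)"
  proof -
    have "- r / p = - \<alpha> / p + - \<beta> / p" "r / p = \<alpha> / p + \<beta> / p" by (simp_all add: field_simps)
    then show ?thesis by (simp only: powr_add mult_ac)
  qed
  finally show ?thesis unfolding B_def by simp
qed

lemma Lspace_majorant:
  assumes "u \<in> Lspace L r" "v \<in> Lspace L r"
  shows "(\<lambda>x. \<bar>u x\<bar> + \<bar>v x\<bar>) \<in> Lspace L r"
  using assms r_gt by (intro Lspace_add Lspace_abs) auto

lemma integrable_h_times:
  assumes "integrable L F"
  shows "integrable L (\<lambda>x. \<bar>h x\<bar> * F x)"
proof (rule Bochner_Integration.integrable_bound[OF assms])
  show "(\<lambda>x. \<bar>h x\<bar> * F x) \<in> borel_measurable L" using h(1) assms by measurable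
  show "AE x in L. norm (\<bar>h x\<bar> * F x) \<le> norm (F x)"
    using h(2,3) by (intro AE_I2) (auto simp: abs_mult intro!: mult_left_le_one_le)
qed

lemma DERIV_E:
  assumes u: "u \<in> X0" and v: "v \<in> X0"
  shows "((\<lambda>t. E (\<lambda>x. 1 * u x + t * v x)) has_real_derivative
      p * (\<integral>z. \<bar>diff2 u z\<bar> powr (p - 2) * diff2 u z * diff2 v z \<partial>G)) (at 0)"
    and "integrable G (\<lambda>z. \<bar>diff2 u z\<bar> powr (p - 2) * diff2 u z * diff2 v z)"
proof -
  note U = X0_diff2[OF u] and V = X0_diff2[OF v]
  have "(\<lambda>z. \<bar>diff2 u z\<bar> + \<bar>diff2 v z\<bar>) \<in> Lspace G p" using U V by (intro Lspace_add Lspace_abs) auto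
  from Lspace_integrable[OF this]
  have i: "integrable G (\<lambda>z. \<bar>1::real\<bar> * (\<bar>diff2 u z\<bar> + \<bar>diff2 v z\<bar>) powr p)"
    by simp
  have one: "(\<lambda>z. 1 :: real) \<in> borel_measurable G" by simp
  note D = DERIV_weighted_powr[OF p_gt_1 one Lspace_measurable[OF U] Lspace_measurable[OF V] i]
  show "((\<lambda>t. E (\<lambda>x. 1 * u x + t * v x)) has_real_derivative
      p * (\<integral>z. \<bar>diff2 u z\<bar> powr (p - 2) * diff2 u z * diff2 v z \<partial>G)) (at 0)"
    using D unfolding energy_def diff2_comb by simp
  show "integrable G (\<lambda>z. \<bar>diff2 u z\<bar> powr (p - 2) * diff2 u z * diff2 v z)"
    using integrable_weighted_powr_derivative[OF p_gt_1 one Lspace_measurable[OF U] Lspace_measurable[OF V] i] by simp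
qed

lemma DERIV_weight:
  assumes a: "a \<in> Lspace L (q_star \<alpha> \<beta> q)" and u: "u \<in> X0" and v: "v \<in> X0"
  shows "((\<lambda>t. \<integral>x. c * a x * \<bar>1 * u x + t * v x\<bar> powr q \<partial>L) has_real_derivative
      q * (\<integral>x. c * a x * (\<bar>u x\<bar> powr (q - 2) * u x * v x) \<partial>L)) (at 0)"
    and "integrable L (\<lambda>x. c * a x * (\<bar>u x\<bar> powr (q - 2) * u x * v x))"
proof -
  have ca: "(\<lambda>x. \<bar>c * a x\<bar>) \<in> Lspace L (q_star \<alpha> \<beta> q)" by (intro Lspace_abs Lspace_scale a)
  have i: "integrable L (\<lambda>x. \<bar>c * a x\<bar> * (\<bar>u x\<bar> + \<bar>v x\<bar>) powr q)"
    using Holder_weight(1)[OF ca Lspace_majorant[OF Sobolev(1)[OF u] Sobolev(1)[OF v]]] by simp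
  have m: "(\<lambda>x. c * a x) \<in> borel_measurable L" "u \<in> borel_measurable L" "v \<in> borel_measurable L"
    using Lspace_measurable[OF a] Lspace_measurable[OF Sobolev(1)] u v by auto
  show "((\<lambda>t. \<integral>x. c * a x * \<bar>1 * u x + t * v x\<bar> powr q \<partial>L) has_real_derivative
      q * (\<integral>x. c * a x * (\<bar>u x\<bar> powr (q - 2) * u x * v x) \<partial>L)) (at 0)"
    using DERIV_weighted_powr[OF q(1) m i] by simp
  show "integrable L (\<lambda>x. c * a x * (\<bar>u x\<bar> powr (q - 2) * u x * v x))"
    by (rule integrable_weighted_powr_derivative[OF q(1) m i])
qed

lemma DERIV_h:
  assumes u: "u \<in> X0" "v \<in> X0" and \<phi>: "\<phi> \<in> X0" "\<psi> \<in> X0"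
  shows "((\<lambda>t. \<integral>x. h x * (\<bar>1 * u x + t * \<phi> x\<bar> powr \<alpha> * \<bar>1 * v x + t * \<psi> x\<bar> powr \<beta>) \<partial>L) has_real_derivative
      \<alpha> * (\<integral>x. h x * (\<bar>u x\<bar> powr (\<alpha> - 2) * u x * \<phi> x * \<bar>v x\<bar> powr \<beta>) \<partial>L)
      + \<beta> * (\<integral>x. h x * (\<bar>u x\<bar> powr \<alpha> * (\<bar>v x\<bar> powr (\<beta> - 2) * v x * \<psi> x)) \<partial>L)) (at 0)"
    and "integrable L (\<lambda>x. h x * (\<bar>u x\<bar> powr (\<alpha> - 2) * u x * \<phi> x * \<bar>v x\<bar> powr \<beta>))"
    and "integrable L (\<lambda>x. h x * (\<bar>u x\<bar> powr \<alpha> * (\<bar>v x\<bar> powr (\<beta> - 2) * v x * \<psi> x)))"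
proof -
  note L = Sobolev(1)[OF u(1)] Sobolev(1)[OF \<phi>(1)] Sobolev(1)[OF u(2)] Sobolev(1)[OF \<phi>(2)]
  have "integrable L (\<lambda>x. (\<bar>u x\<bar> + \<bar>\<phi> x\<bar>) powr r + (\<bar>v x\<bar> + \<bar>\<psi> x\<bar>) powr r)"
    using Lspace_integrable[OF Lspace_majorant[OF L(1,2)]] Lspace_integrable[OF Lspace_majorant[OF L(3,4)]] by simp
  note i = integrable_h_times[OF this]
  note m = h(1) Lspace_measurable[OF L(1)] Lspace_measurable[OF L(2)] Lspace_measurable[OF L(3)] Lspace_measurable[OF L(4)]
  show "((\<lambda>t. \<integral>x. h x * (\<bar>1 * u x + t * \<phi> x\<bar> powr \<alpha> * \<bar>1 * v x + t * \<psi> x\<bar> powr \<beta>) \<partial>L) has_real_derivative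
      \<alpha> * (\<integral>x. h x * (\<bar>u x\<bar> powr (\<alpha> - 2) * u x * \<phi> x * \<bar>v x\<bar> powr \<beta>) \<partial>L)
      + \<beta> * (\<integral>x. h x * (\<bar>u x\<bar> powr \<alpha> * (\<bar>v x\<bar> powr (\<beta> - 2) * v x * \<psi> x)) \<partial>L)) (at 0)"
    using DERIV_product_powr[OF \<alpha>\<beta>(1,2) m i] by simp
  show "integrable L (\<lambda>x. h x * (\<bar>u x\<bar> powr (\<alpha> - 2) * u x * \<phi> x * \<bar>v x\<bar> powr \<beta>))"
    by (rule integrable_product_powr_derivative1[OF \<alpha>\<beta>(1,2) m i])
  show "integrable L (\<lambda>x. h x * (\<bar>u x\<bar> powr \<alpha> * (\<bar>v x\<bar> powr (\<beta> - 2) * v x * \<psi> x)))"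
    by (rule integrable_product_powr_derivative2[OF \<alpha>\<beta>(1,2) m i])
qed

lemma A'_linear:
  assumes w: "fst w \<in> X0" "snd w \<in> X0" and z: "fst z \<in> X0" "snd z \<in> X0"
  shows "A' w (pair_comb a w b z) = a * A w + b * A' w z"
proof -
  have single: "(\<integral>y. \<bar>diff2 u y\<bar> powr (p - 2) * diff2 u y * diff2 (\<lambda>x. a * u x + b * v x) y \<partial>G)
      = a * E u + b * (\<integral>y. \<bar>diff2 u y\<bar> powr (p - 2) * diff2 u y * diff2 v y \<partial>G)"
    if "u \<in> X0" "v \<in> X0" for u v
    unfolding energy_def
  proof (rule integral_comb[OF Lspace_integrable[OF X0_diff2[OF that(1)]] DERIV_E(2)[OF that]])
    fix y
    show "\<bar>diff2 u y\<bar> powr (p - 2) * diff2 u y * diff2 (\<lambda>x. a * u x + b * v x) y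
        = a * \<bar>diff2 u y\<bar> powr p + b * (\<bar>diff2 u y\<bar> powr (p - 2) * diff2 u y * diff2 v y)"
      unfolding diff2_comb abs_powr_minus_2_times[of "diff2 u y" p, symmetric] by (simp add: algebra_simps)
  qed
  show ?thesis
    unfolding A'_def A_def pair_comb_def fst_conv snd_conv single[OF w(1) z(1)] single[OF w(2) z(2)]
    by (simp add: algebra_simps)
qed

lemma K'_linear:
  assumes w: "fst w \<in> X0" "snd w \<in> X0" and z: "fst z \<in> X0" "snd z \<in> X0"
  shows "K' w (pair_comb a w b z) = a * K w + b * K' w z"
proof -
  have single: "(\<integral>x. c * e x * (\<bar>u x\<bar> powr (q - 2) * u x * (a * u x + b * v x)) \<partial>L)
      = a * (\<integral>x. c * e x * \<bar>u x\<bar> powr q \<partial>L) + b * (\<integral>x. c * e x * (\<bar>u x\<bar> powr (q - 2) * u x * v x) \<partial>L)"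
    if "u \<in> X0" "v \<in> X0" "e \<in> Lspace L (q_star \<alpha> \<beta> q)" for u v e c
  proof (rule integral_comb[OF _ DERIV_weight(2)[OF that(3,1,2)]])
    show "integrable L (\<lambda>x. c * e x * \<bar>u x\<bar> powr q)"
      by (rule Holder_weight(1)[OF Lspace_scale[OF that(3)] Sobolev(1)[OF that(1)]])
    fix x
    show "c * e x * (\<bar>u x\<bar> powr (q - 2) * u x * (a * u x + b * v x))
        = a * (c * e x * \<bar>u x\<bar> powr q) + b * (c * e x * (\<bar>u x\<bar> powr (q - 2) * u x * v x))"
      unfolding abs_powr_minus_2_times[of "u x" q, symmetric] by (simp add: algebra_simps)
  qed
  show ?thesis
    unfolding K'_def K_def pair_comb_def fst_conv snd_conv single[OF w(1) z(1) f] single[OF w(2) z(2) g]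
    by (simp add: algebra_simps)
qed

lemma integrable_h_term:
  assumes "u \<in> X0" "v \<in> X0"
  shows "integrable L (\<lambda>x. h x * (\<bar>u x\<bar> powr \<alpha> * \<bar>v x\<bar> powr \<beta>))"
  using DERIV_h(3)[OF assms assms] unfolding abs_powr_minus_2_times .

lemma B'_linear:
  assumes w: "fst w \<in> X0" "snd w \<in> X0" and z: "fst z \<in> X0" "snd z \<in> X0"
  shows "B' w (pair_comb a w b z) = a * B w + b * B' w z"
proof -
  let ?I = "\<integral>x. h x * (\<bar>fst w x\<bar> powr \<alpha> * \<bar>snd w x\<bar> powr \<beta>) \<partial>L"
  have 1: "(\<integral>x. h x * (\<bar>fst w x\<bar> powr (\<alpha> - 2) * fst w x * (a * fst w x + b * fst z x) * \<bar>snd w x\<bar> powr \<beta>) \<partial>L)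
     = a * ?I + b * (\<integral>x. h x * (\<bar>fst w x\<bar> powr (\<alpha> - 2) * fst w x * fst z x * \<bar>snd w x\<bar> powr \<beta>) \<partial>L)"
  proof (rule integral_comb[OF integrable_h_term[OF w] DERIV_h(2)[OF w z]])
    fix x
    show "h x * (\<bar>fst w x\<bar> powr (\<alpha> - 2) * fst w x * (a * fst w x + b * fst z x) * \<bar>snd w x\<bar> powr \<beta>)
        = a * (h x * (\<bar>fst w x\<bar> powr \<alpha> * \<bar>snd w x\<bar> powr \<beta>)) + b * (h x * (\<bar>fst w x\<bar> powr (\<alpha> - 2) * fst w x * fst z x * \<bar>snd w x\<bar> powr \<beta>))"
      unfolding abs_powr_minus_2_times[of "fst w x" \<alpha>, symmetric] by (simp add: algebra_simps)
  qed
  have 2: "(\<integral>x. h x * (\<bar>fst w x\<bar> powr \<alpha> * (\<bar>snd w x\<bar> powr (\<beta> - 2) * snd w x * (a * snd w x + b * snd z x))) \<partial>L)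
     = a * ?I + b * (\<integral>x. h x * (\<bar>fst w x\<bar> powr \<alpha> * (\<bar>snd w x\<bar> powr (\<beta> - 2) * snd w x * snd z x)) \<partial>L)"
  proof (rule integral_comb[OF integrable_h_term[OF w] DERIV_h(3)[OF w z]])
    fix x
    show "h x * (\<bar>fst w x\<bar> powr \<alpha> * (\<bar>snd w x\<bar> powr (\<beta> - 2) * snd w x * (a * snd w x + b * snd z x)))
        = a * (h x * (\<bar>fst w x\<bar> powr \<alpha> * \<bar>snd w x\<bar> powr \<beta>)) + b * (h x * (\<bar>fst w x\<bar> powr \<alpha> * (\<bar>snd w x\<bar> powr (\<beta> - 2) * snd w x * snd z x)))"
      unfolding abs_powr_minus_2_times[of "snd w x" \<beta>, symmetric] by (simp add: algebra_simps)
  qed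
  have s: "2 * \<alpha> / r * (a * I + b * x) + 2 * \<beta> / r * (a * I + b * y) = a * (2 * I) + b * (2 * \<alpha> / r * x + 2 * \<beta> / r * y)" for I x y
  proof -
    have "2 * \<alpha> / r + 2 * \<beta> / r = 2" using r_gt by (simp add: add_divide_distrib[symmetric] distrib_left[symmetric] del: distrib_left_numeral)
    then have "(2 * \<alpha> / r + 2 * \<beta> / r) * (a * I) = 2 * (a * I)" by simp
    then show ?thesis by (simp only: distrib_left distrib_right mult_ac add_ac)
  qed
  show ?thesis
    unfolding B'_def B_def pair_comb_def fst_conv snd_conv 1 2 by (rule s)
qed

lemma X0_Lp_bound:
  assumes "u \<in> X0" "E u \<le> M"
  shows "(\<integral>x. \<bar>u x\<bar> powr p \<partial>L) \<le> measure lebesgue \<Omega> + S powr (- r / p) * \<bar>M\<bar> powr (r / p)"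
proof -
  interpret F: finite_measure L by (rule finite_measure_domain)
  have "(\<integral>x. \<bar>u x\<bar> powr p \<partial>L) \<le> (\<integral>x. 1 + \<bar>u x\<bar> powr r \<partial>L)"
    using Lspace_integrable[OF X0_Lspace[OF assms(1)]] Lspace_integrable[OF Sobolev(1)[OF assms(1)]]
      abs_powr_le_1_plus[of p r] r_gt by (intro integral_mono) auto
  also have "\<dots> = measure lebesgue \<Omega> + (\<integral>x. \<bar>u x\<bar> powr r \<partial>L)"
    using Lspace_integrable[OF Sobolev(1)[OF assms(1)]] by (simp add: measure_restrict_space)
  also have "(\<integral>x. \<bar>u x\<bar> powr r \<partial>L) \<le> S powr (- r / p) * E u powr (r / p)" by (rule Sobolev(2)[OF assms(1)])
  also have "\<dots> \<le> S powr (- r / p) * \<bar>M\<bar> powr (r / p)"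
    using assms(2) energy_nonneg[of s p \<Omega> u] r_gt by (intro mult_left_mono powr_mono2) auto
  finally show ?thesis by simp
qed

lemma weight_term_tendsto:
  assumes a: "a \<in> Lspace L (q_star \<alpha> \<beta> q)" and w: "\<And>k. w k \<in> X0" and W: "W \<in> Lspace L r" "\<And>x. 0 \<le> W x"
    and le: "AE x in L. \<forall>k. \<bar>w k x\<bar> \<le> W x" and lim: "AE x in L. (\<lambda>k. w k x) \<longlonglongrightarrow> u x" and u: "u \<in> X0"
  shows "(\<lambda>k. \<integral>x. c * a x * \<bar>w k x\<bar> powr q \<partial>L) \<longlonglongrightarrow> (\<integral>x. c * a x * \<bar>u x\<bar> powr q \<partial>L)"
proof (rule integral_dominated_convergence[where w = "\<lambda>x. \<bar>c * a x\<bar> * \<bar>W x\<bar> powr q"])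
  note [measurable] = Lspace_measurable[OF a] Lspace_measurable[OF Sobolev(1)[OF w]] Lspace_measurable[OF Sobolev(1)[OF u]]
  show "(\<lambda>x. c * a x * \<bar>u x\<bar> powr q) \<in> borel_measurable L" "(\<lambda>x. c * a x * \<bar>w k x\<bar> powr q) \<in> borel_measurable L" for k
    by measurable
  show "integrable L (\<lambda>x. \<bar>c * a x\<bar> * \<bar>W x\<bar> powr q)"
    by (rule Holder_weight(1)[OF Lspace_abs[OF Lspace_scale[OF a]] W(1)])
  show "AE x in L. (\<lambda>k. c * a x * \<bar>w k x\<bar> powr q) \<longlonglongrightarrow> c * a x * \<bar>u x\<bar> powr q"
    using lim by eventually_elim (use q in \<open>auto intro!: tendsto_intros tendsto_powr'\<close>)
  show "AE x in L. norm (c * a x * \<bar>w k x\<bar> powr q) \<le> \<bar>c * a x\<bar> * \<bar>W x\<bar> powr q" for k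
    using le
  proof eventually_elim
    case (elim x)
    have "\<bar>w k x\<bar> powr q \<le> \<bar>W x\<bar> powr q" using elim W(2)[of x] q by (intro powr_mono2) auto
    then show ?case by (simp add: abs_mult mult_left_mono)
  qed
qed

lemma h_term_tendsto:
  assumes w: "\<And>k. w k \<in> X0" "\<And>k. v k \<in> X0" and W: "W \<in> Lspace L r" "\<And>x. 0 \<le> W x" "W2 \<in> Lspace L r" "\<And>x. 0 \<le> W2 x"
    and le: "AE x in L. \<forall>k. \<bar>w k x\<bar> \<le> W x" "AE x in L. \<forall>k. \<bar>v k x\<bar> \<le> W2 x"
    and lim: "AE x in L. (\<lambda>k. w k x) \<longlonglongrightarrow> u x" "AE x in L. (\<lambda>k. v k x) \<longlonglongrightarrow> u2 x" and u: "u \<in> X0" "u2 \<in> X0"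
  shows "(\<lambda>k. \<integral>x. h x * (\<bar>w k x\<bar> powr \<alpha> * \<bar>v k x\<bar> powr \<beta>) \<partial>L) \<longlonglongrightarrow> (\<integral>x. h x * (\<bar>u x\<bar> powr \<alpha> * \<bar>u2 x\<bar> powr \<beta>) \<partial>L)"
proof (rule integral_dominated_convergence[where w = "\<lambda>x. \<bar>h x\<bar> * (\<bar>W x\<bar> powr r + \<bar>W2 x\<bar> powr r)"])
  note [measurable] = h(1) Lspace_measurable[OF Sobolev(1)[OF w(1)]] Lspace_measurable[OF Sobolev(1)[OF w(2)]]
    Lspace_measurable[OF Sobolev(1)[OF u(1)]] Lspace_measurable[OF Sobolev(1)[OF u(2)]]
  show "(\<lambda>x. h x * (\<bar>u x\<bar> powr \<alpha> * \<bar>u2 x\<bar> powr \<beta>)) \<in> borel_measurable L"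
    "(\<lambda>x. h x * (\<bar>w k x\<bar> powr \<alpha> * \<bar>v k x\<bar> powr \<beta>)) \<in> borel_measurable L" for k
    by measurable
  show "integrable L (\<lambda>x. \<bar>h x\<bar> * (\<bar>W x\<bar> powr r + \<bar>W2 x\<bar> powr r))"
    using Lspace_integrable[OF W(1)] Lspace_integrable[OF W(3)] by (intro integrable_h_times) simp
  show "AE x in L. (\<lambda>k. h x * (\<bar>w k x\<bar> powr \<alpha> * \<bar>v k x\<bar> powr \<beta>)) \<longlonglongrightarrow> h x * (\<bar>u x\<bar> powr \<alpha> * \<bar>u2 x\<bar> powr \<beta>)"
    using lim by eventually_elim (use \<alpha>\<beta> in \<open>auto intro!: tendsto_intros tendsto_powr'\<close>)
  show "AE x in L. norm (h x * (\<bar>w k x\<bar> powr \<alpha> * \<bar>v k x\<bar> powr \<beta>)) \<le> \<bar>h x\<bar> * (\<bar>W x\<bar> powr r + \<bar>W2 x\<bar> powr r)" for k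
    using le
  proof eventually_elim
    case (elim x)
    have "\<bar>w k x\<bar> powr \<alpha> * \<bar>v k x\<bar> powr \<beta> \<le> \<bar>W x\<bar> powr \<alpha> * \<bar>W2 x\<bar> powr \<beta>"
      using elim W(2)[of x] W(4)[of x] \<alpha>\<beta> by (intro mult_mono powr_mono2) auto
    also have "\<dots> \<le> \<bar>W x\<bar> powr r + \<bar>W2 x\<bar> powr r" using \<alpha>\<beta> by (intro powr_mult_le_sum) auto
    finally show ?case by (simp add: abs_mult mult_left_mono)
  qed
qed

text \<open>The energies of the two components are first made to converge along a subsequence. Each of them is
  lower semicontinuous, and only for convergent energies do the two bounds add up.\<close>

lemma functionals_compact:
  assumes w: "\<And>k. fst (w k) \<in> X0" "\<And>k. snd (w k) \<in> X0" and M: "\<And>k. A (w k) \<le> M"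
  shows "\<exists>w0\<in>X0 \<times> X0. \<exists>\<sigma> :: nat \<Rightarrow> nat. strict_mono \<sigma> \<and> (\<lambda>k. K (w (\<sigma> k))) \<longlonglongrightarrow> K w0 \<and>
    (\<lambda>k. B (w (\<sigma> k))) \<longlonglongrightarrow> B w0 \<and> (\<forall>c. (\<forall>\<^sub>F k in sequentially. A (w (\<sigma> k)) \<le> c) \<longrightarrow> A w0 \<le> c)"
proof -
  have E1: "E (fst (w k)) \<le> M" and E2: "E (snd (w k)) \<le> M" for k
    using M[of k] energy_nonneg[of s p \<Omega> "fst (w k)"] energy_nonneg[of s p \<Omega> "snd (w k)"] by (auto simp: A_def)
  have "E (fst (w k)) + E (snd (w k)) \<le> M" for k using M[of k] by (simp add: A_def)
  then obtain \<sigma>0 :: "nat \<Rightarrow> nat" and e1 e2 where \<sigma>0: "strict_mono \<sigma>0"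
    "(\<lambda>k. E (fst (w (\<sigma>0 k)))) \<longlonglongrightarrow> e1" "(\<lambda>k. E (snd (w (\<sigma>0 k)))) \<longlonglongrightarrow> e2"
    using convergent_subsequence_of_pair[of "\<lambda>k. E (fst (w k))" "\<lambda>k. E (snd (w k))" M] energy_nonneg by metis
  define M' where "M' = max M (measure lebesgue \<Omega> + S powr (- r / p) * \<bar>M\<bar> powr (r / p))"
  have b: "E u \<le> M' \<and> (\<integral>x. \<bar>u x\<bar> powr p \<partial>L) \<le> M'" if "u \<in> X0" "E u \<le> M" for u
    using that X0_Lp_bound[OF that] by (auto simp: M'_def)
  obtain u W and \<sigma>1 :: "nat \<Rightarrow> nat" where u: "strict_mono \<sigma>1" "u \<in> X0" "W \<in> Lspace L r" "\<And>x. 0 \<le> W x"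
    "AE x in L. \<forall>k. \<bar>fst (w (\<sigma>0 (\<sigma>1 k))) x\<bar> \<le> W x" "AE x in L. (\<lambda>k. fst (w (\<sigma>0 (\<sigma>1 k))) x) \<longlonglongrightarrow> u x"
    "\<forall>c. (\<forall>\<^sub>F k in sequentially. E (fst (w (\<sigma>0 (\<sigma>1 k)))) \<le> c) \<longrightarrow> E u \<le> c"
    by (rule X0_compact[of r "\<lambda>k. fst (w (\<sigma>0 k))" M']) (use w b E1 \<alpha>\<beta> gap in auto)
  obtain v W2 and \<sigma>2 :: "nat \<Rightarrow> nat" where v: "strict_mono \<sigma>2" "v \<in> X0" "W2 \<in> Lspace L r" "\<And>x. 0 \<le> W2 x"
    "AE x in L. \<forall>k. \<bar>snd (w (\<sigma>0 (\<sigma>1 (\<sigma>2 k)))) x\<bar> \<le> W2 x" "AE x in L. (\<lambda>k. snd (w (\<sigma>0 (\<sigma>1 (\<sigma>2 k)))) x) \<longlonglongrightarrow> v x"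
    "\<forall>c. (\<forall>\<^sub>F k in sequentially. E (snd (w (\<sigma>0 (\<sigma>1 (\<sigma>2 k))))) \<le> c) \<longrightarrow> E v \<le> c"
    by (rule X0_compact[of r "\<lambda>k. snd (w (\<sigma>0 (\<sigma>1 k)))" M']) (use w b E2 \<alpha>\<beta> gap in auto)
  define \<sigma> where "\<sigma> k = \<sigma>0 (\<sigma>1 (\<sigma>2 k))" for k
  have sm12: "strict_mono (\<lambda>k. \<sigma>1 (\<sigma>2 k))" using u(1) v(1) by (simp add: strict_mono_def)
  have sm: "strict_mono \<sigma>" using \<sigma>0(1) sm12 by (simp add: strict_mono_def \<sigma>_def)
  have uW: "AE x in L. \<forall>k. \<bar>fst (w (\<sigma> k)) x\<bar> \<le> W x" using u(5) by eventually_elim (simp add: \<sigma>_def)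
  have vW: "AE x in L. \<forall>k. \<bar>snd (w (\<sigma> k)) x\<bar> \<le> W2 x" using v(5) by (simp add: \<sigma>_def)
  have ul: "AE x in L. (\<lambda>k. fst (w (\<sigma> k)) x) \<longlonglongrightarrow> u x"
    using u(6)
  proof eventually_elim
    case (elim x)
    from LIMSEQ_subseq_LIMSEQ[OF this v(1)] show ?case by (simp add: \<sigma>_def comp_def)
  qed
  have vl: "AE x in L. (\<lambda>k. snd (w (\<sigma> k)) x) \<longlonglongrightarrow> v x" using v(6) by (simp add: \<sigma>_def)
  have Kl: "(\<lambda>k. K (w (\<sigma> k))) \<longlonglongrightarrow> K (u, v)"
    unfolding K_def fst_conv snd_conv
    by (intro tendsto_add weight_term_tendsto[OF f w(1) u(3,4) uW ul u(2)] weight_term_tendsto[OF g w(2) v(3,4) vW vl v(2)])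
  have Bl: "(\<lambda>k. B (w (\<sigma> k))) \<longlonglongrightarrow> B (u, v)"
    unfolding B_def fst_conv snd_conv
    by (intro tendsto_mult_left h_term_tendsto[OF w u(3,4) v(3,4) uW vW ul vl u(2) v(2)])
  have lim1: "(\<lambda>k. E (fst (w (\<sigma>0 (\<sigma>1 k))))) \<longlonglongrightarrow> e1"
    using LIMSEQ_subseq_LIMSEQ[OF \<sigma>0(2) u(1)] by (simp add: comp_def)
  have lim2: "(\<lambda>k. E (snd (w (\<sigma>0 (\<sigma>1 (\<sigma>2 k)))))) \<longlonglongrightarrow> e2"
    using LIMSEQ_subseq_LIMSEQ[OF \<sigma>0(3) sm12] by (simp add: comp_def)
  have lim1': "(\<lambda>k. E (fst (w (\<sigma>0 (\<sigma>1 (\<sigma>2 k)))))) \<longlonglongrightarrow> e1"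
    using LIMSEQ_subseq_LIMSEQ[OF lim1 v(1)] by (simp add: comp_def)
  have "E u \<le> e1"
  proof (rule field_le_epsilon)
    fix d :: real assume "0 < d"
    then have "\<forall>\<^sub>F k in sequentially. E (fst (w (\<sigma>0 (\<sigma>1 k)))) < e1 + d" using lim1 by (intro order_tendstoD(2)) auto
    then have "\<forall>\<^sub>F k in sequentially. E (fst (w (\<sigma>0 (\<sigma>1 k)))) \<le> e1 + d" by (rule eventually_mono) simp
    then show "E u \<le> e1 + d" using u(7) by blast
  qed
  moreover have "E v \<le> e2"
  proof (rule field_le_epsilon)
    fix d :: real assume "0 < d"
    then have "\<forall>\<^sub>F k in sequentially. E (snd (w (\<sigma>0 (\<sigma>1 (\<sigma>2 k))))) < e2 + d" using lim2 by (intro order_tendstoD(2)) auto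
    then have "\<forall>\<^sub>F k in sequentially. E (snd (w (\<sigma>0 (\<sigma>1 (\<sigma>2 k))))) \<le> e2 + d" by (rule eventually_mono) simp
    then show "E v \<le> e2 + d" using v(7) by blast
  qed
  moreover have "e1 + e2 \<le> c" if "\<forall>\<^sub>F k in sequentially. A (w (\<sigma> k)) \<le> c" for c
    using tendsto_add[OF lim1' lim2] that trivial_limit_sequentially
    by (intro tendsto_upperbound[of "\<lambda>k. A (w (\<sigma> k))"]) (auto simp: A_def \<sigma>_def)
  ultimately have "A (u, v) \<le> c" if "\<forall>\<^sub>F k in sequentially. A (w (\<sigma> k)) \<le> c" for c
    using that by (fastforce simp: A_def)
  then show ?thesis using u(2) v(2) sm Kl Bl by (intro bexI[of _ "(u, v)"] exI[of _ \<sigma>]) auto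
qed

lemma exists_critical_point:
  assumes T: "0 < T" "S powr (- q / p) * N powr ((p - q) / p) * T powr (q / p) + 2 * S powr (- r / p) * T powr (r / p) < T"
  shows "\<exists>w\<in>X0 \<times> X0. (0 < K w \<or> 0 < B w) \<and> (\<forall>z\<in>X0 \<times> X0. A' w z = K' w z + B' w z)"
proof -
  have sc: "(\<integral>x. c x * \<bar>t * u x + 0 * v x\<bar> powr q \<partial>L) = t powr q * (\<integral>x. c x * \<bar>u x\<bar> powr q \<partial>L)"
    if "0 < t" for t c and u v :: "real^'n \<Rightarrow> real"
  proof -
    have eq: "c x * \<bar>t * u x + 0 * v x\<bar> powr q = t powr q * (c x * \<bar>u x\<bar> powr q)" for x
      using that by (simp add: abs_mult powr_mult)
    show ?thesis unfolding eq by (rule integral_mult_right_zero)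
  qed
  have "concave_convex (X0 \<times> X0) pair_comb A K B A' K' B' p q r (S powr (- q / p) * N powr ((p - q) / p)) (2 * S powr (- r / p)) T"
  proof
    show "1 < q" "q < p" "p < r" using q \<alpha>\<beta> by auto
    show "0 \<le> S powr (- q / p) * N powr ((p - q) / p)" "0 < 2 * S powr (- r / p)" using S by auto
    show "0 < T" "S powr (- q / p) * N powr ((p - q) / p) * T powr (q / p) + 2 * S powr (- r / p) * T powr (r / p) < T"
      by (rule T)+
    show "\<exists>x\<in>X0 \<times> X0. 0 < B x"
      using h_active by (force simp: B_def)
    fix x y :: "(real^'n \<Rightarrow> real) \<times> (real^'n \<Rightarrow> real)" and a b t :: real
    show "pair_comb 1 x 0 y = x" by (simp add: pair_comb_def)
    show "0 \<le> A x" by (simp add: A_def energy_nonneg)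
    { assume t: "0 < t"
      have E: "E (\<lambda>x. t * u x + 0 * u x) = t powr p * E u" for u
        unfolding energy_def diff2_comb using integral_powr_scale[where c = t and f = "diff2 u" and r = p and M = G] t by simp
      show "A (pair_comb t x 0 x) = t powr p * A x"
        unfolding A_def pair_comb_def fst_conv snd_conv E by (simp add: distrib_left)
      show "K (pair_comb t x 0 x) = t powr q * K x"
        unfolding K_def pair_comb_def fst_conv snd_conv sc[OF t] by (simp add: distrib_left)
      have eq: "h z * (\<bar>t * u z + 0 * u z\<bar> powr \<alpha> * \<bar>t * v z + 0 * v z\<bar> powr \<beta>) = t powr r * (h z * (\<bar>u z\<bar> powr \<alpha> * \<bar>v z\<bar> powr \<beta>))" for u v z
        using t by (simp add: abs_mult powr_mult powr_add mult_ac)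
      show "B (pair_comb t x 0 x) = t powr r * B x"
        unfolding B_def pair_comb_def fst_conv snd_conv eq integral_mult_right_zero
        by (rule mult.left_commute) }
    assume x: "x \<in> X0 \<times> X0"
    then have x': "fst x \<in> X0" "snd x \<in> X0" by auto
    show "K x \<le> S powr (- q / p) * N powr ((p - q) / p) * A x powr (q / p)" by (rule K_growth[OF x'])
    show "B x \<le> 2 * S powr (- r / p) * A x powr (r / p)" by (rule B_growth[OF x'])
    assume y: "y \<in> X0 \<times> X0"
    then have y': "fst y \<in> X0" "snd y \<in> X0" by auto
    show "pair_comb a x b y \<in> X0 \<times> X0" using X0_comb x' y' by (simp add: pair_comb_def)
    show "((\<lambda>t. A (pair_comb 1 x t y)) has_real_derivative p * A' x y) (at 0)"
      unfolding A_def pair_comb_def A'_def fst_conv snd_conv distrib_left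
      by (intro DERIV_add DERIV_E x' y')
    show "((\<lambda>t. K (pair_comb 1 x t y)) has_real_derivative q * K' x y) (at 0)"
      unfolding K_def pair_comb_def K'_def fst_conv snd_conv distrib_left
      by (intro DERIV_add DERIV_weight x' y' f g)
    show "((\<lambda>t. B (pair_comb 1 x t y)) has_real_derivative r * B' x y) (at 0)"
    proof -
      have "R * (2 * \<alpha> / R * i + 2 * \<beta> / R * j) = 2 * (\<alpha> * i + \<beta> * j)" if "R \<noteq> 0" for R i j :: real
        using that by (simp add: field_simps)
      then have "r * (2 * \<alpha> / r * i + 2 * \<beta> / r * j) = 2 * (\<alpha> * i + \<beta> * j)" for i j :: real
        using r_gt by (metis less_irrefl)
      then show ?thesis
        unfolding B_def pair_comb_def B'_def fst_conv snd_conv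
        using DERIV_cmult[OF DERIV_h(1)[OF x' y'], of 2] by (simp only:)
    qed
    show "A' x (pair_comb a x b y) = a * A x + b * A' x y" by (rule A'_linear[OF x' y'])
    show "K' x (pair_comb a x b y) = a * K x + b * K' x y" by (rule K'_linear[OF x' y'])
    show "B' x (pair_comb a x b y) = a * B x + b * B' x y" by (rule B'_linear[OF x' y'])
  next
    fix w :: "nat \<Rightarrow> (real^'n \<Rightarrow> real) \<times> (real^'n \<Rightarrow> real)" and M
    assume "\<And>k. w k \<in> X0 \<times> X0" "\<And>k. A (w k) \<le> M"
    moreover from this have "\<And>k. fst (w k) \<in> X0" "\<And>k. snd (w k) \<in> X0" by (simp_all add: mem_Times_iff)
    ultimately show "\<exists>x0\<in>X0 \<times> X0. \<exists>\<sigma> :: nat \<Rightarrow> nat. strict_mono \<sigma> \<and> (\<lambda>k. K (w (\<sigma> k))) \<longlonglongrightarrow> K x0 \<and>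
        (\<lambda>k. B (w (\<sigma> k))) \<longlonglongrightarrow> B x0 \<and> (\<forall>c. (\<forall>\<^sub>F k in sequentially. A (w (\<sigma> k)) \<le> c) \<longrightarrow> A x0 \<le> c)"
      by (intro functionals_compact)
  qed
  then show ?thesis by (rule concave_convex.critical_point_exists)
qed

section \<open>Weak solutions\<close>

lemma X0_W_sp: "u \<in> X0 \<Longrightarrow> u \<in> W_sp s p \<Omega>"
proof -
  assume u: "u \<in> X0"
  have "set_integrable lebesgue (Q_set \<Omega>) (gagliardo_integrand s p u)"
    using set_integrable_gagliardo[OF open_domain X0_measurable[OF u]] X0_diff2[OF u] by simp
  then have "set_integrable lebesgue (\<Omega> \<times> \<Omega>) (gagliardo_integrand s p u)"
    by (rule set_integrable_subset) (use open_domain in \<open>auto simp: Q_set_def open_Times\<close>)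
  then show ?thesis using X0_Lspace[OF u] Lp_on_eq(1)[of \<Omega> p] by (simp add: W_sp_def)
qed

theorem exists_weak_solution:
  assumes T: "0 < T" "S powr (- q / p) * N powr ((p - q) / p) * T powr (q / p) + 2 * S powr (- r / p) * T powr (r / p) < T"
  shows "\<exists>u v. u \<in> W_sp s p \<Omega> \<and> v \<in> W_sp s p \<Omega> \<and> weak_solution s p q \<Omega> \<alpha> \<beta> f g h l m u v \<and>
    \<not> (AE x in lebesgue. u x = 0 \<and> v x = 0)"
proof -
  obtain u v where w: "u \<in> X0" "v \<in> X0" "0 < K (u, v) \<or> 0 < B (u, v)"
    "\<And>z. z \<in> X0 \<times> X0 \<Longrightarrow> A' (u, v) z = K' (u, v) z + B' (u, v) z"
    using exists_critical_point[OF T] by auto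
  have "weak_solution s p q \<Omega> \<alpha> \<beta> f g h l m u v"
    unfolding weak_solution_def
  proof (intro conjI ballI w(1,2))
    fix \<phi>1 \<phi>2 assume \<phi>: "\<phi>1 \<in> X0" "\<phi>2 \<in> X0"
    note F = set_integral_eq_lebesgue_on(2)[OF domain_sets(1)]
    have A': "frac_form s p \<Omega> u \<phi>1 + frac_form s p \<Omega> v \<phi>2 = A' (u, v) (\<phi>1, \<phi>2)"
      using w(1,2) \<phi> X0_measurable by (simp add: A'_def frac_form_eq[OF open_domain])
    have K': "set_lebesgue_integral lebesgue \<Omega>
            (\<lambda>x. l * f x * \<bar>u x\<bar> powr (q - 2) * u x * \<phi>1 x + m * g x * \<bar>v x\<bar> powr (q - 2) * v x * \<phi>2 x) = K' (u, v) (\<phi>1, \<phi>2)"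
    proof -
      have "(\<integral>x. l * f x * \<bar>u x\<bar> powr (q - 2) * u x * \<phi>1 x + m * g x * \<bar>v x\<bar> powr (q - 2) * v x * \<phi>2 x \<partial>L)
         = (\<integral>x. l * f x * (\<bar>u x\<bar> powr (q - 2) * u x * \<phi>1 x) + m * g x * (\<bar>v x\<bar> powr (q - 2) * v x * \<phi>2 x) \<partial>L)"
        by (simp only: mult.assoc)
      also have "\<dots> = K' (u, v) (\<phi>1, \<phi>2)"
        unfolding K'_def fst_conv snd_conv
        by (rule Bochner_Integration.integral_add[OF DERIV_weight(2)[OF f w(1) \<phi>(1)] DERIV_weight(2)[OF g w(2) \<phi>(2)]])
      finally show ?thesis by (simp only: F)
    qed
    have B': "2 * \<alpha> / r * set_lebesgue_integral lebesgue \<Omega> (\<lambda>x. h x * \<bar>u x\<bar> powr (\<alpha> - 2) * u x * \<bar>v x\<bar> powr \<beta> * \<phi>1 x)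
        + 2 * \<beta> / r * set_lebesgue_integral lebesgue \<Omega> (\<lambda>x. h x * \<bar>u x\<bar> powr \<alpha> * \<bar>v x\<bar> powr (\<beta> - 2) * v x * \<phi>2 x)
        = B' (u, v) (\<phi>1, \<phi>2)"
      unfolding F B'_def fst_conv snd_conv by (simp only: mult_ac)
    show "frac_form s p \<Omega> u \<phi>1 + frac_form s p \<Omega> v \<phi>2 =
          set_lebesgue_integral lebesgue \<Omega>
            (\<lambda>x. l * f x * \<bar>u x\<bar> powr (q - 2) * u x * \<phi>1 x + m * g x * \<bar>v x\<bar> powr (q - 2) * v x * \<phi>2 x) +
          2 * \<alpha> / r * set_lebesgue_integral lebesgue \<Omega> (\<lambda>x. h x * \<bar>u x\<bar> powr (\<alpha> - 2) * u x * \<bar>v x\<bar> powr \<beta> * \<phi>1 x) +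
          2 * \<beta> / r * set_lebesgue_integral lebesgue \<Omega> (\<lambda>x. h x * \<bar>u x\<bar> powr \<alpha> * \<bar>v x\<bar> powr (\<beta> - 2) * v x * \<phi>2 x)"
      using w(4)[of "(\<phi>1, \<phi>2)"] \<phi> A' K' B' by (simp add: add.assoc)
  qed
  moreover have "\<not> (AE x in lebesgue. u x = 0 \<and> v x = 0)"
  proof
    assume "AE x in lebesgue. u x = 0 \<and> v x = 0"
    then have ae: "AE x in L. u x = 0 \<and> v x = 0" by (rule AE_domain)
    have "AE x in L. l * f x * \<bar>u x\<bar> powr q = 0" "AE x in L. m * g x * \<bar>v x\<bar> powr q = 0"
      "AE x in L. h x * (\<bar>u x\<bar> powr \<alpha> * \<bar>v x\<bar> powr \<beta>) = 0"
      using ae by (eventually_elim, simp)+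
    then show False using w(3) by (simp only: K_def B_def fst_conv snd_conv integral_eq_zero_AE) simp
  qed
  ultimately show ?thesis using X0_W_sp w(1,2) by blast
qed

end

text \<open>A bump near a point where \<open>h\<close> is positive. It makes \<open>B\<close> positive somewhere, and it shows that the
  infimum defining the Sobolev constant runs over a nonempty set.\<close>

lemma (in fractional_domain) exists_active_bump:
  assumes h: "continuous_on (closure \<Omega>) h" "(SUP x\<in>closure \<Omega>. \<bar>h x\<bar>) = 1" "\<forall>x\<in>closure \<Omega>. 0 \<le> h x" and e: "0 < \<alpha>" "0 < \<beta>"
  shows "\<exists>w\<in>X0. \<not> (AE x in lebesgue. w x = 0) \<and> 0 < (\<integral>x. h x * (\<bar>w x\<bar> powr \<alpha> * \<bar>w x\<bar> powr \<beta>) \<partial>L)"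
proof -
  have comp: "compact (closure \<Omega>)" using bounded_domain by (simp add: compact_closure)
  have "\<exists>x0\<in>\<Omega>. 0 < h x0"
  proof (rule ccontr)
    assume "\<not> ?thesis"
    then have "\<And>x. x \<in> \<Omega> \<Longrightarrow> h x \<le> 0" by (auto simp: not_less)
    then have "h x \<le> 0" if "x \<in> closure \<Omega>" for x
      using continuous_le_on_closure[OF h(1) that] by blast
    then have "\<And>x. x \<in> closure \<Omega> \<Longrightarrow> \<bar>h x\<bar> = 0" using h(3) by force
    then have "(SUP x\<in>closure \<Omega>. \<bar>h x\<bar>) = 0" using domain_nonempty by simp
    then show False using h(2) by simp
  qed
  then obtain x0 where x0: "x0 \<in> \<Omega>" "0 < h x0" by blast
  have "continuous (at x0) h"
    using h(1) x0(1) open_domain by (metis closure_subset continuous_on_eq_continuous_at continuous_on_subset)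
  then have "\<forall>\<^sub>F x in nhds x0. 0 < h x"
    using x0(2) order_tendstoD(1)[of h "h x0" "nhds x0" 0] by (simp add: continuous_within tendsto_at_iff_tendsto_nhds)
  moreover have "\<forall>\<^sub>F x in nhds x0. x \<in> \<Omega>" using open_domain x0(1) by (rule eventually_nhds_in_open)
  ultimately have "\<forall>\<^sub>F x in nhds x0. 0 < h x \<and> x \<in> \<Omega>" by eventually_elim simp
  then obtain d where d: "d > 0" "\<And>x. dist x x0 < d \<Longrightarrow> 0 < h x \<and> x \<in> \<Omega>" by (auto simp: eventually_nhds_metric)
  have sub: "cball x0 (d / 2) \<subseteq> \<Omega>" using d by (auto simp: dist_commute)
  obtain \<phi> where \<phi>: "\<phi> \<in> test_functions \<Omega>" "\<And>x. 0 \<le> \<phi> x" "\<And>x. x \<in> ball x0 (d / 2) \<Longrightarrow> 0 < \<phi> x"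
    using bump_test_function[OF sub] d(1) by auto
  note T = test_functions_Lspace[OF \<phi>(1)]
  let ?F = "\<lambda>x. h x * (\<bar>\<phi> x\<bar> powr \<alpha> * \<bar>\<phi> x\<bar> powr \<beta>)"
  have hm: "h \<in> borel_measurable L"
    using continuous_imp_measurable_on_sets_lebesgue[OF continuous_on_subset[OF h(1) closure_subset]] by simp
  have h1: "\<bar>h x\<bar> \<le> 1" if "x \<in> closure \<Omega>" for x
  proof -
    have "bdd_above ((\<lambda>x. \<bar>h x\<bar>) ` closure \<Omega>)"
      using compact_continuous_image[OF continuous_on_rabs[OF h(1)] comp] by (intro bounded_imp_bdd_above compact_imp_bounded)
    from cSUP_upper[OF that this] show ?thesis using h(2) by simp
  qed
  have "\<phi> \<in> Lspace L (\<alpha> + \<beta>)" using T(2) e by simp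
  then have ipow: "integrable L (\<lambda>x. \<bar>\<phi> x\<bar> powr \<alpha> * \<bar>\<phi> x\<bar> powr \<beta>)"
    using Lspace_integrable by (fastforce simp: powr_add[symmetric])
  have int: "integrable L ?F"
  proof (rule Bochner_Integration.integrable_bound[OF ipow])
    show "?F \<in> borel_measurable L" using hm measurable_domain[OF T(1)] by measurable
    show "AE x in L. norm (?F x) \<le> norm (\<bar>\<phi> x\<bar> powr \<alpha> * \<bar>\<phi> x\<bar> powr \<beta>)"
      using h1 closure_subset by (intro AE_I2) (auto simp: abs_mult intro!: mult_left_le_one_le)
  qed
  have pos: "0 < ?F x" if "x \<in> ball x0 (d / 2)" for x
  proof -
    have "dist x x0 < d" using that d(1) by (simp add: dist_commute)
    then show ?thesis using \<phi>(3)[OF that] d(2) by simp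
  qed
  have notnull: "\<not> (AE x in lebesgue. x \<notin> ball x0 (d / 2))"
  proof
    assume "AE x in lebesgue. x \<notin> ball x0 (d / 2)"
    then have "x0 \<in> - ball x0 (d / 2)" by (intro mem_closed_if_AE_lebesgue) auto
    then show False using d(1) by simp
  qed
  have "\<not> (AE x in lebesgue. \<phi> x = 0)"
  proof
    assume "AE x in lebesgue. \<phi> x = 0"
    then have "AE x in lebesgue. x \<notin> ball x0 (d / 2)"
      by eventually_elim (use \<phi>(3) in force)
    then show False using notnull by blast
  qed
  moreover have "(\<integral>x. ?F x \<partial>L) \<noteq> 0"
  proof
    assume "(\<integral>x. ?F x \<partial>L) = 0"
    moreover have "AE x in L. 0 \<le> ?F x"
      using h(3) closure_subset by (intro AE_I2 mult_nonneg_nonneg) auto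
    ultimately have "AE x in L. ?F x = 0" using integral_nonneg_eq_0_iff_AE[OF int] by blast
    then have "AE x in lebesgue. x \<in> \<Omega> \<longrightarrow> ?F x = 0" by (simp add: AE_restrict_space_iff)
    then have "AE x in lebesgue. x \<notin> ball x0 (d / 2)"
    proof eventually_elim
      case (elim x)
      then show ?case using pos[of x] sub ball_subset_cball[of x0 "d / 2"] by force
    qed
    then show False using notnull by blast
  qed
  moreover have "0 \<le> (\<integral>x. ?F x \<partial>L)"
    using h(3) closure_subset by (intro integral_nonneg_AE AE_I2 mult_nonneg_nonneg) auto
  ultimately show ?thesis using test_functions_X0[OF \<phi>(1)] by (intro bexI[of _ \<phi>]) auto
qed

text \<open>A divergent integral has the value zero, and so has a quotient with denominator zero. Hence a
  positive Sobolev constant excludes functions whose power is not integrable over \<open>\<Omega>\<close>, and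
  integrability is part of the conclusion.\<close>

lemma (in fractional_domain) sobolev_const_inequality:
  assumes r: "r = \<alpha> + \<beta>" "0 < r" and S: "S = sobolev_const s p \<Omega> \<alpha> \<beta>" "0 < S" and u: "u \<in> X0"
  shows "u \<in> Lspace L r" "(\<integral>x. \<bar>u x\<bar> powr r \<partial>L) \<le> S powr (- r / p) * E u powr (r / p)"
proof -
  let ?I = "\<integral>x. \<bar>u x\<bar> powr r \<partial>L"
  have m: "u \<in> borel_measurable L" using measurable_domain[OF X0_measurable[OF u]] .
  have "u \<in> Lspace L r \<and> ?I \<le> S powr (- r / p) * E u powr (r / p)"
  proof (cases "AE x in lebesgue. u x = 0")
    case True
    then have ae: "AE x in L. u x = 0" by (rule AE_domain)
    have "u \<in> Lspace L r"
      by (rule LspaceI_dominated[OF m, of "\<lambda>x. 0"]) (use ae in auto)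
    moreover have "?I = 0" using ae by (intro integral_eq_zero_AE) (auto elim: eventually_mono)
    ultimately show ?thesis by simp
  next
    case False
    have nn: "0 \<le> ?I" by simp
    have val: "X0_norm s p \<Omega> v powr p / (set_lebesgue_integral lebesgue \<Omega> (\<lambda>x. \<bar>v x\<bar> powr (\<alpha> + \<beta>))) powr (p / (\<alpha> + \<beta>))
        = E v / (\<integral>x. \<bar>v x\<bar> powr r \<partial>L) powr (p / r)" if "v \<in> X0" for v
      using X0_norm_eq[OF open_domain X0_measurable[OF that], of s p] energy_nonneg[of s p \<Omega> v]
        set_integral_eq_lebesgue_on(2)[of \<Omega> "\<lambda>x. \<bar>v x\<bar> powr r"] by (simp add: r powr_powr)
    have "S \<le> X0_norm s p \<Omega> u powr p / (set_lebesgue_integral lebesgue \<Omega> (\<lambda>x. \<bar>u x\<bar> powr (\<alpha> + \<beta>))) powr (p / (\<alpha> + \<beta>))"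
      unfolding S(1) sobolev_const_def
      by (rule cINF_lower) (use u False in \<open>auto intro!: bdd_belowI[of _ 0]\<close>)
    then have le: "S \<le> E u / ?I powr (p / r)" unfolding val[OF u] .
    have I: "0 < ?I"
    proof (rule ccontr)
      assume "\<not> 0 < ?I"
      then have "?I = 0" using nn by linarith
      then show False using le S(2) by simp
    qed
    then have "integrable L (\<lambda>x. \<bar>u x\<bar> powr r)" using not_integrable_integral_eq by fastforce
    then have L: "u \<in> Lspace L r" using m by (simp add: Lspace_def)
    have "S * ?I powr (p / r) \<le> E u" using le I by (simp add: pos_le_divide_eq)
    then have "?I powr (p / r) \<le> E u / S" using S(2) by (simp add: pos_le_divide_eq mult.commute)
    then have "(?I powr (p / r)) powr (r / p) \<le> (E u / S) powr (r / p)"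
      using r by (intro powr_mono2) auto
    moreover have "(?I powr (p / r)) powr (r / p) = ?I" using r(2) nn by (simp add: powr_powr)
    moreover have "(E u / S) powr (r / p) = S powr (- r / p) * E u powr (r / p)"
      using powr_minus_divide[of S "r / p"] by (simp add: powr_divide)
    ultimately show ?thesis using L by simp
  qed
  then show "u \<in> Lspace L r" "?I \<le> S powr (- r / p) * E u powr (r / p)" by auto
qed

theorem theorem1p1:
  fixes \<Omega> :: "(real^'n) set"
    and s p q \<alpha> \<beta> :: real
    and f g h :: "real^'n \<Rightarrow> real"
  assumes "smooth_bounded_domain \<Omega>"
    and "0 < s" and "s < 1"
    and "p * s < real CARD('n)"
    and "1 < q" and "q < p"
    and "1 < \<alpha>" and "1 < \<beta>"
    and "p < \<alpha> + \<beta>"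
    and "\<alpha> + \<beta> < real CARD('n) * p / (real CARD('n) - p * s)"
    and "weight_cond_A \<Omega> q \<alpha> \<beta> f g"
    and "weight_cond_B \<Omega> h"
  shows "\<forall>(l, m)\<in>Theta_set s p q \<Omega> \<alpha> \<beta> f g.
           \<exists>u v. u \<in> W_sp s p \<Omega> \<and> v \<in> W_sp s p \<Omega> \<and>
                 weak_solution s p q \<Omega> \<alpha> \<beta> f g h l m u v \<and>
                 \<not> (AE x in lebesgue. u x = 0 \<and> v x = 0)"
proof clarify
  fix l m assume lm: "(l, m) \<in> Theta_set s p q \<Omega> \<alpha> \<beta> f g"
  interpret fractional_domain \<Omega> s p
    by unfold_locales (use assms in \<open>auto simp: smooth_bounded_domain_def\<close>)
  define S where "S = sobolev_const s p \<Omega> \<alpha> \<beta>"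
  define R where "R = \<alpha> + \<beta>"
  have R: "0 < R" "1 < R" "p < R" using assms by (auto simp: R_def)
  note H = assms(12)[unfolded weight_cond_B_def]
  have "0 < \<alpha>" "0 < \<beta>" using assms by auto
  then obtain w where w: "w \<in> X0" "\<not> (AE x in lebesgue. w x = 0)" "0 < (\<integral>x. h x * (\<bar>w x\<bar> powr \<alpha> * \<bar>w x\<bar> powr \<beta>) \<partial>L)"
    using exists_active_bump[of h \<alpha> \<beta>] H by blast
  define M where "M = (\<bar>l\<bar> * Lp_norm_on (q_star \<alpha> \<beta> q) \<Omega> f) powr (p / (p - q)) +
                 (\<bar>m\<bar> * Lp_norm_on (q_star \<alpha> \<beta> q) \<Omega> g) powr (p / (p - q))"
  have M: "0 < M" "M < C_const \<alpha> \<beta> p q S"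
    using lm by (auto simp: Theta_set_def M_def S_def Let_def)
  have S0: "0 \<le> S"
    unfolding S_def sobolev_const_def by (rule cINF_greatest) (use w in auto)
  have "S \<noteq> 0"
  proof
    assume "S = 0"
    then have "C_const \<alpha> \<beta> p q S = 0" by (simp add: C_const_def)
    then show False using M by simp
  qed
  then have S: "0 < S" using S0 by simp
  have gap: "0 < sobolev_gap CARD('n) s p R"
  proof -
    define n where "n = real CARD('n)"
    have n: "p * s < n" "R < n * p / (n - p * s)" using assms by (auto simp: n_def R_def)
    then have "R * (n - p * s) < n * p" by (simp add: pos_less_divide_eq)
    then have "n * (R - p) < s * (p * R)" by (simp add: algebra_simps)
    moreover have "0 < p * R" using R by simp
    ultimately have "n * (R - p) / (p * R) < s" by (simp add: pos_divide_less_eq)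
    moreover have "n * (R - p) / (p * R) = n * (1 / p - 1 / R)" using R by (simp add: field_simps)
    ultimately show ?thesis by (simp add: sobolev_gap_def n_def)
  qed
  have hb: "h x \<le> 1" if "x \<in> closure \<Omega>" for x
  proof -
    have "compact (closure \<Omega>)" using bounded_domain by (simp add: compact_closure)
    then have "bdd_above ((\<lambda>x. \<bar>h x\<bar>) ` closure \<Omega>)"
      using H by (intro bounded_imp_bdd_above compact_imp_bounded compact_continuous_image continuous_on_rabs) auto
    from cSUP_upper[OF that this] have "\<bar>h x\<bar> \<le> 1"
      unfolding H[THEN conjunct2, THEN conjunct1] .
    then show ?thesis by simp
  qed
  interpret concave_convex_system \<Omega> s p q \<alpha> \<beta> l m S f g h
  proof unfold_locales
    show "1 < q" "q < p" "1 < \<alpha>" "1 < \<beta>" "p < \<alpha> + \<beta>" "0 < S" using assms S by auto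
    show "0 < sobolev_gap CARD('n) s p (\<alpha> + \<beta>)" using gap by (simp add: R_def)
    show "f \<in> Lspace L (q_star \<alpha> \<beta> q)" "g \<in> Lspace L (q_star \<alpha> \<beta> q)"
      using assms(11) Lp_on_eq(1)[of \<Omega>] by (auto simp: weight_cond_A_def)
    show "h \<in> borel_measurable L"
      using continuous_imp_measurable_on_sets_lebesgue[OF continuous_on_subset[OF H[THEN conjunct1] closure_subset]]
      by simp
    show "0 \<le> h x" "h x \<le> 1" if "x \<in> \<Omega>" for x using that H hb closure_subset by auto
    show "u \<in> Lspace L (\<alpha> + \<beta>)" "(\<integral>x. \<bar>u x\<bar> powr (\<alpha> + \<beta>) \<partial>L) \<le> S powr (- (\<alpha> + \<beta>) / p) * E u powr ((\<alpha> + \<beta>) / p)"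
      if "u \<in> X0" for u
      using sobolev_const_inequality[OF refl _ S_def S that] R by (auto simp: R_def)
    show "\<exists>w\<in>X0. 0 < (\<integral>x. h x * (\<bar>w x\<bar> powr \<alpha> * \<bar>w x\<bar> powr \<beta>) \<partial>L)" using w by blast
  qed
  have N: "N = M"
    using Lp_on_eq(2)[of \<Omega>] by (simp add: N_def M_def Nf_def Ng_def)
  have less: "N < ((p - q) / (2 * (\<alpha> + \<beta> - q)) * S powr ((\<alpha> + \<beta>) / p)) powr (p / (\<alpha> + \<beta> - p)) *
      (S powr (- q / p) * ((\<alpha> + \<beta> - q) / (\<alpha> + \<beta> - p))) powr (- (p / (p - q)))"
    using M(2) unfolding N C_const_def .
  have "0 \<le> N" using M(1) by (simp add: N)
  note T = threshold_inequality[OF assms(5,6,9) S this less]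
  show "\<exists>u v. u \<in> W_sp s p \<Omega> \<and> v \<in> W_sp s p \<Omega> \<and>
                 weak_solution s p q \<Omega> \<alpha> \<beta> f g h l m u v \<and>
                 \<not> (AE x in lebesgue. u x = 0 \<and> v x = 0)"
    by (rule exists_weak_solution[OF T])
qed

end
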